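(* Let $\nu>0$ and $\boldsymbol f\in[L^2(\Omega)]^d$. The discrete problem: find $\boldsymbol u_h\in \boldsymbol V_h^0$ and $p_h\in W_h^0$ such that $$a(\boldsymbol u_h,\boldsymbol v)+c(\boldsymbol u_h,\boldsymbol u_h,\boldsymbol v)-b(\boldsymbol v,p_h)=(\boldsymbol f,\mathcal R\boldsymbol v)\quad\forall \boldsymbol v\in\boldsymbol V_h^0,\qquad b(\boldsymbol u_h,q)=0\quad\forall q\in W_h^0,$$ has at least one solution $\boldsymbol u_h\in\boldsymbol D_h$ and $p_h\in W_h^0$.
   Context: Setting. $\Omega\subset\mathbb R^d$ ($d=2,3$) is a bounded connected Lipschitz domain, $\mathcal T_h$ a shape-regular (conforming) partition of $\Omega$ into triangles ($d=2$) or tetrahedra ($d=3$), $\mathcal E_h$ the set of all edges ($d=2$) or faces ($d=3$), $h_T$ the diameter of $T$, $h=\max_T h_T$. $(\cdot,\cdot)_D$ and $\langle\cdot,\cdot\rangle_{\partial T}$ are $L^2$ inner products on $D$ and $\partial T$ (subscript omitted for $D=\Omega$). On $\partial T$, $\boldsymbol n$ is the unit outward normal; each $e\in\mathcal E_h$ has one assigned unit normal $\boldsymbol n_e$. For $d=2$, $\boldsymbol n\times\boldsymbol v=n_1v_2-n_2v_1$, $\nabla\times\boldsymbol w=\partial_xw_2-\partial_yw_1$ and $(\nabla\times\boldsymbol w)\times\boldsymbol z=(\nabla\times\boldsymbol w)(-z_2,z_1)^{\mathrm T}$. Spaces. $\mathrm{CG}=\{\boldsymbol v\in[H^1(\Omega)]^d:\boldsymbol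 v|_T\in[P_1(T)]^d\ \forall T\in\mathcal T_h\}$; $\mathrm{DG}=\{v\in L^2(\mathcal E_h): v|_e\in P_0(e)\ \forall e\in\mathcal E_h\}$; $\boldsymbol V_h=\{\boldsymbol v=\{\boldsymbol v_0,v_b\}:\boldsymbol v_0\in\mathrm{CG},\ v_b\in\mathrm{DG}\}$; $\boldsymbol V_h^0=\{\boldsymbol v\in\boldsymbol V_h:\boldsymbol v_0=0,\ v_b=0\text{ on }\partial\Omega\}$; $W_h^0$ is the space of functions that are constant on each $T\in\mathcal T_h$ and have zero mean over $\Omega$. Operators. For $\boldsymbol v\in\boldsymbol V_h$: the modified gradient $\nabla_m\boldsymbol v$ is the piecewise constant $d\times d$ matrix field with $(\nabla_m\boldsymbol v,\sigma)_T=\langle v_b\,\boldsymbol n_e\cdot\boldsymbol n,\ \boldsymbol n\cdot\sigma\cdot\boldsymbol n\rangle_{\partial T}+\langle\boldsymbol n\times\boldsymbol v_0,\ \boldsymbol n\times\sigma\cdot\boldsymbol n\rangle_{\partial T}$ for all constant matrices $\sigma$ and all $T$ (here $\sigma\cdot\boldsymbol n$ is the matrix-vector product); the modified divergence $\nabla_m\cdot\boldsymbol v$ is the piecewise constant function with $(\nabla_m\cdot\boldsymbol v,\varphi)_T=\langle v_b\,\boldsymbol n_e\cdot\boldsymbol n,\varphi\rangle_{\partial T}$ for all constants $\varphi$ and all $T$. $\mathcal R:\boldsymbol V_h\to H(\operatorname{div};\Omega)$ maps $\boldsymbol v$ to the unique function in the lowest-order Raviart–Thomas space (local space $[P_0(T)]^d\oplus\boldsymbol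 xP_0(T)$) with $\int_e\mathcal R\boldsymbol v\cdot\boldsymbol n_e\,ds=\int_ev_b\,ds$ for all $e\in\mathcal E_h$. $Q_b$ is the $L^2$ projection of $L^2(\mathcal E_h)$ onto $\mathrm{DG}$, and $v_{0,n}|_e=\boldsymbol v_0|_e\cdot\boldsymbol n_e$. Forms. $a(\boldsymbol w,\boldsymbol v)=\nu(\nabla_m\boldsymbol w,\nabla_m\boldsymbol v)+s(\boldsymbol w,\boldsymbol v)$, $s(\boldsymbol w,\boldsymbol v)=\nu\sum_{T\in\mathcal T_h}h_T^{-1}\langle Q_bw_{0,n}-w_b,\ Q_bv_{0,n}-v_b\rangle_{\partial T}$, $c(\boldsymbol w,\boldsymbol z,\boldsymbol v)=((\nabla\times\boldsymbol w_0)\times\mathcal R\boldsymbol z,\ \mathcal R\boldsymbol v)$, $b(\boldsymbol w,q)=(\nabla_m\cdot\boldsymbol w,q)$. $\boldsymbol D_h=\{\boldsymbol v\in\boldsymbol V_h^0:\nabla_m\cdot\boldsymbol v=0\}$. *)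

theory Defs
  imports "HOL-Analysis.Analysis"
begin

section \<open>Vector calculus\<close>

definition pdiff :: "'d::finite \<Rightarrow> (real^'d \<Rightarrow> real) \<Rightarrow> real^'d \<Rightarrow> real" where
  "pdiff j f x = frechet_derivative f (at x) (axis j 1)"

definition cross2 :: "real^2 \<Rightarrow> real^2 \<Rightarrow> real" where
  "cross2 n v = n $ 1 * v $ 2 - n $ 2 * v $ 1"

text \<open>
  The partial derivatives in the curls are pointwise. They are applied to continuous piecewise
  affine fields only, for which they exist in the interior of every simplex, hence almost
  everywhere, and are the weak derivatives.
\<close>

definition curl2 :: "(real^2 \<Rightarrow> real^2) \<Rightarrow> real^2 \<Rightarrow> real" where
  "curl2 w x = pdiff 1 (\<lambda>y. w y $ 2) x - pdiff 2 (\<lambda>y. w y $ 1) x"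

definition curl3 :: "(real^3 \<Rightarrow> real^3) \<Rightarrow> real^3 \<Rightarrow> real^3" where
  "curl3 w x = vector
     [pdiff 2 (\<lambda>y. w y $ 3) x - pdiff 3 (\<lambda>y. w y $ 2) x,
      pdiff 3 (\<lambda>y. w y $ 1) x - pdiff 1 (\<lambda>y. w y $ 3) x,
      pdiff 1 (\<lambda>y. w y $ 2) x - pdiff 2 (\<lambda>y. w y $ 1) x]"

text \<open>
  The two operations whose form depends on the dimension, \<open>n \<times> v\<close> and
  \<open>((\<nabla> \<times> w) \<times> z)(x)\<close>, are passed to the dimension-independent definitions below as
  the parameters \<open>crs\<close> and \<open>ccrs\<close>. The intended values are \<open>cross2\<close>, \<open>curl_cross2\<close> for
  \<open>d = 2\<close> and \<open>cross3\<close>, \<open>curl_cross3\<close> for \<open>d = 3\<close>.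
\<close>

definition curl_cross2 :: "(real^2 \<Rightarrow> real^2) \<Rightarrow> (real^2 \<Rightarrow> real^2) \<Rightarrow> real^2 \<Rightarrow> real^2" where
  "curl_cross2 w z x = curl2 w x *\<^sub>R vector [- (z x $ 2), z x $ 1]"

definition curl_cross3 :: "(real^3 \<Rightarrow> real^3) \<Rightarrow> (real^3 \<Rightarrow> real^3) \<Rightarrow> real^3 \<Rightarrow> real^3" where
  "curl_cross3 w z x = cross3 (curl3 w x) (z x)"


section \<open>Function spaces\<close>

definition L2 :: "'a measure \<Rightarrow> ('a \<Rightarrow> 'b::euclidean_space) \<Rightarrow> bool" where
  "L2 M f \<longleftrightarrow> f \<in> borel_measurable M \<and> integrable M (\<lambda>x. (norm (f x))\<^sup>2)"

definition inner_L2 :: "'a measure \<Rightarrow> ('a \<Rightarrow> 'b::real_inner) \<Rightarrow> ('a \<Rightarrow> 'b) \<Rightarrow> real" where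
  "inner_L2 M f g = (LINT x|M. f x \<bullet> g x)"

definition smooth :: "(real^'d::finite \<Rightarrow> real) \<Rightarrow> bool" where
  "smooth f \<longleftrightarrow> (\<forall>js. foldr pdiff js f differentiable_on UNIV)"

definition test_functions :: "(real^'d::finite) set \<Rightarrow> (real^'d \<Rightarrow> real) set" where
  "test_functions \<Omega> = {\<phi>. smooth \<phi> \<and> compact (closure {x. \<phi> x \<noteq> 0}) \<and> closure {x. \<phi> x \<noteq> 0} \<subseteq> \<Omega>}"

definition H1 :: "(real^'d::finite) set \<Rightarrow> (real^'d \<Rightarrow> real) set" where
  "H1 \<Omega> = {u. L2 (lebesgue_on \<Omega>) u \<and>
     (\<forall>j. \<exists>g. L2 (lebesgue_on \<Omega>) g \<and>
        (\<forall>\<phi>\<in>test_functions \<Omega>.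
           inner_L2 (lebesgue_on \<Omega>) u (pdiff j \<phi>) = - inner_L2 (lebesgue_on \<Omega>) g \<phi>))}"

definition Hdiv :: "(real^'d::finite) set \<Rightarrow> (real^'d \<Rightarrow> real^'d) set" where
  "Hdiv \<Omega> = {r. L2 (lebesgue_on \<Omega>) r \<and>
     (\<exists>g. L2 (lebesgue_on \<Omega>) g \<and>
        (\<forall>\<phi>\<in>test_functions \<Omega>.
           inner_L2 (lebesgue_on \<Omega>) r (\<lambda>x. \<chi> j. pdiff j \<phi> x) = - inner_L2 (lebesgue_on \<Omega>) g \<phi>))}"


section \<open>Domain and mesh\<close>

text \<open>
  Locally \<open>\<Omega>\<close> is the set below the graph of a Lipschitz function, in coordinates whose last
  axis is \<open>a\<close>.
\<close>

definition lipschitz_domain :: "(real^'d::finite) set \<Rightarrow> bool" where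
  "lipschitz_domain \<Omega> \<longleftrightarrow> open \<Omega> \<and> connected \<Omega> \<and> bounded \<Omega> \<and> \<Omega> \<noteq> {} \<and>
     (\<forall>x\<in>frontier \<Omega>. \<exists>a r C g. norm a = 1 \<and> 0 < r \<and> C-lipschitz_on {y. a \<bullet> y = 0} g \<and>
        (\<forall>y\<in>ball x r. y \<in> \<Omega> \<longleftrightarrow> a \<bullet> y < g (y - (a \<bullet> y) *\<^sub>R a)))"

definition inball_diameter :: "(real^'d::finite) set \<Rightarrow> real" where
  "inball_diameter T = Sup {2 * r | r. 0 \<le> r \<and> (\<exists>x. cball x r \<subseteq> T)}"

text \<open>
  \<^const>\<open>triangulation\<close> is the conformity condition: two simplices meet in a common face. The
  simplices are closed and \<open>\<gamma>\<close> is the shape-regularity constant.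
\<close>

definition shape_regular_mesh :: "real \<Rightarrow> (real^'d::finite) set \<Rightarrow> (real^'d) set set \<Rightarrow> bool" where
  "shape_regular_mesh \<gamma> \<Omega> Th \<longleftrightarrow>
     triangulation Th \<and> (\<forall>T\<in>Th. int CARD('d) simplex T) \<and> \<Union>Th = closure \<Omega> \<and>
     (\<forall>T\<in>Th. diameter T \<le> \<gamma> * inball_diameter T)"

definition faces :: "(real^'d::finite) set set \<Rightarrow> (real^'d) set set" where
  "faces Th = {e. \<exists>T\<in>Th. e facet_of T}"

definition face_normals :: "(real^'d::finite) set set \<Rightarrow> ((real^'d) set \<Rightarrow> real^'d) \<Rightarrow> bool" where
  "face_normals Th ne \<longleftrightarrow>
     (\<forall>e\<in>faces Th. norm (ne e) = 1 \<and> (\<forall>x\<in>e. \<forall>y\<in>e. ne e \<bullet> (x - y) = 0))"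

definition outward_normal :: "(real^'d::finite) set \<Rightarrow> (real^'d) set \<Rightarrow> real^'d" where
  "outward_normal T e = (THE n. norm n = 1 \<and> (\<forall>x\<in>T. \<forall>y\<in>e. n \<bullet> x \<le> n \<bullet> y))"

text \<open>
  The \<open>(d - 1)\<close>-dimensional surface measure on a flat face \<open>e\<close>. For \<open>A \<subseteq> e\<close> the slab of
  thickness \<open>1\<close> over \<open>A\<close>, centred at the hyperplane \<open>affine hull e\<close>, has \<open>d\<close>-dimensional Lebesgue
  measure equal to the \<open>(d - 1)\<close>-dimensional measure of \<open>A\<close>; \<open>closest_point (affine hull e)\<close> is the
  orthogonal projection onto that hyperplane.
\<close>

definition face_measure :: "(real^'d::finite) set \<Rightarrow> (real^'d) measure" where
  "face_measure e = (let P = closest_point (affine hull e) in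
     distr (restrict_space lborel {x. P x \<in> e \<and> dist x (P x) \<le> 1/2}) (restrict_space borel e) P)"

text \<open>
  Functions on the union of faces that may take different values on different faces (such as
  \<open>v\<^sub>b\<close> or the outward normal) are families \<open>f e x\<close>, with \<open>e\<close> a face and \<open>x \<in> e\<close>.
\<close>

definition inner_bdry ::
  "(real^'d::finite) set \<Rightarrow> ((real^'d) set \<Rightarrow> real^'d \<Rightarrow> 'b::real_inner) \<Rightarrow>
   ((real^'d) set \<Rightarrow> real^'d \<Rightarrow> 'b) \<Rightarrow> real" where
  "inner_bdry T f g = (\<Sum>e | e facet_of T. inner_L2 (face_measure e) (f e) (g e))"


section \<open>Discrete spaces\<close>

text \<open>
  Functions are total on \<open>real^'d\<close>; only their values on \<open>closure \<Omega>\<close> (for \<open>DG\<close>: on the faces,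
  for piecewise constants: in the interiors of the simplices) are meaningful, and nothing below
  depends on the others. A member of \<open>CG\<close> is represented by its continuous representative,
  affine on each closed simplex, so that its traces are its pointwise values.
\<close>

definition CG :: "(real^'d::finite) set \<Rightarrow> (real^'d) set set \<Rightarrow> (real^'d \<Rightarrow> real^'d) set" where
  "CG \<Omega> Th = {v. (\<forall>i. (\<lambda>x. v x $ i) \<in> H1 \<Omega>) \<and>
     (\<forall>T\<in>Th. \<exists>(A::real^'d^'d) c. \<forall>x\<in>T. v x = A *v x + c)}"

definition DG :: "(real^'d::finite) set set \<Rightarrow> ((real^'d) set \<Rightarrow> real^'d \<Rightarrow> real) set" where
  "DG Th = {m. (\<forall>e\<in>faces Th. L2 (face_measure e) (m e)) \<and>
     (\<forall>e\<in>faces Th. \<exists>c. \<forall>x\<in>e. m e x = c)}"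

definition piecewise_const :: "(real^'d::finite) set set \<Rightarrow> (real^'d \<Rightarrow> 'b) set" where
  "piecewise_const Th = {q. \<forall>T\<in>Th. \<exists>c. \<forall>x\<in>interior T. q x = c}"

definition Wh0 :: "(real^'d::finite) set \<Rightarrow> (real^'d) set set \<Rightarrow> (real^'d \<Rightarrow> real) set" where
  "Wh0 \<Omega> Th = {q \<in> piecewise_const Th. (LINT x|lebesgue_on \<Omega>. q x) = 0}"

text \<open>A pair \<open>v = {v\<^sub>0, v\<^sub>b}\<close>.\<close>

type_synonym 'd weak_fun = "(real^'d \<Rightarrow> real^'d) \<times> ((real^'d) set \<Rightarrow> real^'d \<Rightarrow> real)"

definition Vh :: "(real^'d::finite) set \<Rightarrow> (real^'d) set set \<Rightarrow> 'd weak_fun set" where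
  "Vh \<Omega> Th = CG \<Omega> Th \<times> DG Th"

definition Vh0 :: "(real^'d::finite) set \<Rightarrow> (real^'d) set set \<Rightarrow> 'd weak_fun set" where
  "Vh0 \<Omega> Th = {v \<in> Vh \<Omega> Th. (\<forall>x\<in>frontier \<Omega>. fst v x = 0) \<and>
     (\<forall>e\<in>faces Th. e \<subseteq> frontier \<Omega> \<longrightarrow> (\<forall>x\<in>e. snd v e x = 0))}"


section \<open>Discrete operators\<close>

text \<open>
  Below, \<open>SOME\<close> picks an object that is determined by the condition up to the irrelevant values
  described above.
\<close>

definition grad_m ::
  "(real^'d \<Rightarrow> real^'d \<Rightarrow> 'c::real_inner) \<Rightarrow> (real^'d::finite) set set \<Rightarrow>
   ((real^'d) set \<Rightarrow> real^'d) \<Rightarrow> 'd weak_fun \<Rightarrow> real^'d \<Rightarrow> real^'d^'d" where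
  "grad_m crs Th ne v = (SOME G. G \<in> piecewise_const Th \<and>
     (\<forall>T\<in>Th. \<forall>\<sigma>::real^'d^'d.
        inner_L2 (lebesgue_on T) G (\<lambda>_. \<sigma>) =
          inner_bdry T (\<lambda>e x. snd v e x * (ne e \<bullet> outward_normal T e))
                       (\<lambda>e x. outward_normal T e \<bullet> (\<sigma> *v outward_normal T e)) +
          inner_bdry T (\<lambda>e x. crs (outward_normal T e) (fst v x))
                       (\<lambda>e x. crs (outward_normal T e) (\<sigma> *v outward_normal T e))))"

definition div_m ::
  "(real^'d::finite) set set \<Rightarrow> ((real^'d) set \<Rightarrow> real^'d) \<Rightarrow> 'd weak_fun \<Rightarrow> real^'d \<Rightarrow> real" where
  "div_m Th ne v = (SOME g. g \<in> piecewise_const Th \<and>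
     (\<forall>T\<in>Th. \<forall>\<phi>::real.
        inner_L2 (lebesgue_on T) g (\<lambda>_. \<phi>) =
          inner_bdry T (\<lambda>e x. snd v e x * (ne e \<bullet> outward_normal T e)) (\<lambda>e x. \<phi>)))"

text \<open>
  On \<open>T\<close> the Raviart--Thomas function is \<open>a + b x\<close>, and this polynomial gives its (single-valued)
  normal trace on the faces of \<open>T\<close>.
\<close>

definition RT_interp ::
  "(real^'d::finite) set \<Rightarrow> (real^'d) set set \<Rightarrow> ((real^'d) set \<Rightarrow> real^'d) \<Rightarrow>
   'd weak_fun \<Rightarrow> real^'d \<Rightarrow> real^'d" where
  "RT_interp \<Omega> Th ne v = (SOME r. r \<in> Hdiv \<Omega> \<and>
     (\<forall>T\<in>Th. \<exists>a b. (\<forall>x\<in>interior T. r x = a + b *\<^sub>R x) \<and>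
        (\<forall>e. e facet_of T \<longrightarrow>
           (LINT x|face_measure e. (a + b *\<^sub>R x) \<bullet> ne e) = (LINT x|face_measure e. snd v e x))))"

definition Qb ::
  "(real^'d::finite) set set \<Rightarrow> ((real^'d) set \<Rightarrow> real^'d \<Rightarrow> real) \<Rightarrow>
   (real^'d) set \<Rightarrow> real^'d \<Rightarrow> real" where
  "Qb Th g = (SOME m. m \<in> DG Th \<and>
     (\<forall>\<mu>\<in>DG Th. (\<Sum>e\<in>faces Th. inner_L2 (face_measure e) (\<lambda>x. g e x - m e x) (\<mu> e)) = 0))"

definition normal_comp ::
  "((real^'d::finite) set \<Rightarrow> real^'d) \<Rightarrow> 'd weak_fun \<Rightarrow> (real^'d) set \<Rightarrow> real^'d \<Rightarrow> real" where
  "normal_comp ne v e x = fst v x \<bullet> ne e"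


section \<open>Forms and the discrete problem\<close>

definition s_form ::
  "real \<Rightarrow> (real^'d::finite) set set \<Rightarrow> ((real^'d) set \<Rightarrow> real^'d) \<Rightarrow>
   'd weak_fun \<Rightarrow> 'd weak_fun \<Rightarrow> real" where
  "s_form \<nu> Th ne w v = \<nu> * (\<Sum>T\<in>Th. inverse (diameter T) *
     inner_bdry T (\<lambda>e x. Qb Th (normal_comp ne w) e x - snd w e x)
                  (\<lambda>e x. Qb Th (normal_comp ne v) e x - snd v e x))"

definition a_form ::
  "(real^'d \<Rightarrow> real^'d \<Rightarrow> 'c::real_inner) \<Rightarrow> real \<Rightarrow> (real^'d::finite) set \<Rightarrow>
   (real^'d) set set \<Rightarrow> ((real^'d) set \<Rightarrow> real^'d) \<Rightarrow> 'd weak_fun \<Rightarrow> 'd weak_fun \<Rightarrow> real" where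
  "a_form crs \<nu> \<Omega> Th ne w v =
     \<nu> * inner_L2 (lebesgue_on \<Omega>) (grad_m crs Th ne w) (grad_m crs Th ne v) + s_form \<nu> Th ne w v"

definition c_form ::
  "((real^'d \<Rightarrow> real^'d) \<Rightarrow> (real^'d \<Rightarrow> real^'d) \<Rightarrow> real^'d \<Rightarrow> real^'d) \<Rightarrow>
   (real^'d::finite) set \<Rightarrow> (real^'d) set set \<Rightarrow> ((real^'d) set \<Rightarrow> real^'d) \<Rightarrow>
   'd weak_fun \<Rightarrow> 'd weak_fun \<Rightarrow> 'd weak_fun \<Rightarrow> real" where
  "c_form ccrs \<Omega> Th ne w z v =
     inner_L2 (lebesgue_on \<Omega>) (ccrs (fst w) (RT_interp \<Omega> Th ne z)) (RT_interp \<Omega> Th ne v)"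

definition b_form ::
  "(real^'d::finite) set \<Rightarrow> (real^'d) set set \<Rightarrow> ((real^'d) set \<Rightarrow> real^'d) \<Rightarrow>
   'd weak_fun \<Rightarrow> (real^'d \<Rightarrow> real) \<Rightarrow> real" where
  "b_form \<Omega> Th ne w q = inner_L2 (lebesgue_on \<Omega>) (div_m Th ne w) q"

definition Dh ::
  "(real^'d::finite) set \<Rightarrow> (real^'d) set set \<Rightarrow> ((real^'d) set \<Rightarrow> real^'d) \<Rightarrow> 'd weak_fun set" where
  "Dh \<Omega> Th ne = {v \<in> Vh0 \<Omega> Th. AE x in lebesgue_on \<Omega>. div_m Th ne v x = 0}"

definition discrete_solution ::
  "(real^'d \<Rightarrow> real^'d \<Rightarrow> 'c::real_inner) \<Rightarrow>
   ((real^'d \<Rightarrow> real^'d) \<Rightarrow> (real^'d \<Rightarrow> real^'d) \<Rightarrow> real^'d \<Rightarrow> real^'d) \<Rightarrow>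
   real \<Rightarrow> (real^'d::finite) set \<Rightarrow> (real^'d) set set \<Rightarrow> ((real^'d) set \<Rightarrow> real^'d) \<Rightarrow>
   (real^'d \<Rightarrow> real^'d) \<Rightarrow> 'd weak_fun \<Rightarrow> (real^'d \<Rightarrow> real) \<Rightarrow> bool" where
  "discrete_solution crs ccrs \<nu> \<Omega> Th ne f u p \<longleftrightarrow>
     u \<in> Vh0 \<Omega> Th \<and> p \<in> Wh0 \<Omega> Th \<and>
     (\<forall>v\<in>Vh0 \<Omega> Th.
        a_form crs \<nu> \<Omega> Th ne u v + c_form ccrs \<Omega> Th ne u u v - b_form \<Omega> Th ne v p =
          inner_L2 (lebesgue_on \<Omega>) f (RT_interp \<Omega> Th ne v)) \<and>
     (\<forall>q\<in>Wh0 \<Omega> Th. b_form \<Omega> Th ne u q = 0)"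

end

theory Submission
  imports Defs "HOL-Library.Function_Algebras" "HOL-Homology.Homology"
begin

text \<open>
  On the discretely divergence-free subspace the problem is a finite-dimensional equation
  \<open>a(u,v) + c(u,u,v) = (f,\<R>v)\<close> with \<open>c(u,v,v) = 0\<close>, so in \<open>a\<close>-orthonormal coordinates the residual
  points outwards on a large sphere and has a zero because spheres are not contractible. Only the
  kernel of \<open>a\<close> has to be understood: if \<open>a(v,v) = 0\<close> then \<open>v\<^sub>b\<close> is the mean normal component of
  \<open>v\<^sub>0\<close>, integration by parts identifies the modified gradient with \<open>\<nabla>v\<^sub>0\<close>, and the boundary condition
  forces \<open>v\<^sub>0 = 0\<close>, then \<open>v\<^sub>b = 0\<close>. The residual, a linear functional on all of the space that vanishes
  on the common kernel of the divergences on the simplices, is a combination of them, and the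
  coefficients are the pressure.

  Gauss' theorem on a simplex comes from the radial fields \<open>x - w\<close> at its vertices \<open>w\<close>: such a field is
  tangential to all facets except the one opposite to \<open>w\<close>. These fields also form a basis of the local
  Raviart--Thomas space, so \<open>\<R>v\<close> exists, is unique, and lies in \<open>H(div)\<close> since the fluxes
  through interior facets cancel.
\<close>

section \<open>Galerkin systems\<close>

text \<open>Members of \<open>Vh\<close> are total functions whose values off the mesh are free, so
  \<open>Vh\<close> is infinite-dimensional as a vector space and \<open>a\<close> is only
  semidefinite on it. For this reason \<open>a\<close> is written as a finite sum of squares of
  linear functionals, dimension is counted modulo their common kernel, and the energy argument is
  used in the form that the load and the convective term do not see this kernel. The discrete
  operators are choices, determined only in the interiors of the simplices, so their linearity
  cannot be read off from the definitions. Explicit values per facet and per simplex take their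
  place in all algebraic arguments. Only existence is claimed, without a bound on the pressure, so
  the multipliers come from pure linear algebra and no inf-sup constant enters. The convective term
  is skew pointwise: the same reconstruction stands in both slots of a vector product.\<close>

instantiation "fun" :: (type, real_vector) real_vector
begin

text \<open>Pointwise scaling makes the pairs \<open>{v_0, v_b}\<close> elements of a real vector
  space, so that \<open>subspace\<close> and linear combinations are available for
  \<open>weak_fun\<close>.\<close>

definition scaleR_fun_def: "c *\<^sub>R f = (\<lambda>x. c *\<^sub>R f x)"

instance
  by standard (simp_all add: scaleR_fun_def plus_fun_def fun_eq_iff scaleR_add_right scaleR_add_left)

end

lemma scaleR_fun_apply [simp]: "(c *\<^sub>R f) x = c *\<^sub>R f x"
  by (simp add: scaleR_fun_def)

section \<open>Zeros of maps that point outwards on a sphere\<close>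

abbreviation coord_sphere :: "nat \<Rightarrow> (nat \<Rightarrow> real) set"
  where "coord_sphere n \<equiv> {x. (\<Sum>i\<le>n. (x i)\<^sup>2) = 1 \<and> (\<forall>i>n. x i = 0)}"

lemma nsphere_eq_top_of_set: "nsphere n = top_of_set (coord_sphere n)"
  by (simp add: nsphere euclidean_product_topology Collect_conj_eq Int_commute)

text \<open>A family without zeros can be divided by its length. Points of
  \<open>coord_sphere n\<close> are sequences supported on \<open>0..n\<close>, so \<open>N\<close>
  also cuts off the later coordinates, about which nothing is assumed for \<open>h\<close>.\<close>

lemma homotopic_normalized:
  fixes h :: "real \<Rightarrow> (nat \<Rightarrow> real) \<Rightarrow> nat \<Rightarrow> real"
  assumes cont: "\<And>i. i \<le> n \<Longrightarrow> continuous_on ({0..1} \<times> coord_sphere n) (\<lambda>p. h (fst p) (snd p) i)"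
    and nz: "\<And>t x. t \<in> {0..1} \<Longrightarrow> x \<in> coord_sphere n \<Longrightarrow> \<exists>i\<le>n. h t x i \<noteq> 0"
  defines "N \<equiv> \<lambda>y i. if i \<le> n then y i / sqrt (\<Sum>j\<le>n. (y j)\<^sup>2) else 0"
  shows "homotopic_with_canon (\<lambda>x. True) (coord_sphere n) (coord_sphere n)
           (\<lambda>x. N (h 0 x)) (\<lambda>x. N (h 1 x))"
proof -
  have pos: "(\<Sum>j\<le>n. (h t x j)\<^sup>2) > 0" if tx: "t \<in> {0..1}" "x \<in> coord_sphere n" for t x
  proof -
    obtain i where "i \<le> n" "h t x i \<noteq> 0" using nz[OF tx] by blast
    then show ?thesis by (intro sum_pos2[of _ i]) auto
  qed
  have nrm: "N (h t x) \<in> coord_sphere n" if "t \<in> {0..1}" "x \<in> coord_sphere n" for t x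
  proof -
    have "(\<Sum>i\<le>n. (N (h t x) i)\<^sup>2) = (\<Sum>i\<le>n. (h t x i)\<^sup>2 / (\<Sum>j\<le>n. (h t x j)\<^sup>2))"
      using pos[OF that] by (intro sum.cong) (auto simp: N_def power_divide)
    also have "\<dots> = 1"
      using pos[OF that] by (simp flip: sum_divide_distrib)
    finally show ?thesis by (simp add: N_def)
  qed
  have cN: "continuous_on ({0..1} \<times> coord_sphere n) (\<lambda>p. N (h (fst p) (snd p)))"
  proof (rule continuous_on_coordinatewise_then_product)
    fix i
    have p: "sqrt (\<Sum>j\<le>n. (h (fst p) (snd p) j)\<^sup>2) \<noteq> 0" if "p \<in> {0..1} \<times> coord_sphere n" for p
      using pos[of "fst p" "snd p"] that by (auto simp: less_le)
    show "continuous_on ({0..1} \<times> coord_sphere n) (\<lambda>p. N (h (fst p) (snd p)) i)"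
    proof (cases "i \<le> n")
      case True
      then show ?thesis unfolding N_def
        using p by (auto intro!: continuous_intros cont)
    qed (simp add: N_def)
  qed
  show ?thesis
    unfolding homotopic_with_def
  proof (intro exI conjI allI ballI)
    let ?h = "\<lambda>p. N (h (fst p) (snd p))"
    show "continuous_map (prod_topology (top_of_set {0..1}) (top_of_set (coord_sphere n)))
            (top_of_set (coord_sphere n)) ?h"
    proof -
      have "?h \<in> {0..1} \<times> coord_sphere n \<rightarrow> coord_sphere n"
        by (rule Pi_I, rule nrm) (simp_all only: mem_Times_iff)
      then show ?thesis
        using cN unfolding subtopology_Times [symmetric] by (simp del: mem_Collect_eq)
    qed
  qed auto
qed

text \<open>The dimension \<open>n + 1\<close> is a number here, not a type. If \<open>P\<close> had no zero, its normalization would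
  contract the \<open>n\<close>-sphere: \<open>P\<close> is homotopic to the identity on the sphere of radius \<open>R\<close>, and
  to a constant through smaller spheres.\<close>

lemma coercive_has_zero:
  fixes P :: "(nat \<Rightarrow> real) \<Rightarrow> nat \<Rightarrow> real"
  assumes cont: "\<And>i. i \<le> n \<Longrightarrow> continuous_on UNIV (\<lambda>x. P x i)"
    and R: "R > 0"
    and coercive: "\<And>x. (\<Sum>i\<le>n. (x i)\<^sup>2) = R\<^sup>2 \<Longrightarrow> (\<Sum>i\<le>n. P x i * x i) > 0"
  shows "\<exists>x. \<forall>i\<le>n. P x i = 0"
proof (rule ccontr)
  assume "\<not> ?thesis"
  then have nz: "\<exists>i\<le>n. P x i \<noteq> 0" for x by blast
  let ?S = "coord_sphere n"
  define N :: "(nat \<Rightarrow> real) \<Rightarrow> nat \<Rightarrow> real" where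
    "N = (\<lambda>y i. if i \<le> n then y i / sqrt (\<Sum>j\<le>n. (y j)\<^sup>2) else 0)"
  let ?h1 = "\<lambda>t x i. (1 - t) * x i + t * P (\<lambda>j. R * x j) i"
  let ?h2 = "\<lambda>t x i. P (\<lambda>j. (1 - t) * R * x j) i"
  have cP: "continuous_on A (\<lambda>p. P (f p) i)" if "i \<le> n" "continuous_on A f"
    for A :: "(real \<times> (nat \<Rightarrow> real)) set" and f i
    using continuous_on_compose2[OF cont[OF that(1)] that(2)] by simp
  have cx: "continuous_on A (\<lambda>p. snd p j)" for A :: "(real \<times> (nat \<Rightarrow> real)) set" and j :: nat
    by (rule continuous_on_product_then_coordinatewise) (intro continuous_intros)
  have 1: "homotopic_with_canon (\<lambda>x. True) ?S ?S (\<lambda>x. N (?h1 0 x)) (\<lambda>x. N (?h1 1 x))"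
    unfolding N_def
  proof (rule homotopic_normalized)
    show "continuous_on ({0..1} \<times> ?S) (\<lambda>p. ?h1 (fst p) (snd p) i)" if "i \<le> n" for i
      by (intro continuous_intros cx cP that continuous_on_coordinatewise_then_product)
  next
    fix t :: real and x assume t: "t \<in> {0..1}" and x: "x \<in> ?S"
    have pos: "(\<Sum>i\<le>n. P (\<lambda>j. R * x j) i * (R * x i)) > 0"
      using x by (intro coercive) (simp add: power_mult_distrib flip: sum_distrib_left)
    \<comment> \<open>Testing against \<open>x\<close> itself: on the unit sphere this is a convex
      combination of \<open>1\<close> and a positive number, so the segment from \<open>x\<close> to
      \<open>P (R x)\<close> avoids zero.\<close>
    have *: "(\<Sum>i\<le>n. ?h1 t x i * x i) = (1 - t) + t * ((\<Sum>i\<le>n. P (\<lambda>j. R * x j) i * (R * x i)) / R)"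
    proof -
      have "(\<Sum>i\<le>n. ?h1 t x i * x i)
        = (1 - t) * (\<Sum>i\<le>n. (x i)\<^sup>2) + t * ((\<Sum>i\<le>n. P (\<lambda>j. R * x j) i * (R * x i)) / R)"
        using R by (simp add: sum_distrib_left sum.distrib algebra_simps power2_eq_square
            sum_divide_distrib sum_subtractf)
      then show ?thesis using x by simp
    qed
    have "(\<Sum>i\<le>n. ?h1 t x i * x i) > 0"
    proof (cases "t = 1")
      case True
      then show ?thesis unfolding * using pos R by simp
    next
      case False
      then show ?thesis unfolding * using pos R t
        by (intro add_pos_nonneg mult_nonneg_nonneg) auto
    qed
    then have "\<not> (\<forall>i\<le>n. ?h1 t x i = 0)"
      by (metis (no_types, lifting) atMost_iff less_irrefl mult_zero_left sum.neutral)
    then show "\<exists>i\<le>n. ?h1 t x i \<noteq> 0" by blast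
  qed
  \<comment> \<open>Coercivity says nothing about the smaller spheres; this homotopy avoids zero
    because \<open>P\<close> is assumed to have no zero at all.\<close>
  have 2: "homotopic_with_canon (\<lambda>x. True) ?S ?S (\<lambda>x. N (?h2 0 x)) (\<lambda>x. N (?h2 1 x))"
    unfolding N_def
  proof (rule homotopic_normalized)
    show "continuous_on ({0..1} \<times> ?S) (\<lambda>p. ?h2 (fst p) (snd p) i)" if "i \<le> n" for i
      by (intro continuous_intros cx cP that continuous_on_coordinatewise_then_product)
  qed (rule nz)
  have "homotopic_with_canon (\<lambda>x. True) ?S ?S (\<lambda>x. N (?h1 0 x)) (\<lambda>x. N (?h2 1 x))"
    using homotopic_with_trans[OF 1] 2 by simp
  then have 3: "homotopic_with_canon (\<lambda>x. True) ?S ?S id (\<lambda>x. N (P (\<lambda>j. 0)))"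
    by (rule homotopic_with_eq) (auto simp: N_def fun_eq_iff)
  then have "contractible_space (nsphere n)"
    unfolding contractible_space_def nsphere_eq_top_of_set by blast
  then show False using non_contractible_space_nsphere by blast
qed

section \<open>Linear functionals and semi-inner products on a subspace\<close>

text \<open>Linearity is relative to \<open>V\<close> because functionals such as
  \<open>face_moment\<close> are integrals, additive only for integrable arguments, and others rest
  on the affine form of \<open>v_0\<close> on a simplex.\<close>

definition linear_on_subspace :: "'v::real_vector set \<Rightarrow> ('v \<Rightarrow> 'b::real_vector) \<Rightarrow> bool" where
  "linear_on_subspace V f \<longleftrightarrow>
     (\<forall>u\<in>V. \<forall>v\<in>V. f (u + v) = f u + f v) \<and> (\<forall>r. \<forall>v\<in>V. f (r *\<^sub>R v) = r *\<^sub>R f v)"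

lemma linear_on_subspaceI:
  assumes "\<And>u v. u \<in> V \<Longrightarrow> v \<in> V \<Longrightarrow> f (u + v) = f u + f v"
    and "\<And>r v. v \<in> V \<Longrightarrow> f (r *\<^sub>R v) = r *\<^sub>R f v"
  shows "linear_on_subspace V f"
  using assms by (auto simp: linear_on_subspace_def)

lemma linear_on_subspaceD:
  assumes "linear_on_subspace V f"
  shows "u \<in> V \<Longrightarrow> v \<in> V \<Longrightarrow> f (u + v) = f u + f v"
    and "v \<in> V \<Longrightarrow> f (r *\<^sub>R v) = r *\<^sub>R f v"
  using assms by (auto simp: linear_on_subspace_def)

lemma linear_on_subspace_mono:
  "linear_on_subspace V f \<Longrightarrow> W \<subseteq> V \<Longrightarrow> linear_on_subspace W f"
  by (simp add: linear_on_subspace_def subset_iff)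

lemma linear_on_subspace_0:
  assumes "linear_on_subspace V f" "subspace V"
  shows "f 0 = 0"
  using linear_on_subspaceD(2)[OF assms(1), of 0 0] subspace_0[OF assms(2)] by simp

lemma linear_on_subspace_diff:
  assumes "linear_on_subspace V f" "subspace V" "u \<in> V" "v \<in> V"
  shows "f (u - v) = f u - f v"
proof -
  have "f (u + (-1) *\<^sub>R v) = f u + (-1) *\<^sub>R f v"
    using assms subspace_scale[of V v "-1"] by (metis linear_on_subspaceD)
  then show ?thesis by simp
qed

lemma linear_on_subspace_sum:
  assumes f: "linear_on_subspace V f" and V: "subspace V" and e: "\<And>i. i \<in> I \<Longrightarrow> e i \<in> V"
  shows "f (\<Sum>i\<in>I. x i *\<^sub>R e i) = (\<Sum>i\<in>I. x i *\<^sub>R f (e i))"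
  using e
proof (induction I rule: infinite_finite_induct)
  case (insert j I)
  then have "(\<Sum>i\<in>I. x i *\<^sub>R e i) \<in> V" "x j *\<^sub>R e j \<in> V"
    using V by (auto intro: subspace_sum subspace_scale)
  then show ?case using insert by (simp add: linear_on_subspaceD[OF f])
qed (auto simp: linear_on_subspace_0[OF f V])

text \<open>The functionals are eliminated one at a time. Finiteness is asked of \<open>K\<close>
  only, not of the dimension of \<open>V\<close>. The coefficients will become the pressure.\<close>

lemma functional_in_span:
  fixes F :: "'v::real_vector \<Rightarrow> real"
  assumes "finite K" "subspace V" "linear_on_subspace V F"
    and "\<And>k. k \<in> K \<Longrightarrow> linear_on_subspace V (l k)"
    and "\<And>v. v \<in> V \<Longrightarrow> (\<forall>k\<in>K. l k v = 0) \<Longrightarrow> F v = 0"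
  shows "\<exists>c. \<forall>v\<in>V. F v = (\<Sum>k\<in>K. c k * l k v)"
  using assms
proof (induction K arbitrary: F rule: finite_induct)
  case empty
  then show ?case by simp
next
  case (insert j K)
  show ?case
  proof (cases "\<exists>w\<in>V. (\<forall>k\<in>K. l k w = 0) \<and> l j w \<noteq> 0")
    \<comment> \<open>\<open>l j\<close> vanishes wherever the others do, so it imposes nothing new
      and gets the coefficient \<open>0\<close>.\<close>
    case False
    then have "\<exists>c. \<forall>v\<in>V. F v = (\<Sum>k\<in>K. c k * l k v)"
      using insert.prems by (intro insert.IH) auto
    then obtain c where "\<forall>v\<in>V. F v = (\<Sum>k\<in>K. c k * l k v)" by blast
    then show ?thesis using insert.hyps
      by (intro exI[of _ "c(j := 0)"]) (auto intro!: sum.cong)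
  next
    case True
    then obtain w where w: "w \<in> V" "\<forall>k\<in>K. l k w = 0" "l j w \<noteq> 0" by blast
    \<comment> \<open>The value at \<open>w\<close>, where all functionals in \<open>K\<close>
      vanish, forces this coefficient. Below, \<open>z\<close> is \<open>v\<close> moved along
      \<open>w\<close> until \<open>l j\<close> vanishes as well.\<close>
    define d where "d = F w / l j w"
    let ?G = "\<lambda>v. F v - d * l j v"
    have "\<exists>c. \<forall>v\<in>V. ?G v = (\<Sum>k\<in>K. c k * l k v)"
    proof (rule insert.IH)
      show "subspace V" by fact
      show "linear_on_subspace V (l k)" if "k \<in> K" for k using insert.prems that by auto
      show "linear_on_subspace V ?G"
        using insert.prems(2) insert.prems(3)[of j]
        by (auto simp: linear_on_subspace_def algebra_simps)
      fix v assume v: "v \<in> V" "\<forall>k\<in>K. l k v = 0"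
      define z where "z = v - (l j v / l j w) *\<^sub>R w"
      have sw: "(l j v / l j w) *\<^sub>R w \<in> V" using insert.prems w by (simp add: subspace_scale)
      have z: "z \<in> V" using insert.prems v sw by (simp add: z_def subspace_diff)
      have lz: "f z = f v - (l j v / l j w) * f w" if "linear_on_subspace V f" for f :: "'v \<Rightarrow> real"
        unfolding z_def
        using linear_on_subspace_diff[OF that insert.prems(1) v(1) sw] linear_on_subspaceD(2)[OF that w(1)]
        by simp
      have "F z = 0"
      proof (rule insert.prems(4)[OF z], rule ballI)
        fix k assume k: "k \<in> insert j K"
        have "l k z = l k v - (l j v / l j w) * l k w"
          by (rule lz) (use insert.prems k in auto)
        then show "l k z = 0" using k v w by auto
      qed
      then show "?G v = 0" using lz[OF insert.prems(2)] by (simp add: d_def)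
    qed
    then obtain c where "\<forall>v\<in>V. ?G v = (\<Sum>k\<in>K. c k * l k v)" by blast
    then have c: "\<And>v. v \<in> V \<Longrightarrow> F v = d * l j v + (\<Sum>k\<in>K. c k * l k v)"
      by (simp add: algebra_simps)
    show ?thesis
    proof (intro exI ballI)
      fix v assume "v \<in> V"
      have "(\<Sum>k\<in>K. (c(j := d)) k * l k v) = (\<Sum>k\<in>K. c k * l k v)"
        using insert.hyps by (intro sum.cong) auto
      then show "F v = (\<Sum>k\<in>insert j K. (c(j := d)) k * l k v)"
        using c[OF \<open>v \<in> V\<close>] insert.hyps by simp
    qed
  qed
qed

text \<open>Summing Bessel's inequality for the unit vectors over \<open>K\<close>.\<close>

lemma orthonormal_family_card_le:
  fixes y :: "nat \<Rightarrow> 'k \<Rightarrow> real"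
  assumes K: "finite K"
    and on: "\<And>i j. i < n \<Longrightarrow> j < n \<Longrightarrow> (\<Sum>k\<in>K. y i k * y j k) = (if i = j then 1 else 0)"
  shows "n \<le> card K"
proof -
  have bessel: "(\<Sum>i<n. (y i k)\<^sup>2) \<le> 1" if k: "k \<in> K" for k
  proof -
    let ?b = "\<Sum>i<n. (y i k)\<^sup>2"
    let ?d = "\<lambda>m. if m = k then 1 else 0 :: real"
    \<comment> \<open>The projection of the unit vector \<open>?d\<close> onto the family. Its inner
      product with \<open>?d\<close> and its squared length are both \<open>?b\<close>, so the
      squared distance of \<open>?d\<close> and \<open>?z\<close> is \<open>1 - ?b\<close>.\<close>
    let ?z = "\<lambda>m. \<Sum>i<n. y i k * y i m"
    have 1: "(\<Sum>m\<in>K. ?d m * ?z m) = ?b"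
      using k K by (simp add: power2_eq_square if_distrib[of "\<lambda>c. c * _"] cong: if_cong)
    have "(\<Sum>m\<in>K. (?z m)\<^sup>2) = (\<Sum>m\<in>K. \<Sum>i<n. \<Sum>j<n. y i k * y j k * (y i m * y j m))"
      by (simp add: power2_eq_square sum_product mult_ac)
    also have "\<dots> = (\<Sum>i<n. \<Sum>j<n. \<Sum>m\<in>K. y i k * y j k * (y i m * y j m))"
      by (subst sum.swap, rule sum.cong[OF refl], subst sum.swap, rule refl)
    also have "\<dots> = (\<Sum>i<n. \<Sum>j<n. y i k * y j k * (if i = j then 1 else 0))"
      by (simp add: on flip: sum_distrib_left)
    also have "\<dots> = ?b"
      by (simp add: power2_eq_square if_distrib[of "\<lambda>c. _ * c"] cong: if_cong)
    finally have 2: "(\<Sum>m\<in>K. (?z m)\<^sup>2) = ?b" .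
    have 3: "(\<Sum>m\<in>K. (?d m)\<^sup>2) = 1"
      using k K by (simp add: if_distrib[of "\<lambda>c. c ^ 2"] cong: if_cong)
    have "0 \<le> (\<Sum>m\<in>K. (?d m - ?z m)\<^sup>2)" by (simp add: sum_nonneg)
    also have "\<dots> = (\<Sum>m\<in>K. (?d m)\<^sup>2 + (?z m)\<^sup>2 - 2 * (?d m * ?z m))"
      by (simp add: power2_diff mult.assoc)
    also have "\<dots> = (\<Sum>m\<in>K. (?d m)\<^sup>2) + (\<Sum>m\<in>K. (?z m)\<^sup>2) - 2 * (\<Sum>m\<in>K. ?d m * ?z m)"
      by (simp only: sum.distrib sum_subtractf sum_distrib_left)
    finally show ?thesis unfolding 1 2 3 by simp
  qed
  have "real n = (\<Sum>i<n. \<Sum>k\<in>K. (y i k)\<^sup>2)"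
    by (simp add: on power2_eq_square)
  also have "\<dots> = (\<Sum>k\<in>K. \<Sum>i<n. (y i k)\<^sup>2)" by (rule sum.swap)
  also have "\<dots> \<le> (\<Sum>k\<in>K. 1)" by (intro sum_mono bessel)
  finally show ?thesis by simp
qed

text \<open>A longest \<open>a\<close>-orthonormal family exists since \<open>card K\<close> bounds
  the length. A remainder of positive energy could be normalized and appended; hence remainders have
  energy zero, though they need not be zero themselves.\<close>

lemma orthonormal_basis_modulo_null:
  fixes l :: "'k \<Rightarrow> 'v::real_vector \<Rightarrow> real"
  assumes K: "finite K" and V: "subspace V"
    and l: "\<And>k. k \<in> K \<Longrightarrow> linear_on_subspace V (l k)"
    and a_def: "\<And>u v. a u v = (\<Sum>k\<in>K. l k u * l k v)"
  shows "\<exists>(n::nat) e. (\<forall>i<n. e i \<in> V) \<and>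
    (\<forall>i<n. \<forall>j<n. a (e i) (e j) = (if i = j then 1 else 0)) \<and>
    (\<forall>v\<in>V. a (v - (\<Sum>i<n. a v (e i) *\<^sub>R e i)) (v - (\<Sum>i<n. a v (e i) *\<^sub>R e i)) = 0)"
proof -
  define Q where "Q n e \<longleftrightarrow> (\<forall>i<n. e i \<in> V) \<and>
    (\<forall>i<n. \<forall>j<n. a (e i) (e j) = (if i = j then 1 else 0))" for n :: nat and e :: "nat \<Rightarrow> 'v"
  have lin: "linear_on_subspace V (\<lambda>u. a u v)" for v
    using l unfolding a_def linear_on_subspace_def
    by (auto simp: algebra_simps sum.distrib sum_distrib_left)
  have sym: "a u v = a v u" for u v by (simp add: a_def mult.commute)
  have "\<exists>n. (\<exists>e. Q n e) \<and> (\<forall>m. (\<exists>e. Q m e) \<longrightarrow> m \<le> n)"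
  proof (rule Nat.ex_has_greatest_nat)
    show "\<exists>e. Q 0 e" by (simp add: Q_def)
    show "\<forall>m. (\<exists>e. Q m e) \<longrightarrow> m \<le> card K"
    proof clarify
      fix m e assume "Q m e"
      then show "m \<le> card K"
        using orthonormal_family_card_le[OF K, of m "\<lambda>i k. l k (e i)"] by (auto simp: Q_def a_def)
    qed
  qed
  then obtain n e where Qn: "Q n e" and max: "\<And>m e. Q m e \<Longrightarrow> m \<le> n" by blast
  have eV: "e i \<in> V" and on: "j < n \<Longrightarrow> a (e i) (e j) = (if i = j then 1 else 0)" if "i < n" for i j
    using Qn that by (auto simp: Q_def)
  have null: "a (v - (\<Sum>i<n. a v (e i) *\<^sub>R e i)) (v - (\<Sum>i<n. a v (e i) *\<^sub>R e i)) = 0"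
    if v: "v \<in> V" for v
  proof (rule ccontr)
    define r where "r = v - (\<Sum>i<n. a v (e i) *\<^sub>R e i)"
    assume "a (v - (\<Sum>i<n. a v (e i) *\<^sub>R e i)) (v - (\<Sum>i<n. a v (e i) *\<^sub>R e i)) \<noteq> 0"
    then have "a r r \<noteq> 0" by (simp add: r_def)
    moreover have "a r r \<ge> 0" by (simp add: a_def sum_nonneg)
    ultimately have pos: "a r r > 0" by simp
    have sV: "(\<Sum>i<n. a v (e i) *\<^sub>R e i) \<in> V"
      using V eV by (intro subspace_sum subspace_scale) auto
    then have rV: "r \<in> V" using V v by (simp add: r_def subspace_diff)
    have re: "a r (e j) = 0" if j: "j < n" for j
    proof -
      have "a r (e j) = a v (e j) - (\<Sum>i<n. a v (e i) *\<^sub>R a (e i) (e j))"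
        unfolding r_def linear_on_subspace_diff[OF lin V v sV]
        by (subst linear_on_subspace_sum[OF lin V]) (auto simp: eV)
      also have "\<dots> = 0"
        using j by (simp add: on if_distrib[of "\<lambda>c. _ * c"] cong: if_cong)
      finally show ?thesis .
    qed
    define e' where "e' = e(n := (1 / sqrt (a r r)) *\<^sub>R r)"
    have sc: "a ((1 / sqrt (a r r)) *\<^sub>R r) w = a r w / sqrt (a r r)" for w
      using linear_on_subspaceD(2)[OF lin rV] by simp
    have "Q (Suc n) e'"
      unfolding Q_def
    proof (intro conjI allI impI)
      fix i j assume i: "i < Suc n" and j: "j < Suc n"
      show "e' i \<in> V" using i rV V eV by (auto simp: e'_def less_Suc_eq subspace_scale)
      have "a ((1 / sqrt (a r r)) *\<^sub>R r) ((1 / sqrt (a r r)) *\<^sub>R r) = 1"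
        unfolding sc sym[of r "_ *\<^sub>R r"] using pos by simp
      moreover have "a ((1 / sqrt (a r r)) *\<^sub>R r) (e k) = 0" if "k < n" for k
        by (simp add: sc re that)
      moreover from this have "a (e k) ((1 / sqrt (a r r)) *\<^sub>R r) = 0" if "k < n" for k
        using that by (subst sym) simp
      ultimately show "a (e' i) (e' j) = (if i = j then 1 else 0)"
        using i j unfolding e'_def less_Suc_eq by (elim disjE) (simp_all add: on)
    qed
    then show False using max[of "Suc n" e'] by simp
  qed
  show ?thesis
    using eV on null by (intro exI[of _ n] exI[of _ e]) blast
qed

text \<open>By \<open>skew\<close>, testing the residual with \<open>u\<close> leaves only energy
  and load, which fixes its sign on a large sphere. By \<open>null\<close>, the equation is blind to
  test vectors of energy zero, so it is enough that finitely many coordinates of the residual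
  vanish.\<close>

lemma galerkin_solution:
  fixes l :: "'k \<Rightarrow> 'v::real_vector \<Rightarrow> real" and c :: "'v \<Rightarrow> 'v \<Rightarrow> 'v \<Rightarrow> real"
  assumes K: "finite K" and V: "subspace V"
    and l: "\<And>k. k \<in> K \<Longrightarrow> linear_on_subspace V (l k)"
    and c1: "\<And>u v. u \<in> V \<Longrightarrow> v \<in> V \<Longrightarrow> linear_on_subspace V (\<lambda>w. c w u v)"
    and c2: "\<And>u v. u \<in> V \<Longrightarrow> v \<in> V \<Longrightarrow> linear_on_subspace V (\<lambda>w. c u w v)"
    and c3: "\<And>u v. u \<in> V \<Longrightarrow> v \<in> V \<Longrightarrow> linear_on_subspace V (\<lambda>w. c u v w)"
    and skew: "\<And>u v. u \<in> V \<Longrightarrow> v \<in> V \<Longrightarrow> c u v v = 0"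
    and F: "linear_on_subspace V F"
    and null: "\<And>v. v \<in> V \<Longrightarrow> (\<forall>k\<in>K. l k v = 0) \<Longrightarrow> F v = 0 \<and> (\<forall>u\<in>V. c u u v = 0)"
  shows "\<exists>u\<in>V. \<forall>v\<in>V. (\<Sum>k\<in>K. l k u * l k v) + c u u v = F v"
proof -
  define a where "a u v = (\<Sum>k\<in>K. l k u * l k v)" for u v
  have "\<exists>(n::nat) e. (\<forall>i<n. e i \<in> V) \<and>
      (\<forall>i<n. \<forall>j<n. a (e i) (e j) = (if i = j then 1 else 0)) \<and>
      (\<forall>v\<in>V. a (v - (\<Sum>i<n. a v (e i) *\<^sub>R e i)) (v - (\<Sum>i<n. a v (e i) *\<^sub>R e i)) = 0)"
    by (rule orthonormal_basis_modulo_null[OF K V _ a_def]) (rule l)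
  then obtain n :: nat and e
    where "(\<forall>i<n. e i \<in> V) \<and>
      (\<forall>i<n. \<forall>j<n. a (e i) (e j) = (if i = j then 1 else 0)) \<and>
      (\<forall>v\<in>V. a (v - (\<Sum>i<n. a v (e i) *\<^sub>R e i)) (v - (\<Sum>i<n. a v (e i) *\<^sub>R e i)) = 0)"
    by (elim exE) (rule that)
  then have eV: "\<And>i. i < n \<Longrightarrow> e i \<in> V"
    and on: "\<And>i j. i < n \<Longrightarrow> j < n \<Longrightarrow> a (e i) (e j) = (if i = j then 1 else 0)"
    and an: "\<And>v. v \<in> V \<Longrightarrow> a (v - (\<Sum>i<n. a v (e i) *\<^sub>R e i)) (v - (\<Sum>i<n. a v (e i) *\<^sub>R e i)) = 0"
    by (simp_all only: simp_thms)
  have alin: "linear_on_subspace V (\<lambda>u. a u v)" "linear_on_subspace V (a v)" for v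
    using l unfolding a_def linear_on_subspace_def
    by (auto simp: algebra_simps sum.distrib sum_distrib_left)
  define U where "U x = (\<Sum>i<n. x i *\<^sub>R e i)" for x
  have UV: "U x \<in> V" for x
    unfolding U_def using V eV by (intro subspace_sum subspace_scale) auto
  have lU: "f (U x) = (\<Sum>i<n. x i * f (e i))" if "linear_on_subspace V f" for f :: "'v \<Rightarrow> real" and x
    unfolding U_def by (subst linear_on_subspace_sum[OF that V]) (auto simp: eV)
  define P where "P x i = x i + c (U x) (U x) (e i) - F (e i)" for x i
  have "\<exists>x. \<forall>i<n. P x i = 0"
  \<comment> \<open>The zero lemma counts coordinates from \<open>0\<close> to \<open>m\<close> and
    so covers \<open>n = m + 1\<close>; for \<open>n = 0\<close> there is no equation to
    solve.\<close>
  proof (cases n)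
    case (Suc m)
    have lt: "{..<n} = {..m}" using Suc by auto
    have "\<exists>x. \<forall>i\<le>m. P x i = 0"
    proof (rule coercive_has_zero)
      fix i assume "i \<le> m"
      then have i: "i < n" using Suc by simp
      \<comment> \<open>In coordinates the convective term is a quadratic polynomial, hence
        continuous.\<close>
      have "c (U x) (U x) (e i) = (\<Sum>j<n. x j * (\<Sum>k<n. x k * c (e j) (e k) (e i)))" for x
        by (subst lU[OF c1], simp_all add: UV eV i)
           (intro sum.cong refl, subst lU[OF c2], simp_all add: UV eV i)
      moreover have "continuous_on UNIV (\<lambda>x::nat \<Rightarrow> real. x j)" for j
        by (rule continuous_on_product_coordinates)
      ultimately show "continuous_on UNIV (\<lambda>x. P x i)"
        unfolding P_def by (simp only:) (intro continuous_intros)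
    next
      \<comment> \<open>On the sphere of radius \<open>R = ?L + 1\<close> every coordinate is at
        most \<open>R\<close> in modulus, so the load is at most \<open>?L * R\<close>, which is
        less than the energy \<open>R\<^sup>2\<close>.\<close>
      let ?L = "\<Sum>i\<le>m. \<bar>F (e i)\<bar>"
      show R: "?L + 1 > 0" by (intro add_nonneg_pos sum_nonneg) auto
      fix x :: "nat \<Rightarrow> real" assume x: "(\<Sum>i\<le>m. (x i)\<^sup>2) = (?L + 1)\<^sup>2"
      have 1: "(\<Sum>i\<le>m. c (U x) (U x) (e i) * x i) = 0"
        using lU[OF c3[OF UV UV], of x x x] skew[OF UV UV, of x x] unfolding lt by (simp add: mult.commute)
      have xb: "\<bar>x i\<bar> \<le> ?L + 1" if "i \<le> m" for i
      proof (rule power2_le_imp_le)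
        show "\<bar>x i\<bar>\<^sup>2 \<le> (?L + 1)\<^sup>2"
          unfolding x[symmetric] power2_abs using that by (intro member_le_sum) auto
      qed (use R in simp)
      have "(\<Sum>i\<le>m. F (e i) * x i) \<le> (\<Sum>i\<le>m. \<bar>F (e i)\<bar> * (?L + 1))"
      proof (rule sum_mono)
        fix i assume "i \<in> {..m}"
        then have "\<bar>F (e i) * x i\<bar> \<le> \<bar>F (e i)\<bar> * (?L + 1)"
          unfolding abs_mult using xb by (intro mult_left_mono) auto
        then show "F (e i) * x i \<le> \<bar>F (e i)\<bar> * (?L + 1)" by linarith
      qed
      also have "\<dots> = ?L * (?L + 1)" by (simp only: sum_distrib_right)
      also have "\<dots> < (?L + 1) * (?L + 1)" using R by (intro mult_strict_right_mono) auto
      finally have 2: "(\<Sum>i\<le>m. F (e i) * x i) < (?L + 1)\<^sup>2" by (simp only: power2_eq_square)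
      have "(\<Sum>i\<le>m. P x i * x i)
          = (\<Sum>i\<le>m. (x i)\<^sup>2) + (\<Sum>i\<le>m. c (U x) (U x) (e i) * x i) - (\<Sum>i\<le>m. F (e i) * x i)"
        by (simp add: P_def algebra_simps sum.distrib sum_subtractf power2_eq_square)
      then show "(\<Sum>i\<le>m. P x i * x i) > 0" using 1 2 x by linarith
    qed
    then show ?thesis using Suc by (auto simp: less_Suc_eq_le)
  qed simp
  then obtain x where x: "\<And>i. i < n \<Longrightarrow> P x i = 0" by blast
  define u where "u = U x"
  have u: "u \<in> V" by (simp add: u_def UV)
  let ?E = "\<lambda>v. a u v + c u u v - F v"
  have E: "linear_on_subspace V ?E"
    using alin(2)[of u] c3[OF u u] F
    by (auto simp: linear_on_subspace_def algebra_simps)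
  have Ee: "?E (e i) = 0" if i: "i < n" for i
  proof -
    have "a u (e i) = (\<Sum>j<n. x j * a (e j) (e i))"
      unfolding u_def by (rule lU[OF alin(1)])
    also have "\<dots> = x i" using i by (simp add: on if_distrib[of "\<lambda>c. _ * c"] cong: if_cong)
    finally show ?thesis using x[OF i] by (simp add: P_def u_def)
  qed
  \<comment> \<open>\<open>v\<close> splits into its coordinate part \<open>w\<close> and a
    remainder \<open>r\<close> of energy zero. All energy functionals vanish at \<open>r\<close>, so
    each of the three terms of \<open>?E r\<close> does.\<close>
  have "?E v = 0" if v: "v \<in> V" for v
  proof -
    define w where "w = U (\<lambda>i. a v (e i))"
    have w: "w \<in> V" by (simp add: w_def UV)
    define r where "r = v - w"
    have r: "r \<in> V" using v w V by (simp add: r_def subspace_diff)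
    have "a r r = 0" using an[OF v] by (simp add: r_def w_def U_def)
    then have "\<forall>k\<in>K. l k r = 0"
      unfolding a_def by (subst (asm) sum_nonneg_eq_0_iff) (auto simp: K)
    moreover from this have "a u r = 0" by (simp add: a_def)
    ultimately have "?E r = 0" using null[OF r] u by simp
    moreover have "?E w = 0" unfolding w_def by (subst lU[OF E]) (simp add: Ee)
    moreover have "?E v = ?E r + ?E w"
      using linear_on_subspaceD(1)[OF E r w] by (simp add: r_def)
    ultimately show ?thesis by simp
  qed
  then show ?thesis using u unfolding a_def by (intro bexI[of _ u]) auto
qed

section \<open>Simplices and their facets\<close>

text \<open>The differences \<open>w' - w\<close> are independent, so some linear functional is
  \<open>-1\<close> on all of them; \<open>g\<close> is its representing vector, and
  \<open>b\<close> adjusts the value at \<open>w\<close> to \<open>1\<close>.\<close>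

lemma barycentric_functional:
  fixes C :: "(real^'d::finite) set"
  assumes "\<not> affine_dependent C" "w \<in> C"
  shows "\<exists>g b. \<forall>w'\<in>C. g \<bullet> w' + b = (if w = w' then 1 else 0)"
proof -
  let ?B = "(\<lambda>x. - w + x) ` (C - {w})"
  have "independent ?B" using assms affine_dependent_iff_dependent2 by blast
  from linear_independent_extend[OF this, of "\<lambda>_. -1::real"]
  obtain f :: "real^'d \<Rightarrow> real" where f: "linear f" "\<forall>x\<in>?B. f x = -1" by blast
  have fg: "f x = adjoint f 1 \<bullet> x" for x
    using adjoint_works[OF f(1), of x 1] by (simp add: inner_commute)
  show ?thesis
  proof (intro exI ballI)
    fix w' assume w': "w' \<in> C"
    show "adjoint f 1 \<bullet> w' + (1 - f w) = (if w = w' then 1 else 0)"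
    proof (cases "w = w'")
      case False
      then have "f (- w + w') = -1" using f(2) w' by blast
      then show ?thesis using False f(1) by (simp add: linear_diff fg[symmetric])
    qed (simp add: fg[symmetric])
  qed
qed

text \<open>\<open>g w \<bullet> x + b w\<close> is the barycentric coordinate of the vertex
  \<open>w\<close>. Vertices and functionals are auxiliary and therefore hidden behind a predicate;
  \<open>simplex_facets\<close> restates the outcome in terms of facets.\<close>

definition barycentric_coords ::
  "(real^'d::finite) set \<Rightarrow> (real^'d) set \<Rightarrow> (real^'d \<Rightarrow> real^'d) \<Rightarrow> (real^'d \<Rightarrow> real) \<Rightarrow> bool" where
  "barycentric_coords T C g b \<longleftrightarrow> finite C \<and> C = {x. x extreme_point_of T} \<and> T = convex hull C \<and>
    (\<forall>w\<in>C. \<forall>w'\<in>C. g w \<bullet> w' + b w = (if w = w' then 1 else 0)) \<and>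
    (\<forall>x. (\<Sum>w\<in>C. g w \<bullet> x + b w) = 1) \<and> (\<forall>x. (\<Sum>w\<in>C. (g w \<bullet> x + b w) *\<^sub>R w) = x) \<and>
    (\<forall>w\<in>C. g w \<noteq> 0 \<and> C - {w} \<noteq> {}) \<and> T = {x. \<forall>w\<in>C. 0 \<le> g w \<bullet> x + b w} \<and>
    (\<forall>e. e facet_of T \<longleftrightarrow> (\<exists>w\<in>C. e = convex hull (C - {w}))) \<and>
    (\<forall>w\<in>C. convex hull (C - {w}) = {x\<in>T. g w \<bullet> x + b w = 0})"

text \<open>\<open>d + 1\<close> affinely independent points span the space, so every point is an
  affine combination of the vertices and each functional reads off its own weight. Nonnegative
  weights describe the simplex, a vanishing weight a facet.\<close>

lemma simplex_barycentric:
  fixes T :: "(real^'d::finite) set"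
  assumes T: "int CARD('d) simplex T"
  shows "\<exists>C g b. barycentric_coords T C g b"
proof -
  from T obtain C where C: "\<not> affine_dependent C" "int (card C) = int CARD('d) + 1" "T = convex hull C"
    by (auto simp: simplex_def)
  have cC: "card C = Suc CARD('d)" using C(2) by linarith
  have fC: "finite C" using C(1) aff_independent_finite by blast
  obtain g b where gb: "\<And>w w'. w \<in> C \<Longrightarrow> w' \<in> C \<Longrightarrow> g w \<bullet> w' + b w = (if w = w' then 1 else 0)"
    using barycentric_functional[OF C(1)] by metis
  have hull: "affine hull C = UNIV" using affine_independent_span_eq[OF C(1)] cC by simp
  have coord: "g w \<bullet> (\<Sum>v\<in>C. u v *\<^sub>R v) + b w = u w" if "sum u C = 1" "w \<in> C" for u w
  proof -
    have "g w \<bullet> (\<Sum>v\<in>C. u v *\<^sub>R v) + b w = (\<Sum>v\<in>C. u v * (g w \<bullet> v)) + (\<Sum>v\<in>C. u v) * b w"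
      using that by (simp add: inner_sum_right)
    also have "\<dots> = (\<Sum>v\<in>C. u v * (g w \<bullet> v + b w))"
      by (simp add: distrib_left sum.distrib sum_distrib_right)
    also have "\<dots> = (\<Sum>v\<in>C. u v * (if w = v then 1 else 0))"
      using that by (intro sum.cong) (auto simp: gb)
    also have "\<dots> = u w" using fC that by (simp add: if_distrib[of "\<lambda>c. _ * c"] cong: if_cong)
    finally show ?thesis .
  qed
  have rep: "(\<Sum>w\<in>C. g w \<bullet> x + b w) = 1 \<and> (\<Sum>w\<in>C. (g w \<bullet> x + b w) *\<^sub>R w) = x" for x
  proof -
    have "x \<in> affine hull C" by (simp add: hull)
    then obtain u where u: "sum u C = 1" "(\<Sum>v\<in>C. u v *\<^sub>R v) = x"
      unfolding affine_hull_finite[OF fC] by blast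
    have "g w \<bullet> x + b w = u w" if "w \<in> C" for w using coord[OF u(1) that] u(2) by simp
    then show ?thesis using u by simp
  qed
  have ne: "C - {w} \<noteq> {}" for w
  proof
    assume "C - {w} = {}"
    then have "C \<subseteq> {w}" by blast
    then have "card C \<le> 1" using card_mono[of "{w}" C] by simp
    then show False using cC by simp
  qed
  have gnz: "g w \<noteq> 0" if w: "w \<in> C" for w
  proof
    assume g0: "g w = 0"
    obtain w' where "w' \<in> C" "w' \<noteq> w" using ne by blast
    then show False using gb[OF w, of w'] gb[OF w w] g0 by simp
  qed
  have Teq: "T = {x. \<forall>w\<in>C. 0 \<le> g w \<bullet> x + b w}"
  proof (rule subset_antisym; rule subsetI)
    fix x assume "x \<in> T"
    then obtain u where "\<forall>v\<in>C. 0 \<le> u v" "sum u C = 1" "(\<Sum>v\<in>C. u v *\<^sub>R v) = x"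
      unfolding C(3) convex_hull_finite[OF fC] by blast
    then show "x \<in> {x. \<forall>w\<in>C. 0 \<le> g w \<bullet> x + b w}" using coord by auto
  next
    fix x assume "x \<in> {x. \<forall>w\<in>C. 0 \<le> g w \<bullet> x + b w}"
    then show "x \<in> T" unfolding C(3) convex_hull_finite[OF fC]
      using rep[of x] by (intro CollectI exI[of _ "\<lambda>w. g w \<bullet> x + b w"]) auto
  qed
  have face: "convex hull (C - {w}) = {x\<in>T. g w \<bullet> x + b w = 0}" if w: "w \<in> C" for w
  proof (rule subset_antisym; rule subsetI)
    fix x assume x: "x \<in> convex hull (C - {w})"
    have "finite (C - {w})" using fC by simp
    from x[unfolded convex_hull_finite[OF this]] obtain u
      where u: "\<forall>v\<in>C-{w}. 0 \<le> u v" "sum u (C-{w}) = 1" "(\<Sum>v\<in>C-{w}. u v *\<^sub>R v) = x" by blast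
    let ?u = "u(w := 0)"
    have "sum ?u (C-{w}) = 1" "(\<Sum>v\<in>C-{w}. ?u v *\<^sub>R v) = x"
      unfolding u(2,3)[symmetric] by (auto intro!: sum.cong)
    then have s: "sum ?u C = 1" "(\<Sum>v\<in>C. ?u v *\<^sub>R v) = x"
      by (simp_all add: sum.remove[OF fC w])
    have "g w \<bullet> x + b w = 0" using coord[OF s(1) w] s(2) by simp
    moreover have "x \<in> T" using x hull_mono[of "C - {w}" C convex] C(3) by blast
    ultimately show "x \<in> {x\<in>T. g w \<bullet> x + b w = 0}" by simp
  next
    fix x assume "x \<in> {x\<in>T. g w \<bullet> x + b w = 0}"
    then have x: "x \<in> T" "g w \<bullet> x + b w = 0" by auto
    have fCw: "finite (C - {w})" using fC by simp
    have "(\<Sum>v\<in>C-{w}. g v \<bullet> x + b v) = 1" "(\<Sum>v\<in>C-{w}. (g v \<bullet> x + b v) *\<^sub>R v) = x"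
      using rep[of x] x(2) by (simp_all add: sum.remove[OF fC w])
    then show "x \<in> convex hull (C - {w})" unfolding convex_hull_finite[OF fCw]
      using x(1) Teq by (intro CollectI exI[of _ "\<lambda>w. g w \<bullet> x + b w"]) auto
  qed
  have facet: "e facet_of T \<longleftrightarrow> (\<exists>w\<in>C. e = convex hull (C - {w}))" for e
    unfolding C(3) facet_of_convex_hull_affine_independent[OF C(1)] using ne by auto
  have ext: "C = {x. x extreme_point_of T}"
    unfolding C(3) using extreme_point_of_convex_hull_affine_independent[OF C(1)] by blast
  have "barycentric_coords T C g b"
    unfolding barycentric_coords_def
  proof (intro conjI)
    show "\<forall>w\<in>C. \<forall>w'\<in>C. g w \<bullet> w' + b w = (if w = w' then 1 else 0)" using gb by blast
    show "\<forall>x. (\<Sum>w\<in>C. g w \<bullet> x + b w) = 1" "\<forall>x. (\<Sum>w\<in>C. (g w \<bullet> x + b w) *\<^sub>R w) = x"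
      using rep by blast+
    show "\<forall>w\<in>C. g w \<noteq> 0 \<and> C - {w} \<noteq> {}" using gnz ne by blast
    show "\<forall>e. e facet_of T \<longleftrightarrow> (\<exists>w\<in>C. e = convex hull (C - {w}))" using facet by blast
    show "\<forall>w\<in>C. convex hull (C - {w}) = {x\<in>T. g w \<bullet> x + b w = 0}" using face by blast
  qed (fact fC ext C(3) Teq)+
  then show ?thesis by blast
qed

section \<open>Simplices described by their facets\<close>

text \<open>Facets rather than vertices index the data of a simplex, since \<open>v_b\<close> and
  the sums over the boundary are attached to facets. In a simplex exactly one vertex lies off a
  given facet.\<close>

definition apex :: "(real^'d::finite) set \<Rightarrow> (real^'d) set \<Rightarrow> real^'d" where
  "apex T e = (THE w. w extreme_point_of T \<and> w \<notin> e)"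

definition facet_height :: "(real^'d::finite) set \<Rightarrow> (real^'d) set \<Rightarrow> real" where
  "facet_height T e = (THE h. \<forall>y\<in>e. outward_normal T e \<bullet> (y - apex T e) = h)"

text \<open>For a simplex this is the barycentric coordinate of the vertex opposite to
  \<open>e\<close>: \<open>1\<close> at that vertex and \<open>0\<close> on the hyperplane of
  \<open>e\<close>.\<close>

definition bary_coord :: "(real^'d::finite) set \<Rightarrow> (real^'d) set \<Rightarrow> real^'d \<Rightarrow> real" where
  "bary_coord T e x = 1 - outward_normal T e \<bullet> (x - apex T e) / facet_height T e"

text \<open>Opposite to the vertex \<open>w\<close> the outward normal is
  \<open>- g w / norm (g w)\<close> and the height is \<open>1 / norm (g w)\<close>, so the
  coordinate of that facet is the functional of \<open>w\<close>. The claims are then carried over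
  by the bijection \<open>E\<close> from vertices to facets.\<close>

lemma simplex_facets:
  fixes T :: "(real^'d::finite) set"
  assumes T: "int CARD('d) simplex T"
  shows "\<forall>e. e facet_of T \<longrightarrow> norm (outward_normal T e) = 1 \<and> facet_height T e > 0 \<and>
       e \<noteq> {} \<and> e = {x\<in>T. bary_coord T e x = 0}"
    and "\<forall>e e'. e facet_of T \<longrightarrow> e' facet_of T \<longrightarrow> e \<noteq> e' \<longrightarrow> apex T e' \<in> e"
    and "T = {x. \<forall>e. e facet_of T \<longrightarrow> 0 \<le> bary_coord T e x}"
    and "\<And>x. (\<Sum>e | e facet_of T. bary_coord T e x) = 1"
    and "\<And>x. (\<Sum>e | e facet_of T. bary_coord T e x *\<^sub>R apex T e) = x"
proof -
  obtain C g b where H: "barycentric_coords T C g b" using simplex_barycentric[OF T] by blast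
  note H' = H[unfolded barycentric_coords_def]
  note c2 = H'[THEN conjunct2, THEN conjunct2]
  note c3 = c2[THEN conjunct2] note c4 = c3[THEN conjunct2] note c5 = c4[THEN conjunct2]
  note c6 = c5[THEN conjunct2] note c7 = c6[THEN conjunct2] note c8 = c7[THEN conjunct2]
  have fC: "finite C" and ext: "C = {x. x extreme_point_of T}" and TC: "T = convex hull C"
    and gb: "\<And>w w'. w \<in> C \<Longrightarrow> w' \<in> C \<Longrightarrow> g w \<bullet> w' + b w = (if w = w' then 1 else 0)"
    and sum1: "\<And>x. (\<Sum>w\<in>C. g w \<bullet> x + b w) = 1" and sumx: "\<And>x. (\<Sum>w\<in>C. (g w \<bullet> x + b w) *\<^sub>R w) = x"
    and gnz: "\<And>w. w \<in> C \<Longrightarrow> g w \<noteq> 0" and ne: "\<And>w. w \<in> C \<Longrightarrow> C - {w} \<noteq> {}"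
    and Teq: "T = {x. \<forall>w\<in>C. 0 \<le> g w \<bullet> x + b w}"
    and facet: "\<And>e. e facet_of T \<longleftrightarrow> (\<exists>w\<in>C. e = convex hull (C - {w}))"
    and face: "\<And>w. w \<in> C \<Longrightarrow> convex hull (C - {w}) = {x\<in>T. g w \<bullet> x + b w = 0}"
    using H'[THEN conjunct1] H'[THEN conjunct2, THEN conjunct1] c2[THEN conjunct1] 
      c3[THEN conjunct1, THEN bspec, THEN bspec] c4[THEN conjunct1, THEN spec]
      c5[THEN conjunct1, THEN spec] c6[THEN conjunct1, THEN bspec, THEN conjunct1]
      c6[THEN conjunct1, THEN bspec, THEN conjunct2] c7[THEN conjunct1]
      c8[THEN conjunct1, THEN spec] c8[THEN conjunct2, THEN bspec]
    by - assumption+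
  define E where "E w = convex hull (C - {w})" for w
  have CT: "C \<subseteq> T" using TC by (simp add: hull_subset)
  have Ein: "w' \<in> E w \<longleftrightarrow> w' \<noteq> w" if "w \<in> C" "w' \<in> C" for w w'
    using face[OF that(1)] CT that gb by (auto simp: E_def)
  have Ene: "E w \<noteq> {}" if "w \<in> C" for w using ne[OF that] by (simp add: E_def)
  have EE: "e facet_of T \<longleftrightarrow> (\<exists>w\<in>C. e = E w)" for e using facet by (simp add: E_def)
  have inj: "inj_on E C" by (intro inj_onI) (metis Ein)
  have facets: "{e. e facet_of T} = E ` C" using EE by auto
  have out: "outward_normal T (E w) = - (1 / norm (g w)) *\<^sub>R g w" if w: "w \<in> C" for w
    unfolding outward_normal_def
  proof (rule the_equality)
    let ?n = "- (1 / norm (g w)) *\<^sub>R g w"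
    have gp: "norm (g w) > 0" using gnz[OF w] by simp
    have "?n \<bullet> x \<le> ?n \<bullet> y" if "x \<in> T" "y \<in> E w" for x y
    proof -
      have "g w \<bullet> y \<le> g w \<bullet> x" using that face[OF w] Teq w unfolding E_def by fastforce
      then show ?thesis using gp by (simp add: divide_right_mono)
    qed
    then show "norm ?n = 1 \<and> (\<forall>x\<in>T. \<forall>y\<in>E w. ?n \<bullet> x \<le> ?n \<bullet> y)" using gp by auto
    \<comment> \<open>A competitor takes one value on all vertices of \<open>E w\<close>. By the
      barycentric expansion it then depends on the coordinate of \<open>w\<close> alone, which makes
      it a multiple \<open>k\<close> of \<open>g w\<close>; its length and its sign determine
      \<open>k\<close>.\<close>
    fix n :: "real^'d" assume n: "norm n = 1 \<and> (\<forall>x\<in>T. \<forall>y\<in>E w. n \<bullet> x \<le> n \<bullet> y)"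
    obtain w0 where w0: "w0 \<in> C" "w0 \<noteq> w" using ne[OF w] by blast
    have eq: "n \<bullet> v = n \<bullet> w0" if "v \<in> C" "v \<noteq> w" for v
      using n that w0 Ein[OF w] CT by (meson antisym subsetD)
    have le: "n \<bullet> w \<le> n \<bullet> w0" using n w w0 Ein[OF w] CT by blast
    define k where "k = n \<bullet> w - n \<bullet> w0"
    have nx: "n \<bullet> x = n \<bullet> w0 + k * (g w \<bullet> x + b w)" for x
    proof -
      have "n \<bullet> x = (\<Sum>v\<in>C. (g v \<bullet> x + b v) * (n \<bullet> v))"
        by (subst (1) sumx[of x, symmetric]) (simp add: inner_sum_right)
      also have "\<dots> = (\<Sum>v\<in>C. (g v \<bullet> x + b v) * (n \<bullet> w0) + (if v = w then (g w \<bullet> x + b w) * k else 0))"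
        by (intro sum.cong) (auto simp: eq k_def algebra_simps)
      also have "\<dots> = (\<Sum>v\<in>C. (g v \<bullet> x + b v)) * (n \<bullet> w0) + (g w \<bullet> x + b w) * k"
        by (simp only: sum.distrib sum_distrib_right[symmetric] sum.delta[OF fC] w if_True)
      finally show ?thesis by (simp add: sum1 mult.commute)
    qed
    have "(n - k *\<^sub>R g w) \<bullet> x = 0" for x
      using nx[of x] nx[of 0] by (simp add: inner_diff_left algebra_simps)
    then have nk: "n = k *\<^sub>R g w" by (metis eq_iff_diff_eq_0 inner_eq_zero_iff)
    then have "\<bar>k\<bar> * norm (g w) = 1" using n by simp
    moreover have "k \<le> 0" using le by (simp add: k_def)
    ultimately have "k = - (1 / norm (g w))" using gp by (simp add: field_simps)
    then show "n = ?n" using nk by simp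
  qed
  have apx: "apex T (E w) = w" if w: "w \<in> C" for w
    unfolding apex_def using ext Ein[OF w] w by (intro the_equality) auto
  have hgt: "facet_height T (E w) = 1 / norm (g w)" if w: "w \<in> C" for w
  proof -
    have gp: "norm (g w) > 0" using gnz[OF w] by simp
    have "outward_normal T (E w) \<bullet> (y - apex T (E w)) = 1 / norm (g w)" if "y \<in> E w" for y
    proof -
      have "g w \<bullet> y + b w = 0" using that face[OF w] by (simp add: E_def)
      moreover have "g w \<bullet> w + b w = 1" using gb[OF w w] by simp
      ultimately have "g w \<bullet> y = g w \<bullet> w - 1" by linarith
      then show ?thesis by (simp add: out[OF w] apx[OF w] inner_diff_right diff_divide_distrib)
    qed
    then show ?thesis unfolding facet_height_def using Ene[OF w]
      by (intro the_equality) auto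
  qed
  have bc: "bary_coord T (E w) x = g w \<bullet> x + b w" if w: "w \<in> C" for w x
  proof -
    have gp: "norm (g w) > 0" using gnz[OF w] by simp
    have "outward_normal T (E w) \<bullet> (x - apex T (E w)) / facet_height T (E w) = - (g w \<bullet> (x - w))"
      unfolding out[OF w] apx[OF w] hgt[OF w] using gp by simp
    then show ?thesis using gb[OF w w] by (simp add: bary_coord_def inner_diff_right)
  qed
  show "\<forall>e. e facet_of T \<longrightarrow> norm (outward_normal T e) = 1 \<and> facet_height T e > 0 \<and>
       e \<noteq> {} \<and> e = {x\<in>T. bary_coord T e x = 0}"
  proof (intro allI impI)
    fix e assume "e facet_of T"
    then obtain w where w: "w \<in> C" and e: "e = E w" using EE by blast
    have gp: "norm (g w) > 0" using gnz[OF w] by simp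
    have "E w = {x\<in>T. bary_coord T (E w) x = 0}" unfolding bc[OF w] using face[OF w] by (simp add: E_def)
    moreover have "norm (outward_normal T (E w)) = 1" "facet_height T (E w) > 0"
      using gp by (auto simp: out[OF w] hgt[OF w])
    ultimately show "norm (outward_normal T e) = 1 \<and> facet_height T e > 0 \<and>
       e \<noteq> {} \<and> e = {x\<in>T. bary_coord T e x = 0}"
      using Ene[OF w] unfolding e by blast
  qed
  show "\<forall>e e'. e facet_of T \<longrightarrow> e' facet_of T \<longrightarrow> e \<noteq> e' \<longrightarrow> apex T e' \<in> e"
    using EE Ein apx by auto
  show "T = {x. \<forall>e. e facet_of T \<longrightarrow> 0 \<le> bary_coord T e x}"
    by (subst (1) Teq) (use EE bc in auto)
  show "(\<Sum>e | e facet_of T. bary_coord T e x) = 1" for x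
    unfolding facets sum.reindex[OF inj] using sum1[of x] by (simp add: bc)
  show "(\<Sum>e | e facet_of T. bary_coord T e x *\<^sub>R apex T e) = x" for x
    unfolding facets sum.reindex[OF inj] using sumx[of x] by (simp add: bc apx)
qed

locale full_simplex =
  fixes T :: "(real^'d::finite) set"
  assumes simplex: "int CARD('d) simplex T"
begin

lemma facet_normal: "e facet_of T \<Longrightarrow> norm (outward_normal T e) = 1"
  and facet_height_pos: "e facet_of T \<Longrightarrow> facet_height T e > 0"
  and facet_nonempty: "e facet_of T \<Longrightarrow> e \<noteq> {}"
  and facet_iff: "e facet_of T \<Longrightarrow> x \<in> e \<longleftrightarrow> x \<in> T \<and> bary_coord T e x = 0"
  and apex_in_facet: "e facet_of T \<Longrightarrow> e' facet_of T \<Longrightarrow> e \<noteq> e' \<Longrightarrow> apex T e' \<in> e"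
  and simplex_iff: "x \<in> T \<longleftrightarrow> (\<forall>e. e facet_of T \<longrightarrow> 0 \<le> bary_coord T e x)"
  and bary_sum: "(\<Sum>e | e facet_of T. bary_coord T e x) = 1"
  and bary_combination: "(\<Sum>e | e facet_of T. bary_coord T e x *\<^sub>R apex T e) = x"
proof -
  note f = simplex_facets[OF simplex]
  show "norm (outward_normal T e) = 1" "facet_height T e > 0" "e \<noteq> {}"
    "x \<in> e \<longleftrightarrow> x \<in> T \<and> bary_coord T e x = 0" if "e facet_of T" for e x
    using f(1) that by blast+
  show "apex T e' \<in> e" if "e facet_of T" "e' facet_of T" "e \<noteq> e'" for e e'
    using f(2) that by blast
  show "x \<in> T \<longleftrightarrow> (\<forall>e. e facet_of T \<longrightarrow> 0 \<le> bary_coord T e x)" for x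
    by (subst f(3)) (rule mem_Collect_eq)
  show "(\<Sum>e | e facet_of T. bary_coord T e x) = 1"
    "(\<Sum>e | e facet_of T. bary_coord T e x *\<^sub>R apex T e) = x" for x
    by (rule f(4)) (rule f(5))
qed

lemma finite_facets: "finite {e. e facet_of T}"
  using simplex finite_polytope_facets simplex_imp_polytope by blast

lemma bary_apex: "bary_coord T e (apex T e) = 1"
  by (simp add: bary_coord_def)

lemma bary_affine: "bary_coord T e ((1 - t) *\<^sub>R x + t *\<^sub>R y) = (1 - t) * bary_coord T e x + t * bary_coord T e y"
  by (simp add: bary_coord_def algebra_simps inner_simps add_divide_distrib diff_divide_distrib)

lemma continuous_bary: "continuous_on A (bary_coord T e)"
  unfolding bary_coord_def divide_inverse by (intro continuous_intros)

lemma bary_0_iff: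
  "e facet_of T \<Longrightarrow> bary_coord T e y = 0 \<longleftrightarrow> outward_normal T e \<bullet> (y - apex T e) = facet_height T e"
  using facet_height_pos[of e] by (auto simp: bary_coord_def field_simps)

lemma normal_facet:
  assumes "e facet_of T" "y \<in> e"
  shows "outward_normal T e \<bullet> (y - apex T e) = facet_height T e"
  using assms bary_0_iff facet_iff by blast

lemma bary_eq_normal:
  assumes "e facet_of T" "y \<in> e"
  shows "bary_coord T e x = outward_normal T e \<bullet> (y - x) / facet_height T e"
  using normal_facet[OF assms] facet_height_pos[OF assms(1)]
  by (simp add: bary_coord_def inner_diff_right field_simps)

lemma compact_T: "compact T" and convex_T: "convex T"
  using simplex compact_simplex convex_simplex by blast+

lemma compact_facet: "e facet_of T \<Longrightarrow> compact e" and convex_facet: "e facet_of T \<Longrightarrow> convex e"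
  using compact_T convex_T face_of_imp_compact face_of_imp_convex facet_of_imp_face_of by blast+

lemma facet_subset: "e facet_of T \<Longrightarrow> e \<subseteq> T"
  by (rule facet_of_imp_subset)

lemma aff_dim_T: "aff_dim T = int CARD('d)"
  using aff_dim_simplex[OF simplex] .

lemma interior_T_nonempty: "interior T \<noteq> {}"
proof -
  have "affine hull T = UNIV" using aff_dim_T aff_dim_eq_full[of T] by simp
  moreover have "T \<noteq> {}" using aff_dim_T by auto
  ultimately show ?thesis using rel_interior_interior rel_interior_eq_empty[OF convex_T] by metis
qed

text \<open>One affine set contains the other and both have dimension \<open>d - 1\<close>.\<close>

lemma affine_hull_facet:
  assumes e: "e facet_of T"
  shows "affine hull e = {y. outward_normal T e \<bullet> y = outward_normal T e \<bullet> apex T e + facet_height T e}"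
proof (rule affine_dim_equal)
  let ?H = "{y. outward_normal T e \<bullet> y = outward_normal T e \<bullet> apex T e + facet_height T e}"
  have nz: "outward_normal T e \<noteq> 0" using facet_normal[OF e] by auto
  show "affine ?H" by (rule affine_hyperplane)
  have "e \<subseteq> ?H" using normal_facet[OF e] by (auto simp: inner_diff_right algebra_simps)
  then show "affine hull e \<subseteq> ?H" by (rule hull_minimal[of e ?H affine]) (rule affine_hyperplane)
  show "aff_dim (affine hull e) = aff_dim ?H"
    using e aff_dim_T aff_dim_hyperplane[OF nz] by (simp add: facet_of_def)
qed (use facet_nonempty[OF e] in auto)

text \<open>The radial fields \<^term>\<open>x - apex T e\<close> span the local Raviart--Thomas space.\<close>

lemma radial_expansion:
  "a + b *\<^sub>R x = (\<Sum>e | e facet_of T. (b * bary_coord T e 0 + outward_normal T e \<bullet> a / facet_height T e) *\<^sub>R (x - apex T e))"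
    (is "_ = ?S")
proof -
  let ?c = "\<lambda>e. outward_normal T e \<bullet> a / facet_height T e"
  \<comment> \<open>\<open>?c e\<close> is the drop of a barycentric coordinate from
    \<open>0\<close> to \<open>a\<close>. Therefore the \<open>?c e\<close> sum to \<open>0\<close>,
    and weighted with the vertices they give \<open>0 - a\<close>.\<close>
  have c: "bary_coord T e a = bary_coord T e 0 - ?c e" for e
    by (simp add: bary_coord_def inner_diff_right diff_divide_distrib)
  have 1: "(\<Sum>e | e facet_of T. ?c e) = 0"
    using bary_sum[of a] bary_sum[of 0] by (simp add: c sum_subtractf)
  have 2: "(\<Sum>e | e facet_of T. ?c e *\<^sub>R apex T e) = - a"
  proof -
    have "- (\<Sum>e | e facet_of T. ?c e *\<^sub>R apex T e) = a"
      using bary_combination[of a] bary_combination[of 0]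
      by (simp add: c sum_subtractf scaleR_diff_left)
    then show ?thesis by (rule minus_equation_iff[THEN iffD1, symmetric])
  qed
  have "?S = (\<Sum>e | e facet_of T. (b * bary_coord T e 0) *\<^sub>R x - b *\<^sub>R (bary_coord T e 0 *\<^sub>R apex T e)
      + (?c e *\<^sub>R x - ?c e *\<^sub>R apex T e))"
    by (intro sum.cong refl) (simp add: scaleR_diff_right scaleR_add_left algebra_simps)
  also have "\<dots> = (b * (\<Sum>e | e facet_of T. bary_coord T e 0)) *\<^sub>R x
      - b *\<^sub>R (\<Sum>e | e facet_of T. bary_coord T e 0 *\<^sub>R apex T e)
      + ((\<Sum>e | e facet_of T. ?c e) *\<^sub>R x - (\<Sum>e | e facet_of T. ?c e *\<^sub>R apex T e))"
    by (simp only: sum.distrib sum_subtractf scaleR_sum_left scaleR_sum_right sum_distrib_left)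
  also have "\<dots> = a + b *\<^sub>R x"
    using bary_sum[of 0] bary_combination[of 0] by (simp add: 1 2)
  finally show ?thesis ..
qed

lemma normal_radial:
  assumes "e facet_of T" "e' facet_of T" "x \<in> e"
  shows "outward_normal T e \<bullet> (x - apex T e') = (if e = e' then facet_height T e else 0)"
proof (cases "e = e'")
  case True
  then show ?thesis using normal_facet assms by simp
next
  case False
  then have "apex T e' \<in> e" using apex_in_facet assms by blast
  from normal_facet[OF assms(1) this] show ?thesis
    using False normal_facet[OF assms(1,3)] by (simp add: inner_diff_right)
qed

text \<open>The segment from the vertex \<open>apex T e'\<close>, which lies in \<open>e\<close>,
  through \<open>x\<close> can be prolonged beyond \<open>x\<close> within \<open>e\<close>. The
  coordinate is \<open>1\<close> at the start and nonnegative at the end, hence positive at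
  \<open>x\<close>.\<close>

lemma bary_pos_rel_interior:
  assumes e: "e facet_of T" "e' facet_of T" "e \<noteq> e'" and x: "x \<in> rel_interior e"
  shows "bary_coord T e' x > 0"
proof -
  have xe: "x \<in> e" using x rel_interior_subset by blast
  have ge: "bary_coord T e' y \<ge> 0" if "y \<in> e" for y
    using that facet_subset[OF e(1)] simplex_iff e(2) by blast
  have "apex T e' \<in> e" using apex_in_facet e by blast
  then obtain m where m: "m > 1" "(1 - m) *\<^sub>R apex T e' + m *\<^sub>R x \<in> e"
    using convex_rel_interior_iff[OF convex_facet[OF e(1)] facet_nonempty[OF e(1)]] x by blast
  have "0 \<le> (1 - m) + m * bary_coord T e' x"
    using ge[OF m(2)] by (simp add: bary_affine bary_apex)
  then have "m * bary_coord T e' x > 0" using m(1) by linarith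
  then show ?thesis using m(1) by (simp add: zero_less_mult_iff)
qed

text \<open>Near a relative interior point of \<open>e\<close> all coordinates of other facets are
  positive, so there \<open>T\<close> is a half-space.\<close>

lemma half_ball_subset:
  assumes e: "e facet_of T" and x: "x \<in> rel_interior e"
  shows "\<exists>r>0. \<forall>y. dist x y < r \<longrightarrow> outward_normal T e \<bullet> y \<le> outward_normal T e \<bullet> x \<longrightarrow> y \<in> T"
proof -
  let ?F = "{e'. e' facet_of T} - {e}"
  have xe: "x \<in> e" using x rel_interior_subset by blast
  have "open (\<Inter>e'\<in>?F. {y. bary_coord T e' y > 0})"
    using finite_facets by (intro open_INT) (auto intro!: open_Collect_less continuous_bary continuous_on_const)
  moreover have "x \<in> (\<Inter>e'\<in>?F. {y. bary_coord T e' y > 0})"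
    using bary_pos_rel_interior[OF e _ _ x] by auto
  ultimately obtain r where r: "r > 0" "ball x r \<subseteq> (\<Inter>e'\<in>?F. {y. bary_coord T e' y > 0})"
    by (metis open_contains_ball)
  show ?thesis
  proof (intro exI conjI allI impI)
    show "r > 0" by fact
    fix y assume y: "dist x y < r" "outward_normal T e \<bullet> y \<le> outward_normal T e \<bullet> x"
    have "0 \<le> bary_coord T e' y" if "e' facet_of T" for e'
    proof (cases "e' = e")
      case True
      then show ?thesis using bary_eq_normal[OF e xe, of y] y(2) facet_height_pos[OF e]
        by (simp add: inner_diff_right)
    next
      case False
      then have "y \<in> (\<Inter>e'\<in>?F. {y. bary_coord T e' y > 0})" using r(2) y(1) by auto
      then show ?thesis using that False by (auto intro: less_imp_le)
    qed
    then show "y \<in> T" by (subst simplex_iff) blast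
  qed
qed

end

section \<open>Gauss' theorem on a simplex\<close>

lemma det_scaling: "det (matrix (\<lambda>x::real^'d::finite. s *\<^sub>R x)) = s ^ CARD('d)"
proof -
  have "matrix (\<lambda>x::real^'d. s *\<^sub>R x) = (\<chi> i j. if i = j then s else 0)"
    by (simp add: matrix_def vec_eq_iff axis_def)
  then show ?thesis by (simp add: det_diagonal)
qed

text \<open>After a rotation taking \<open>n\<close> to a coordinate axis, the map differs from a
  multiple of the identity in one column only. This is the Jacobian that \<open>shell\<close> will
  have.\<close>

lemma det_scaling_plus_rank_one:
  fixes n w :: "real^'d::finite"
  assumes n: "norm n = 1" and s: "s \<noteq> 0"
  shows "det (matrix (\<lambda>x. s *\<^sub>R x + (n \<bullet> x) *\<^sub>R w)) = s ^ (CARD('d) - 1) * (s + n \<bullet> w)"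
proof -
  obtain k :: 'd where True by blast
  obtain f :: "real^'d \<Rightarrow> real^'d" where f: "orthogonal_transformation f" "f n = axis k 1"
    using orthogonal_transformation_exists_1[of n "axis k 1"] n by auto
  define L where "L = (\<lambda>x. s *\<^sub>R x + (n \<bullet> x) *\<^sub>R w)"
  define A :: "real^'d^'d" where "A = (\<chi> i j. if i = j then s else 0)"
  \<comment> \<open>\<open>B\<close> has the form of Cramer's rule: column \<open>k\<close> of
    \<open>A\<close> is replaced by the image under \<open>A\<close> of a vector whose
    \<open>k\<close>-th entry is the quotient of determinants. The division by \<open>s\<close> is
    where \<open>s \<noteq> 0\<close> enters.\<close>
  define B :: "real^'d^'d" where
    "B = (\<chi> i j. if j = k then (A *v (axis k 1 + (1 / s) *\<^sub>R f w)) $ i else A $ i $ j)"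
  have lf: "linear f" using f(1) orthogonal_transformation_linear by blast
  have lL: "linear L" unfolding L_def
    by (rule linearI) (simp_all add: algebra_simps inner_add_right scaleR_add_left)
  have Av: "A *v x = s *\<^sub>R x" for x
    by (simp add: A_def matrix_vector_mult_def vec_eq_iff if_distrib[of "\<lambda>c. c * _"] cong: if_cong)
  have Bv: "B *v x = s *\<^sub>R x + (x $ k) *\<^sub>R f w" for x
  proof (simp only: vec_eq_iff, rule allI)
    fix i
    have Bij: "B $ i $ j = (if i = j then s else 0) + (if j = k then f w $ i else 0)" for j
      unfolding B_def Av using s by (auto simp: axis_def A_def field_simps)
    show "(B *v x) $ i = (s *\<^sub>R x + (x $ k) *\<^sub>R f w) $ i"
      by (simp add: matrix_vector_mult_def Bij distrib_right sum.distrib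
          if_distrib[of "\<lambda>c. c * _"] cong: if_cong)
  qed
  have fk: "f x $ k = n \<bullet> x" for x
  proof -
    have "f x $ k = f x \<bullet> f n" by (simp add: f(2) inner_axis)
    also have "\<dots> = n \<bullet> x" using f(1) by (simp add: orthogonal_transformation_def inner_commute)
    finally show ?thesis .
  qed
  have "f (L x) = B *v (f x)" for x
  proof -
    show ?thesis unfolding Bv L_def fk using lf by (simp add: linear_add linear_scale)
  qed
  then have "f \<circ> L = (*v) B \<circ> f" by auto
  then have "matrix f ** matrix L = B ** matrix f"
    using matrix_compose[OF lL lf] matrix_compose[OF lf matrix_vector_mul_linear, of B] by simp
  then have "det (matrix f) * det (matrix L) = det B * det (matrix f)"
    by (metis det_mul)
  moreover have "det (matrix f) \<noteq> 0"
    using f(1) det_orthogonal_matrix orthogonal_transformation_matrix by fastforce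
  ultimately have "det (matrix L) = det B" by simp
  also have "det B = (axis k 1 + (1 / s) *\<^sub>R f w) $ k * det A"
    unfolding B_def by (rule cramer_lemma)
  also have "det A = s ^ CARD('d)" by (simp add: A_def det_diagonal)
  also have "(axis k 1 + (1 / s) *\<^sub>R f w) $ k = (s + n \<bullet> w) / s"
    using s by (simp add: add_divide_distrib fk axis_def)
  finally show ?thesis unfolding L_def
    using s by (simp add: power_eq_if[of s "CARD('d)"])
qed

lemma absolutely_integrable_continuous_compact:
  fixes f :: "'a::euclidean_space \<Rightarrow> 'b::euclidean_space"
  assumes "compact S" "continuous_on S f"
  shows "f absolutely_integrable_on S"
  using borel_integrable_compact[OF assms] unfolding set_integrable_def
  by (simp add: integrable_completion borel_measurable_integrable)

text \<open>The change of variables theorem is applied to the integrand carried into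
  \<open>real^1\<close>; the scalar statement is its only component.\<close>

lemma integral_image_C1:
  fixes f :: "real^'d::{finite,wellorder} \<Rightarrow> real" and g :: "real^'d::_ \<Rightarrow> real^'d::_"
  assumes S: "compact S" and g: "\<And>x. x \<in> S \<Longrightarrow> (g has_derivative g' x) (at x within S)"
    and inj: "inj_on g S" and f: "continuous_on (g ` S) f"
  shows "integral (g ` S) f = integral S (\<lambda>x. \<bar>det (matrix (g' x))\<bar> * f (g x))"
    and "(\<lambda>x. \<bar>det (matrix (g' x))\<bar> * f (g x)) integrable_on S"
proof -
  have cg: "continuous_on S g" using g has_derivative_continuous_on by blast
  have "compact (g ` S)" using S cg compact_continuous_image by blast
  then have ai: "f absolutely_integrable_on (g ` S)"
    using f absolutely_integrable_continuous_compact by blast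
  let ?F = "\<lambda>x. (vec (f x) :: real^1)"
  have "?F absolutely_integrable_on (g ` S)"
    using ai by (simp add: absolutely_integrable_componentwise_iff[where f="?F"] Basis_vec_def inner_axis)
  then have *: "(\<lambda>x. \<bar>det (matrix (g' x))\<bar> *\<^sub>R ?F (g x)) absolutely_integrable_on S"
    "integral S (\<lambda>x. \<bar>det (matrix (g' x))\<bar> *\<^sub>R ?F (g x)) = integral (g ` S) ?F"
    using has_absolute_integral_change_of_variables_compact[OF S g inj, of ?F "integral (g ` S) ?F"] by auto
  have 1: "(\<lambda>x. \<bar>det (matrix (g' x))\<bar> *\<^sub>R ?F (g x)) integrable_on S"
    using *(1) absolutely_integrable_on_def by blast
  have 2: "?F integrable_on (g ` S)"
    using \<open>?F absolutely_integrable_on (g ` S)\<close> absolutely_integrable_on_def by blast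
  have "integral S (\<lambda>x. \<bar>det (matrix (g' x))\<bar> * f (g x)) = integral S (\<lambda>x. \<bar>det (matrix (g' x))\<bar> *\<^sub>R ?F (g x)) $ 1"
    by (subst integral_component_eq_cart[OF 1, symmetric]) simp
  also have "\<dots> = integral (g ` S) f" unfolding *(2)
    by (subst integral_component_eq_cart[OF 2, symmetric]) simp
  finally show "integral (g ` S) f = integral S (\<lambda>x. \<bar>det (matrix (g' x))\<bar> * f (g x))" ..
  show "(\<lambda>x. \<bar>det (matrix (g' x))\<bar> * f (g x)) integrable_on S"
    using integrable_component[OF 1, of "axis 1 1"] by (simp add: inner_axis)
qed

section \<open>The layer over one facet\<close>

locale simplex_facet = full_simplex T
  for T :: "(real^'d::{finite,wellorder}) set" +
  fixes e :: "(real^'d::_) set"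
  assumes facet: "e facet_of T"
begin

abbreviation "n \<equiv> outward_normal T e"
abbreviation "w \<equiv> apex T e"
abbreviation "h \<equiv> facet_height T e"

text \<open>An explicit formula for the closest point map in \<open>face_measure\<close>; being
  affine it can be differentiated.\<close>

definition proj :: "real^'d::_ \<Rightarrow> real^'d::_" where
  "proj x = x - (n \<bullet> (x - w) - h) *\<^sub>R n"

definition slab :: "(real^'d::_) set" where
  "slab = {x. proj x \<in> e \<and> \<bar>n \<bullet> (x - w) - h\<bar> \<le> 1/2}"

lemma n1: "norm n = 1" and nn: "n \<bullet> n = 1" and h_pos: "h > 0"
  using facet_normal[OF facet] facet_height_pos[OF facet] by (auto simp: norm_eq_1)

lemma normal_proj: "n \<bullet> (proj x - w) = h"
  by (simp add: proj_def inner_diff_right nn)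

lemma proj_affine_hull: "proj x \<in> affine hull e"
  using normal_proj[of x] by (simp add: affine_hull_facet[OF facet] inner_diff_right algebra_simps)

lemma dist_proj: "dist x (proj x) = \<bar>n \<bullet> (x - w) - h\<bar>"
  by (simp add: dist_norm proj_def n1)

lemma proj_shift: "y \<in> e \<Longrightarrow> proj (y + c *\<^sub>R n) = y" "y \<in> e \<Longrightarrow> n \<bullet> (y + c *\<^sub>R n - w) - h = c"
  using normal_facet[OF facet, of y] by (auto simp: proj_def inner_diff_right inner_add_right nn algebra_simps)

lemma closest_point_eq_proj: "closest_point (affine hull e) x = proj x"
proof (rule closest_point_unique[symmetric])
  show "\<forall>z\<in>affine hull e. dist x (proj x) \<le> dist x z"
  proof
    fix z assume "z \<in> affine hull e"
    then have "n \<bullet> (x - w) - h = n \<bullet> (x - z)"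
      by (simp add: affine_hull_facet[OF facet] inner_diff_right)
    then show "dist x (proj x) \<le> dist x z"
      using Cauchy_Schwarz_ineq2[of n "x - z"] unfolding dist_proj by (simp add: n1 dist_norm)
  qed
qed (auto simp: proj_affine_hull affine_imp_convex)

lemma continuous_proj: "continuous_on A proj"
  unfolding proj_def by (intro continuous_intros)

lemma compact_slab: "compact slab"
proof -
  have "closed slab"
    unfolding slab_def
    by (intro closed_Collect_conj closed_Collect_le continuous_intros
        closed_vimage[where f=proj, unfolded vimage_def] compact_imp_closed compact_facet facet continuous_proj)
  moreover have "bounded slab"
  proof -
    obtain B where B: "\<And>y. y \<in> e \<Longrightarrow> norm y \<le> B"
      using compact_facet[OF facet] compact_imp_bounded bounded_iff by metis
    have "norm x \<le> B + 1/2" if "x \<in> slab" for x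
    proof -
      have "norm x \<le> norm (proj x) + dist x (proj x)"
        by (metis dist_norm norm_triangle_sub)
      then show ?thesis using that B[of "proj x"] by (simp add: slab_def dist_proj)
    qed
    then show ?thesis unfolding bounded_iff by blast
  qed
  ultimately show ?thesis by (simp add: compact_eq_bounded_closed)
qed

lemma face_measure_eq:
  "face_measure e = distr (restrict_space lborel slab) (restrict_space borel e) proj"
proof -
  have "closest_point (affine hull e) = proj" using closest_point_eq_proj by blast
  then show ?thesis by (simp add: face_measure_def slab_def dist_proj Let_def)
qed

text \<open>The surface measure is the image of Lebesgue measure on the slab under
  \<open>proj\<close>, so surface integrals become volume integrals, to which a change of variables
  applies.\<close>

lemma face_integral:
  fixes f :: "real^'d::_ \<Rightarrow> 'b::euclidean_space"
  assumes f: "continuous_on e f"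
  shows "integrable (face_measure e) f"
    and "(LINT x|face_measure e. f x) = integral slab (\<lambda>x. f (proj x))"
proof -
  let ?M = "restrict_space lborel slab" and ?N = "restrict_space borel e"
  have pm: "proj \<in> ?M \<rightarrow>\<^sub>M ?N"
  proof (rule measurable_restrict_space2)
    show "proj \<in> space ?M \<rightarrow> e" by (auto simp: space_restrict_space slab_def)
    show "proj \<in> borel_measurable ?M"
      by (rule measurable_restrict_space1)
         (use borel_measurable_continuous_onI[OF continuous_proj] in simp)
  qed
  have fm: "f \<in> borel_measurable ?N" by (rule borel_measurable_continuous_on_restrict[OF f])
  have slab: "slab \<in> sets lborel" using compact_slab by (simp add: compact_imp_closed)
  have "continuous_on slab (\<lambda>x. f (proj x))"
    by (rule continuous_on_compose2[OF f continuous_proj]) (auto simp: slab_def)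
  then have int: "set_integrable lborel slab (\<lambda>x. f (proj x))"
    unfolding set_integrable_def by (rule borel_integrable_compact[OF compact_slab])
  then show "integrable (face_measure e) f"
    unfolding face_measure_eq integrable_distr_eq[OF pm fm]
    using slab by (simp add: integrable_restrict_space set_integrable_def)
  show "(LINT x|face_measure e. f x) = integral slab (\<lambda>x. f (proj x))"
    unfolding face_measure_eq integral_distr[OF pm fm] set_borel_integral_eq_integral(2)[OF int, symmetric]
    using slab by (simp add: integral_restrict_space set_lebesgue_integral_def)
qed

text \<open>The slab over \<open>e\<close>, whose volume is the surface measure of \<open>e\<close>, is mapped onto the layer
  between \<open>T\<close> and its image under the contraction by \<open>1 - \<epsilon>\<close> towards the apex \<open>w\<close>. Dividing by
  \<open>\<epsilon>\<close> and letting \<open>\<epsilon> \<rightarrow> 0\<close> turns a difference of two volume integrals into the integral over \<open>e\<close>.\<close>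

definition shell :: "real \<Rightarrow> real^'d::_ \<Rightarrow> real^'d::_" where
  "shell \<epsilon> x = w + (1 - \<epsilon> * (n \<bullet> (x - w) - h + 1/2)) *\<^sub>R (proj x - w)"

lemma shell_derivative:
  "(shell \<epsilon> has_derivative (\<lambda>y. (1 - \<epsilon> * (n \<bullet> (x - w) - h + 1/2)) *\<^sub>R y +
     (n \<bullet> y) *\<^sub>R (- (1 - \<epsilon> * (n \<bullet> (x - w) - h + 1/2)) *\<^sub>R n - \<epsilon> *\<^sub>R (proj x - w)))) (at x within A)"
  unfolding shell_def proj_def
  by (rule derivative_eq_intros refl ext | simp add: algebra_simps vec_eq_iff)+

text \<open>The scaling factor cancels against the first part of the rank-one direction, and
  \<open>n \<bullet> (proj x - w) = h\<close> leaves \<open>- \<epsilon> * h\<close>. The sign is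
  negative because \<open>shell\<close> moves towards the apex while \<open>x\<close> moves
  outwards.\<close>

lemma shell_det:
  assumes "1 - \<epsilon> * (n \<bullet> (x - w) - h + 1/2) \<noteq> 0"
  shows "det (matrix (\<lambda>y. (1 - \<epsilon> * (n \<bullet> (x - w) - h + 1/2)) *\<^sub>R y +
     (n \<bullet> y) *\<^sub>R (- (1 - \<epsilon> * (n \<bullet> (x - w) - h + 1/2)) *\<^sub>R n - \<epsilon> *\<^sub>R (proj x - w))))
   = - \<epsilon> * h * (1 - \<epsilon> * (n \<bullet> (x - w) - h + 1/2)) ^ (CARD('d) - 1)"
  unfolding det_scaling_plus_rank_one[OF n1 assms]
  by (simp add: inner_diff_right[of n "_ *\<^sub>R n"] nn normal_proj)

lemma slab_param: "x \<in> slab \<Longrightarrow> 0 \<le> n \<bullet> (x - w) - h + 1/2 \<and> n \<bullet> (x - w) - h + 1/2 \<le> 1"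
proof -
  assume "x \<in> slab"
  then have "n \<bullet> (x - w) - h \<le> 1/2" "- (n \<bullet> (x - w) - h) \<le> 1/2"
    by (simp_all only: slab_def mem_Collect_eq abs_le_iff)
  then show ?thesis by linarith
qed

lemma shell_scale:
  assumes "0 < \<epsilon>" "\<epsilon> < 1" "x \<in> slab"
  shows "1 - \<epsilon> \<le> 1 - \<epsilon> * (n \<bullet> (x - w) - h + 1/2)" "1 - \<epsilon> * (n \<bullet> (x - w) - h + 1/2) \<le> 1"
    "0 < 1 - \<epsilon> * (n \<bullet> (x - w) - h + 1/2)"
proof -
  have p: "0 \<le> n \<bullet> (x - w) - h + 1/2" "n \<bullet> (x - w) - h + 1/2 \<le> 1" using slab_param assms(3) by auto
  have "\<epsilon> * (n \<bullet> (x - w) - h + 1/2) \<le> \<epsilon> * 1" using p assms by (intro mult_left_mono) auto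
  moreover have "0 \<le> \<epsilon> * (n \<bullet> (x - w) - h + 1/2)" using p assms by (intro mult_nonneg_nonneg) auto
  ultimately show "1 - \<epsilon> \<le> 1 - \<epsilon> * (n \<bullet> (x - w) - h + 1/2)" "1 - \<epsilon> * (n \<bullet> (x - w) - h + 1/2) \<le> 1"
    "0 < 1 - \<epsilon> * (n \<bullet> (x - w) - h + 1/2)" using assms by linarith+
qed

lemma shell_inj:
  assumes "0 < \<epsilon>" "\<epsilon> < 1"
  shows "inj_on (shell \<epsilon>) slab"
proof (rule inj_onI)
  fix x y assume x: "x \<in> slab" and y: "y \<in> slab" and eq: "shell \<epsilon> x = shell \<epsilon> y"
  define s where "s x = 1 - \<epsilon> * (n \<bullet> (x - w) - h + 1/2)" for x
  have sh: "shell \<epsilon> x = w + s x *\<^sub>R (proj x - w)" for x by (simp add: shell_def s_def)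
  have "n \<bullet> (shell \<epsilon> x - w) = s x * h" for x by (simp add: sh normal_proj)
  then have "s x * h = s y * h" by (metis eq)
  then have s: "s x = s y" using h_pos by simp
  then have t: "n \<bullet> (x - w) = n \<bullet> (y - w)" using assms by (simp add: s_def)
  have "s x > 0" using shell_scale(3)[OF assms x] by (simp add: s_def)
  then have "proj x = proj y" using eq s by (simp add: sh)
  then show "x = y" using t by (simp add: proj_def)
qed

lemma bary_w: "e' facet_of T \<Longrightarrow> bary_coord T e' w = (if e = e' then 1 else 0)"
  using bary_apex[of e] apex_in_facet[of e' e] facet_iff[of e' w] facet by auto

lemma bary_cone: "e' facet_of T \<Longrightarrow> bary_coord T e' (w + s *\<^sub>R (x - w)) =
    (if e = e' then 1 - s else 0) + s * bary_coord T e' x"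
proof -
  assume e': "e' facet_of T"
  have "w + s *\<^sub>R (x - w) = (1 - s) *\<^sub>R w + s *\<^sub>R x" by (simp add: algebra_simps)
  then show ?thesis by (simp only: bary_affine bary_w[OF e']) simp
qed

text \<open>A point at relative position \<open>t\<close> in \<open>[0,1]\<close> across the slab is
  sent to a point whose coordinate for \<open>e\<close> is \<open>\<epsilon> * t\<close>; projecting
  centrally from \<open>w\<close> recovers its foot on \<open>e\<close>.\<close>

lemma shell_image:
  assumes \<epsilon>: "0 < \<epsilon>" "\<epsilon> < 1"
  shows "shell \<epsilon> ` slab = {x\<in>T. bary_coord T e x \<le> \<epsilon>}"
proof (rule subset_antisym; rule subsetI)
  fix z assume "z \<in> shell \<epsilon> ` slab"
  then obtain x where x: "x \<in> slab" "z = shell \<epsilon> x" by blast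
  define s where "s = 1 - \<epsilon> * (n \<bullet> (x - w) - h + 1/2)"
  have z: "z = w + s *\<^sub>R (proj x - w)" using x(2) by (simp add: shell_def s_def)
  have s: "1 - \<epsilon> \<le> s" "s \<le> 1" "0 < s" using shell_scale[OF \<epsilon> x(1)] by (auto simp: s_def)
  have p: "proj x \<in> T" "bary_coord T e (proj x) = 0"
    using x(1) facet_iff[OF facet] by (auto simp: slab_def)
  have "bary_coord T e z = 1 - s" by (simp add: z bary_cone[OF facet] p)
  moreover have "0 \<le> bary_coord T e' z" if "e' facet_of T" for e'
    using p(1) that s simplex_iff[of "proj x"] by (simp add: z bary_cone[OF that])
  ultimately show "z \<in> {x\<in>T. bary_coord T e x \<le> \<epsilon>}" using s simplex_iff[of z] by auto
next
  fix z assume "z \<in> {x\<in>T. bary_coord T e x \<le> \<epsilon>}"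
  then have z: "z \<in> T" "bary_coord T e z \<le> \<epsilon>" by auto
  define s where "s = 1 - bary_coord T e z"
  have s: "1 - \<epsilon> \<le> s" "s \<le> 1" "0 < s" using z \<epsilon> simplex_iff[of z] facet by (auto simp: s_def)
  define y where "y = w + (1 / s) *\<^sub>R (z - w)"
  have zy: "z = w + s *\<^sub>R (y - w)" using s by (simp add: y_def)
  have be: "bary_coord T e y = 0"
    using s unfolding y_def bary_cone[OF facet] by (simp add: s_def field_simps)
  moreover have "0 \<le> bary_coord T e' y" if "e' facet_of T" for e'
  proof (cases "e = e'")
    case False
    then show ?thesis using that z s simplex_iff[of z] by (simp add: y_def bary_cone[OF that])
  qed (use be in simp)
  ultimately have y: "y \<in> e" using facet_iff[OF facet] simplex_iff[of y] by blast
  \<comment> \<open>This inverts \<open>s = 1 - \<epsilon> * t\<close>; the \<open>1/2\<close>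
    accounts for the slab being centred at the hyperplane of \<open>e\<close>.\<close>
  define x where "x = y + ((1 - s) / \<epsilon> - 1/2) *\<^sub>R n"
  have px: "proj x = y" "n \<bullet> (x - w) - h = (1 - s) / \<epsilon> - 1/2"
    unfolding x_def by (rule proj_shift[OF y])+
  have "(1 - s) / \<epsilon> \<le> 1" "0 \<le> (1 - s) / \<epsilon>" using s \<epsilon> by (auto simp: field_simps)
  then have "\<bar>n \<bullet> (x - w) - h\<bar> \<le> 1/2" unfolding px(2) by linarith
  then have "x \<in> slab" using px(1) y unfolding slab_def by simp
  moreover have "shell \<epsilon> x = z" using \<epsilon> by (simp add: shell_def px zy[symmetric])
  ultimately show "z \<in> shell \<epsilon> ` slab" by blast
qed

lemma shrink_image:
  assumes \<epsilon>: "0 < \<epsilon>" "\<epsilon> < 1"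
  shows "(\<lambda>x. w + (1 - \<epsilon>) *\<^sub>R (x - w)) ` T = {x\<in>T. \<epsilon> \<le> bary_coord T e x}"
proof (rule subset_antisym; rule subsetI)
  fix z assume "z \<in> (\<lambda>x. w + (1 - \<epsilon>) *\<^sub>R (x - w)) ` T"
  then obtain x where x: "x \<in> T" "z = w + (1 - \<epsilon>) *\<^sub>R (x - w)" by blast
  have b: "0 \<le> bary_coord T e' x" if "e' facet_of T" for e' using x(1) simplex_iff that by blast
  have "0 \<le> bary_coord T e' z" if "e' facet_of T" for e'
    using b[OF that] \<epsilon> by (simp add: x(2) bary_cone[OF that])
  moreover have "\<epsilon> \<le> bary_coord T e z"
    using b[OF facet] \<epsilon> by (simp add: x(2) bary_cone[OF facet])
  ultimately show "z \<in> {x\<in>T. \<epsilon> \<le> bary_coord T e x}" using simplex_iff[of z] by blast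
next
  fix z assume "z \<in> {x\<in>T. \<epsilon> \<le> bary_coord T e x}"
  then have z: "z \<in> T" "\<epsilon> \<le> bary_coord T e z" by auto
  define y where "y = w + (1 / (1 - \<epsilon>)) *\<^sub>R (z - w)"
  have "0 \<le> bary_coord T e' y" if "e' facet_of T" for e'
  proof (cases "e = e'")
    case True
    have "bary_coord T e y = (bary_coord T e z - \<epsilon>) / (1 - \<epsilon>)"
    proof -
      have "(bary_coord T e z - \<epsilon>) / (1 - \<epsilon>) = (bary_coord T e z - 1) / (1 - \<epsilon>) + (1 - \<epsilon>) / (1 - \<epsilon>)"
        unfolding add_divide_distrib[symmetric] by simp
      then show ?thesis
        using \<epsilon> unfolding y_def bary_cone[OF facet] by (simp add: diff_divide_distrib)
    qed
    then show ?thesis using True z \<epsilon> by simp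
  next
    case False
    then show ?thesis using that z \<epsilon> simplex_iff[of z] by (simp add: y_def bary_cone[OF that])
  qed
  then have "y \<in> T" using simplex_iff by blast
  moreover have "z = w + (1 - \<epsilon>) *\<^sub>R (y - w)" using \<epsilon> by (simp add: y_def)
  ultimately show "z \<in> (\<lambda>x. w + (1 - \<epsilon>) *\<^sub>R (x - w)) ` T" by blast
qed

text \<open>\<open>T\<close> is cut where the coordinate of \<open>e\<close> equals
  \<open>\<epsilon>\<close>. The part near the apex is a contracted copy of \<open>T\<close> and the
  rest is the image of the slab; the cut lies in a hyperplane and is negligible.\<close>

lemma shell_difference:
  fixes \<phi> :: "real^'d::_ \<Rightarrow> real"
  assumes \<epsilon>: "0 < \<epsilon>" "\<epsilon> < 1" and \<phi>: "continuous_on T \<phi>"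
  shows "integral T (\<lambda>x. (\<phi> x - (1 - \<epsilon>) ^ CARD('d) * \<phi> (w + (1 - \<epsilon>) *\<^sub>R (x - w))) / \<epsilon>)
    = integral slab (\<lambda>x. h * (1 - \<epsilon> * (n \<bullet> (x - w) - h + 1/2)) ^ (CARD('d) - 1) * \<phi> (shell \<epsilon> x))"
    and "(\<lambda>x. (\<phi> x - (1 - \<epsilon>) ^ CARD('d) * \<phi> (w + (1 - \<epsilon>) *\<^sub>R (x - w))) / \<epsilon>) integrable_on T"
    and "(\<lambda>x. h * (1 - \<epsilon> * (n \<bullet> (x - w) - h + 1/2)) ^ (CARD('d) - 1) * \<phi> (shell \<epsilon> x)) integrable_on slab"
proof -
  let ?A = "{x\<in>T. bary_coord T e x \<le> \<epsilon>}" and ?B = "{x\<in>T. \<epsilon> \<le> bary_coord T e x}"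
  let ?s = "\<lambda>x. 1 - \<epsilon> * (n \<bullet> (x - w) - h + 1/2)"
  let ?G = "\<lambda>x. \<epsilon> * (h * ?s x ^ (CARD('d) - 1) * \<phi> (shell \<epsilon> x))"
  let ?H = "\<lambda>x. (1 - \<epsilon>) ^ CARD('d) * \<phi> (w + (1 - \<epsilon>) *\<^sub>R (x - w))"
  have absd: "\<bar>- \<epsilon> * h * ?s x ^ (CARD('d) - 1)\<bar> * \<phi> (shell \<epsilon> x) = ?G x" if "x \<in> slab" for x
    using shell_scale(3)[OF \<epsilon> that] \<epsilon> h_pos by (simp add: abs_mult)
  have cA: "continuous_on (shell \<epsilon> ` slab) \<phi>"
    unfolding shell_image[OF \<epsilon>] by (rule continuous_on_subset[OF \<phi>]) auto
  have det: "\<bar>det (matrix (\<lambda>y. ?s x *\<^sub>R y + (n \<bullet> y) *\<^sub>R (- ?s x *\<^sub>R n - \<epsilon> *\<^sub>R (proj x - w))))\<bar> * \<phi> (shell \<epsilon> x) = ?G x"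
    if "x \<in> slab" for x
    using shell_det[of \<epsilon> x] shell_scale(3)[OF \<epsilon> that] absd[OF that] by simp
  have G: "integral ?A \<phi> = integral slab ?G" "?G integrable_on slab"
  proof -
    note I = integral_image_C1[OF compact_slab shell_derivative shell_inj[OF \<epsilon>] cA]
    show "integral ?A \<phi> = integral slab ?G"
      using I(1) unfolding shell_image[OF \<epsilon>] by (simp only: integral_cong[OF det])
    show "?G integrable_on slab" by (rule integrable_eq[OF I(2) det])
  qed
  have cB: "continuous_on ((\<lambda>x. w + (1 - \<epsilon>) *\<^sub>R (x - w)) ` T) \<phi>"
    unfolding shrink_image[OF \<epsilon>] by (rule continuous_on_subset[OF \<phi>]) auto
  have H: "integral ?B \<phi> = integral T ?H" "?H integrable_on T"
  proof -
    have d: "((\<lambda>x. w + (1 - \<epsilon>) *\<^sub>R (x - w)) has_derivative (\<lambda>y. (1 - \<epsilon>) *\<^sub>R y)) (at x within T)" for x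
      by (auto intro!: derivative_eq_intros)
    have i: "inj_on (\<lambda>x. w + (1 - \<epsilon>) *\<^sub>R (x - w)) T" using \<epsilon> by (auto intro!: inj_onI)
    note I = integral_image_C1[OF compact_T d i cB]
    show "integral ?B \<phi> = integral T ?H" "?H integrable_on T"
      using I \<epsilon> unfolding shrink_image[OF \<epsilon>] det_scaling by simp_all
  qed
  have intT: "\<phi> integrable_on T"
    using absolutely_integrable_continuous_compact[OF compact_T \<phi>] absolutely_integrable_on_def by blast
  have sub: "\<phi> integrable_on U" if "U \<subseteq> T" "compact U" for U
    using absolutely_integrable_continuous_compact[OF that(2) continuous_on_subset[OF \<phi> that(1)]]
      absolutely_integrable_on_def by blast
  have "compact ?A" unfolding shell_image[OF \<epsilon>, symmetric]
    by (intro compact_continuous_image compact_slab has_derivative_continuous_on[OF shell_derivative])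
  moreover have "compact ?B" unfolding shrink_image[OF \<epsilon>, symmetric]
    by (intro compact_continuous_image continuous_intros compact_T)
  moreover have "negligible (?A \<inter> ?B)"
  proof (rule negligible_subset)
    have "n \<noteq> 0" using n1 by auto
    then show "negligible {x. n \<bullet> x = n \<bullet> w + (1 - \<epsilon>) * h}" by (intro negligible_hyperplane) simp
    show "?A \<inter> ?B \<subseteq> {x. n \<bullet> x = n \<bullet> w + (1 - \<epsilon>) * h}"
    proof
      fix x assume "x \<in> ?A \<inter> ?B"
      then have "n \<bullet> (x - w) / h = 1 - \<epsilon>" by (auto simp: bary_coord_def)
      then show "x \<in> {x. n \<bullet> x = n \<bullet> w + (1 - \<epsilon>) * h}"
        using h_pos by (simp add: inner_diff_right field_simps)
    qed
  qed
  ultimately have "integral (?A \<union> ?B) \<phi> = integral ?A \<phi> + integral ?B \<phi>"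
    by (intro integral_Un sub) auto
  moreover have "?A \<union> ?B = T" by auto
  ultimately have split: "integral T \<phi> = integral slab ?G + integral T ?H" using G H by simp
  have "integral T (\<lambda>x. (\<phi> x - ?H x) / \<epsilon>) = (integral T \<phi> - integral T ?H) / \<epsilon>"
    using intT H(2) by (simp add: integral_diff)
  also have "\<dots> = integral slab (\<lambda>x. h * ?s x ^ (CARD('d) - 1) * \<phi> (shell \<epsilon> x))"
    unfolding split using \<epsilon> by simp
  finally show "integral T (\<lambda>x. (\<phi> x - ?H x) / \<epsilon>)
    = integral slab (\<lambda>x. h * ?s x ^ (CARD('d) - 1) * \<phi> (shell \<epsilon> x))" .
  show "(\<lambda>x. (\<phi> x - ?H x) / \<epsilon>) integrable_on T"
    using integrable_on_cmult_left[OF integrable_diff[OF intT H(2)], of "1/\<epsilon>"] by simp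
  show "(\<lambda>x. h * ?s x ^ (CARD('d) - 1) * \<phi> (shell \<epsilon> x)) integrable_on slab"
    using integrable_on_cmult_left[OF G(2), of "1/\<epsilon>"] \<epsilon> by simp
qed

text \<open>Gauss' theorem for the field \<open>\<phi> (x - w)\<close>: the integrand on the left is
  its divergence, and its normal component is \<open>h * \<phi>\<close> on \<open>e\<close> and
  \<open>0\<close> on the other facets.\<close>

lemma cone_formula:
  fixes \<phi> :: "real^'d::_ \<Rightarrow> real" and g :: "real^'d::_ \<Rightarrow> real^'d::_"
  assumes \<phi>': "\<And>x. (\<phi> has_derivative (\<lambda>y. g x \<bullet> y)) (at x)" and g: "continuous_on UNIV g"
  shows "integral T (\<lambda>x. g x \<bullet> (x - w) + real CARD('d) * \<phi> x) = h * (LINT y|face_measure e. \<phi> y)"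
proof -
  let ?d = "CARD('d)"
  \<comment> \<open>The dilation by \<open>r\<close> together with its Jacobian factor. Its
    difference quotient at \<open>r = 1\<close> is the integrand of \<open>shell_difference\<close>,
    and \<open>?F' x 1\<close> is the divergence of \<open>\<phi> (x - w)\<close>.\<close>
  let ?F = "\<lambda>x r. r ^ ?d * \<phi> (w + r *\<^sub>R (x - w))"
  let ?F' = "\<lambda>x r. real ?d * r ^ (?d - 1) * \<phi> (w + r *\<^sub>R (x - w)) + r ^ ?d * (g (w + r *\<^sub>R (x - w)) \<bullet> (x - w))"
  \<comment> \<open>Adding \<open>2\<close> keeps the value strictly between \<open>0\<close> and
    \<open>1\<close>, also for \<open>k = 0\<close>.\<close>
  let ?\<epsilon> = "\<lambda>k. 1 / (real k + 2)"
  have \<epsilon>: "0 < ?\<epsilon> k" "?\<epsilon> k < 1" for k by (auto simp: field_simps)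
  have \<epsilon>0: "?\<epsilon> \<longlonglongrightarrow> 0"
    using LIMSEQ_ignore_initial_segment[OF LIMSEQ_inverse_real_of_nat, of 1]
    by (simp add: inverse_eq_divide add.commute)
  have c\<phi>: "continuous_on UNIV \<phi>"
    using \<phi>' has_derivative_continuous continuous_at_imp_continuous_on by blast
  have DF: "((\<lambda>r. ?F x r) has_real_derivative ?F' x r) (at r)" for x r
  proof -
    have l: "((\<lambda>r. w + r *\<^sub>R (x - w)) has_derivative (\<lambda>s. s *\<^sub>R (x - w))) (at r)"
      by (auto intro!: derivative_eq_intros)
    have "((\<lambda>r. \<phi> (w + r *\<^sub>R (x - w))) has_derivative (\<lambda>s. g (w + r *\<^sub>R (x - w)) \<bullet> (s *\<^sub>R (x - w)))) (at r)"
      by (rule has_derivative_compose[OF l \<phi>'])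
    then have "((\<lambda>r. \<phi> (w + r *\<^sub>R (x - w))) has_real_derivative g (w + r *\<^sub>R (x - w)) \<bullet> (x - w)) (at r)"
      by (simp add: has_field_derivative_def mult.commute[of _ "g _ \<bullet> _"] mult_commute_abs)
    then show ?thesis
      by (auto intro!: derivative_eq_intros simp: algebra_simps)
  qed
  \<comment> \<open>By the mean value theorem the difference quotients are values of
    \<open>?F'\<close>, so this bound dominates them uniformly in \<open>k\<close>.\<close>
  obtain M where M: "\<And>x r. x \<in> T \<Longrightarrow> r \<in> {0..1} \<Longrightarrow> \<bar>?F' x r\<bar> \<le> M"
  proof -
    have "continuous_on (T \<times> {0..1}) (\<lambda>p. ?F' (fst p) (snd p))"
      by (intro continuous_intros continuous_on_compose2[OF c\<phi>] continuous_on_compose2[OF g]) auto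
    then have "compact ((\<lambda>p. ?F' (fst p) (snd p)) ` (T \<times> {0..1}))"
      by (intro compact_continuous_image compact_Times compact_T) auto
    from iffD1[OF bounded_iff compact_imp_bounded[OF this]] obtain M
      where M: "\<forall>y\<in>(\<lambda>p. ?F' (fst p) (snd p)) ` (T \<times> {0..1}). norm y \<le> M"
      by (elim exE) (rule that)
    have "\<bar>?F' x r\<bar> \<le> M" if "x \<in> T" "r \<in> {0..1}" for x r
      using bspec[OF M imageI[of "(x, r)"]] that by simp
    then show ?thesis by (rule that)
  qed
  let ?q = "\<lambda>k x. (\<phi> x - (1 - ?\<epsilon> k) ^ ?d * \<phi> (w + (1 - ?\<epsilon> k) *\<^sub>R (x - w))) / ?\<epsilon> k"
  let ?b = "\<lambda>k x. h * (1 - ?\<epsilon> k * (n \<bullet> (x - w) - h + 1/2)) ^ (?d - 1) * \<phi> (shell (?\<epsilon> k) x)"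
  have cT: "continuous_on T \<phi>" using c\<phi> continuous_on_subset by blast
  note S = shell_difference[OF \<epsilon> cT]
  have const: "(\<lambda>x. c) integrable_on A" if "compact A" for c :: real and A :: "(real^'d::_) set"
    using absolutely_integrable_continuous_compact[OF that continuous_on_const] absolutely_integrable_on_def by blast
  have 1: "(\<lambda>k. integral T (?q k)) \<longlonglongrightarrow> integral T (\<lambda>x. ?F' x 1)"
  proof (rule dominated_convergence(2)[where h="\<lambda>_. M"])
    show "?q k integrable_on T" for k by (rule S(2))
    show "(\<lambda>_. M) integrable_on T" by (rule const[OF compact_T])
  next
    fix k x assume x: "x \<in> T"
    have "\<exists>z>1 - ?\<epsilon> k. z < 1 \<and> ?F x 1 - ?F x (1 - ?\<epsilon> k) = (1 - (1 - ?\<epsilon> k)) * ?F' x z"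
      using \<epsilon>[of k] by (intro MVT2 DF) auto
    then obtain z where z: "1 - ?\<epsilon> k < z" "z < 1" "?F x 1 - ?F x (1 - ?\<epsilon> k) = ?\<epsilon> k * ?F' x z"
      by auto
    have "?q k x = ?F' x z" using z(3) \<epsilon>[of k] by (simp add: field_simps)
    moreover have "0 \<le> z" using z(1) \<epsilon>(2)[of k] by linarith
    then have "z \<in> {0..1}" using z(2) by simp
    ultimately show "norm (?q k x) \<le> M" using M[OF x] by simp
  next
    fix x assume "x \<in> T"
    have "((\<lambda>t. (?F x (1 + t) - ?F x 1) / t) \<longlongrightarrow> ?F' x 1) (at 0)"
      using DF[of x 1] by (simp only: DERIV_def)
    moreover have "filterlim (\<lambda>k. - ?\<epsilon> k) (at 0) sequentially"
      using tendsto_minus[OF \<epsilon>0] \<epsilon> by (intro filterlim_atI) (auto simp: less_le intro!: always_eventually)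
    ultimately have "(\<lambda>k. (?F x (1 + - ?\<epsilon> k) - ?F x 1) / (- ?\<epsilon> k)) \<longlonglongrightarrow> ?F' x 1"
      by (rule filterlim_compose)
    moreover have "(?F x (1 + - ?\<epsilon> k) - ?F x 1) / (- ?\<epsilon> k) = ?q k x" for k
    proof -
      have neg: "(a - b) / (- c) = (b - a) / c" for a b c :: real
        by (simp add: divide_inverse algebra_simps)
      show ?thesis by (subst neg) simp
    qed
    ultimately show "(\<lambda>k. ?q k x) \<longlonglongrightarrow> ?F' x 1" by simp
  qed
  obtain B where B: "\<And>x. x \<in> T \<Longrightarrow> \<bar>\<phi> x\<bar> \<le> B"
  proof -
    have "bounded (\<phi> ` T)" using compact_continuous_image[OF cT compact_T] by (rule compact_imp_bounded)
    then obtain B where "\<forall>y\<in>\<phi> ` T. norm y \<le> B" unfolding bounded_iff by blast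
    then show ?thesis by (intro that[of B]) simp
  qed
  have 2: "(\<lambda>k. integral slab (?b k)) \<longlonglongrightarrow> integral slab (\<lambda>x. h * \<phi> (proj x))"
  proof (rule dominated_convergence(2)[where h="\<lambda>_. h * B"])
    show "?b k integrable_on slab" for k by (rule S(3))
    show "(\<lambda>_. h * B) integrable_on slab" by (rule const[OF compact_slab])
  next
    fix k x assume x: "x \<in> slab"
    have "shell (?\<epsilon> k) x \<in> T" using shell_image[OF \<epsilon>[of k]] x by blast
    then have b: "\<bar>\<phi> (shell (?\<epsilon> k) x)\<bar> \<le> B" by (rule B)
    have s: "\<bar>(1 - ?\<epsilon> k * (n \<bullet> (x - w) - h + 1/2)) ^ (?d - 1)\<bar> \<le> 1"
      using shell_scale[OF \<epsilon>[of k] x] by (simp add: power_le_one)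
    have "norm (?b k x) = h * (\<bar>(1 - ?\<epsilon> k * (n \<bullet> (x - w) - h + 1/2)) ^ (?d - 1)\<bar> * \<bar>\<phi> (shell (?\<epsilon> k) x)\<bar>)"
      using h_pos by (simp add: abs_mult)
    also have "\<dots> \<le> h * (1 * B)" using h_pos b s by (intro mult_left_mono mult_mono) auto
    finally show "norm (?b k x) \<le> h * B" by simp
  next
    fix x assume x: "x \<in> slab"
    have sh: "(\<lambda>k. shell (?\<epsilon> k) x) \<longlonglongrightarrow> w + (1 - 0 * (n \<bullet> (x - w) - h + 1/2)) *\<^sub>R (proj x - w)"
      unfolding shell_def by (intro tendsto_intros \<epsilon>0)
    have "isCont \<phi> (w + (1 - 0 * (n \<bullet> (x - w) - h + 1/2)) *\<^sub>R (proj x - w))"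
      using c\<phi> by (simp add: continuous_on_eq_continuous_at)
    then have "(\<lambda>k. \<phi> (shell (?\<epsilon> k) x)) \<longlonglongrightarrow> \<phi> (w + (1 - 0 * (n \<bullet> (x - w) - h + 1/2)) *\<^sub>R (proj x - w))"
      using sh by (rule isCont_tendsto_compose)
    then have "?b x' x = ?b x' x \<and> (\<lambda>k. ?b k x) \<longlonglongrightarrow> h * (1 - 0 * (n \<bullet> (x - w) - h + 1/2)) ^ (?d - 1) *
        \<phi> (w + (1 - 0 * (n \<bullet> (x - w) - h + 1/2)) *\<^sub>R (proj x - w))" for x'
      by (intro conjI refl tendsto_intros \<epsilon>0)
    then show "(\<lambda>k. ?b k x) \<longlonglongrightarrow> h * \<phi> (proj x)" by simp
  qed
  have "integral T (\<lambda>x. ?F' x 1) = integral slab (\<lambda>x. h * \<phi> (proj x))"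
    using 1 2 unfolding S(1) by (rule LIMSEQ_unique)
  then show ?thesis
    using face_integral(2)[of \<phi>] continuous_on_subset[OF c\<phi>, of e] by (simp add: add.commute)
qed

end

section \<open>Gauss' theorem for the fields \<open>a + b x\<close>\<close>

text \<open>This compares divergences in \<open>radial_expansion\<close>: each radial field has
  divergence \<open>d\<close>, the whole field \<open>d * b\<close>. The proof uses that barycentric
  coordinates sum to \<open>1\<close> at every point.\<close>

lemma (in full_simplex) radial_coefficient_sum:
  "(\<Sum>e | e facet_of T. b * bary_coord T e 0 + outward_normal T e \<bullet> a / facet_height T e) = b"
proof -
  have c: "bary_coord T e a = bary_coord T e 0 - outward_normal T e \<bullet> a / facet_height T e" for e
    by (simp add: bary_coord_def inner_diff_right diff_divide_distrib)
  have "(\<Sum>e | e facet_of T. outward_normal T e \<bullet> a / facet_height T e) = 0"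
    using bary_sum[of a] bary_sum[of 0] by (simp add: c sum_subtractf)
  then show ?thesis
    using bary_sum[of 0] by (simp add: sum.distrib flip: sum_distrib_left)
qed

text \<open>Among the radial fields only the one of \<open>e\<close> itself has a normal component
  on \<open>e\<close>. In particular this component is constant on \<open>e\<close> and determines
  the coefficient.\<close>

lemma (in full_simplex) normal_component:
  assumes e: "e facet_of T" and x: "x \<in> e"
  shows "outward_normal T e \<bullet> (a + b *\<^sub>R x) =
    (b * bary_coord T e 0 + outward_normal T e \<bullet> a / facet_height T e) * facet_height T e"
proof -
  let ?c = "\<lambda>e. b * bary_coord T e 0 + outward_normal T e \<bullet> a / facet_height T e"
  have "outward_normal T e \<bullet> (a + b *\<^sub>R x) =
      (\<Sum>e' | e' facet_of T. ?c e' * (outward_normal T e \<bullet> (x - apex T e')))"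
    unfolding radial_expansion[of a b x] inner_sum_right by simp
  also have "\<dots> = (\<Sum>e' | e' facet_of T. if e' = e then ?c e * facet_height T e else 0)"
    by (intro sum.cong) (auto simp: normal_radial e x)
  also have "\<dots> = ?c e * facet_height T e"
    using finite_facets e by (simp add: sum.delta)
  finally show ?thesis .
qed

text \<open>The cone formulas are added with the weights of the radial expansion. Taking
  \<open>b = 0\<close> serves the gradient, general \<open>b\<close> the weak divergence of
  Raviart--Thomas functions.\<close>

lemma simplex_gauss:
  fixes T :: "(real^'d::{finite,wellorder}) set"
    and \<phi> :: "real^'d::_ \<Rightarrow> real" and g :: "real^'d::_ \<Rightarrow> real^'d::_"
  assumes T: "int CARD('d) simplex T"
    and \<phi>': "\<And>x. (\<phi> has_derivative (\<lambda>y. g x \<bullet> y)) (at x)" and g: "continuous_on UNIV g"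
  shows "integral T (\<lambda>x. g x \<bullet> (a + b *\<^sub>R x) + real CARD('d) * b * \<phi> x) =
    (\<Sum>e | e facet_of T. LINT x|face_measure e. \<phi> x * (outward_normal T e \<bullet> (a + b *\<^sub>R x)))"
proof -
  interpret full_simplex T by unfold_locales (rule T)
  let ?c = "\<lambda>e. b * bary_coord T e 0 + outward_normal T e \<bullet> a / facet_height T e"
  let ?f = "\<lambda>e x. g x \<bullet> (x - apex T e) + real CARD('d) * \<phi> x"
  have c\<phi>: "continuous_on UNIV \<phi>"
    using \<phi>' has_derivative_continuous continuous_at_imp_continuous_on by blast
  have int: "(\<lambda>x. ?c e * ?f e x) integrable_on T" for e
  proof -
    have "continuous_on T (\<lambda>x. ?c e * ?f e x)"
      by (intro continuous_intros continuous_on_subset[OF c\<phi>] continuous_on_subset[OF g]) auto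
    then show ?thesis
      using absolutely_integrable_continuous_compact[OF compact_T] absolutely_integrable_on_def by blast
  qed
  have "g x \<bullet> (a + b *\<^sub>R x) + real CARD('d) * b * \<phi> x = (\<Sum>e | e facet_of T. ?c e * ?f e x)" for x
  proof -
    have "g x \<bullet> (a + b *\<^sub>R x) = (\<Sum>e | e facet_of T. ?c e * (g x \<bullet> (x - apex T e)))"
      unfolding radial_expansion[of a b x] inner_sum_right by simp
    moreover have "real CARD('d) * b * \<phi> x = (\<Sum>e | e facet_of T. ?c e * (real CARD('d) * \<phi> x))"
      unfolding sum_distrib_right[symmetric] radial_coefficient_sum by simp
    ultimately show ?thesis by (simp only: distrib_left sum.distrib)
  qed
  then have "integral T (\<lambda>x. g x \<bullet> (a + b *\<^sub>R x) + real CARD('d) * b * \<phi> x) =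
      integral T (\<lambda>x. \<Sum>e | e facet_of T. ?c e * ?f e x)" by simp
  also have "\<dots> = (\<Sum>e | e facet_of T. integral T (\<lambda>x. ?c e * ?f e x))"
    using finite_facets int by (intro integral_sum) auto
  also have "\<dots> = (\<Sum>e | e facet_of T. LINT x|face_measure e. \<phi> x * (outward_normal T e \<bullet> (a + b *\<^sub>R x)))"
  proof (rule sum.cong[OF refl])
    fix e assume "e \<in> {e. e facet_of T}"
    then have e: "e facet_of T" by simp
    interpret simplex_facet T e by unfold_locales (rule e)
    have sp: "space (face_measure e) = e"
      by (simp add: face_measure_def Let_def space_restrict_space)
    have "integral T (\<lambda>x. ?c e * ?f e x) = ?c e * (facet_height T e * (LINT y|face_measure e. \<phi> y))"
      using cone_formula[OF \<phi>' g] by simp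
    also have "\<dots> = (LINT y|face_measure e. \<phi> y * (?c e * facet_height T e))" by simp
    also have "\<dots> = (LINT x|face_measure e. \<phi> x * (outward_normal T e \<bullet> (a + b *\<^sub>R x)))"
      by (rule Bochner_Integration.integral_cong) (simp_all add: sp normal_component[OF e])
    finally show "integral T (\<lambda>x. ?c e * ?f e x) =
      (LINT x|face_measure e. \<phi> x * (outward_normal T e \<bullet> (a + b *\<^sub>R x)))" .
  qed
  finally show ?thesis .
qed

section \<open>The mesh\<close>

text \<open>\<open>e\<close> spans its hyperplane, so \<open>m\<close> is orthogonal to all its
  directions. What remains of \<open>m\<close> after removing its normal part is such a direction
  and hence orthogonal to itself.\<close>

lemma (in full_simplex) parallel_normal:
  assumes e: "e facet_of T" and m: "\<And>x y. x \<in> e \<Longrightarrow> y \<in> e \<Longrightarrow> m \<bullet> (x - y) = 0"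
  shows "m = (m \<bullet> outward_normal T e) *\<^sub>R outward_normal T e"
proof -
  let ?n = "outward_normal T e"
  obtain y0 where y0: "y0 \<in> e" using facet_nonempty[OF e] by blast
  have nn: "?n \<bullet> ?n = 1" using facet_normal[OF e] by (simp add: norm_eq_1)
  have "e \<subseteq> {y. m \<bullet> y = m \<bullet> y0}" using m[OF _ y0] by (auto simp: inner_diff_right)
  then have sub: "affine hull e \<subseteq> {y. m \<bullet> y = m \<bullet> y0}"
    by (rule hull_minimal) (rule affine_hyperplane)
  have orth: "m \<bullet> u = 0" if "?n \<bullet> u = 0" for u
  proof -
    have "y0 + u \<in> affine hull e"
      using normal_facet[OF e y0] that
      by (simp add: affine_hull_facet[OF e] inner_add_right inner_diff_right)
    then have "m \<bullet> (y0 + u) = m \<bullet> y0" using sub by blast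
    then show ?thesis by (simp add: inner_add_right)
  qed
  let ?u = "m - (m \<bullet> ?n) *\<^sub>R ?n"
  have nu: "?n \<bullet> ?u = 0" using nn by (simp add: inner_diff_right inner_commute)
  have "?u \<bullet> ?u = m \<bullet> ?u - (m \<bullet> ?n) * (?n \<bullet> ?u)" by (simp only: inner_diff_left inner_scaleR_left)
  also have "\<dots> = 0" using orth[OF nu] nu by simp
  finally show ?thesis by simp
qed

lemma (in full_simplex) normal_unique_up_to_sign:
  assumes e: "e facet_of T" and m: "norm m = 1" "\<And>x y. x \<in> e \<Longrightarrow> y \<in> e \<Longrightarrow> m \<bullet> (x - y) = 0"
  shows "m = outward_normal T e \<or> m = - outward_normal T e"
proof -
  have eq: "m = (m \<bullet> outward_normal T e) *\<^sub>R outward_normal T e" by (rule parallel_normal[OF e m(2)])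
  have "norm m = \<bar>m \<bullet> outward_normal T e\<bar> * norm (outward_normal T e)" by (subst (1) eq) simp
  then have "\<bar>m \<bullet> outward_normal T e\<bar> = 1" using m(1) facet_normal[OF e] by simp
  then have "m \<bullet> outward_normal T e = 1 \<or> m \<bullet> outward_normal T e = -1" by linarith
  then show ?thesis
  proof
    assume "m \<bullet> outward_normal T e = 1"
    with eq show ?thesis by simp
  next
    assume "m \<bullet> outward_normal T e = -1"
    with eq show ?thesis by simp
  qed
qed

lemma (in full_simplex) normal_const_on_facet:
  assumes e: "e facet_of T" "x \<in> e" "y \<in> e"
  shows "outward_normal T e \<bullet> (x - y) = 0"
  using normal_facet[OF e(1,2)] normal_facet[OF e(1,3)] by (simp add: inner_diff_right)

text \<open>The graph condition excludes slits: a boundary point lies on or above the graph, and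
  arbitrarily near it there are open sets strictly above, which miss the domain. The mesh covers
  only \<open>closure \<Omega>\<close>; this brings the interiors of the simplices back into
  \<open>\<Omega>\<close>.\<close>

lemma lipschitz_domain_interior_closure:
  fixes \<Omega> :: "(real^'d::finite) set"
  assumes "lipschitz_domain \<Omega>"
  shows "interior (closure \<Omega>) = \<Omega>"
proof (rule subset_antisym)
  have op: "open \<Omega>" using assms by (simp add: lipschitz_domain_def)
  then show "\<Omega> \<subseteq> interior (closure \<Omega>)" by (simp add: closure_subset interior_maximal)
  show "interior (closure \<Omega>) \<subseteq> \<Omega>"
  proof (rule subsetI, rule ccontr)
    fix x assume x: "x \<in> interior (closure \<Omega>)" "x \<notin> \<Omega>"
    then have "x \<in> frontier \<Omega>" using op interior_subset by (auto simp: frontier_def interior_open)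
    then obtain a r C g where a: "norm a = 1" "0 < r" "C-lipschitz_on {y. a \<bullet> y = 0} g"
      and g: "\<And>y. y \<in> ball x r \<Longrightarrow> y \<in> \<Omega> \<longleftrightarrow> a \<bullet> y < g (y - (a \<bullet> y) *\<^sub>R a)"
      using assms unfolding lipschitz_domain_def by meson
    define G where "G y = g (y - (a \<bullet> y) *\<^sub>R a)" for y
    have aa: "a \<bullet> a = 1" using a(1) by (simp add: norm_eq_1)
    have "continuous_on {y. a \<bullet> y = 0} g" using a(3) by (rule lipschitz_on_continuous_on)
    then have cG: "continuous_on UNIV G" unfolding G_def
      by (rule continuous_on_compose2) (auto intro!: continuous_intros simp: inner_diff_right aa)
    obtain r' where r': "r' > 0" "ball x r' \<subseteq> interior (closure \<Omega>)"
      using x(1) open_contains_ball open_interior by meson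
    \<comment> \<open>Small enough for \<open>y\<close> to stay in the chart and in the
      neighbourhood contained in \<open>closure \<Omega>\<close>, yet positive, so that
      \<open>y\<close> is strictly above the graph.\<close>
    define t where "t = min r r' / 2"
    have t: "0 < t" "t < r" "t < r'" using a(2) r'(1) by (auto simp: t_def)
    define y where "y = x + t *\<^sub>R a"
    have dy: "dist x y = t" using t a(1) by (simp add: y_def dist_norm)
    have "y \<in> closure \<Omega>" using dy t r'(2) interior_subset by (force simp: dist_commute)
    moreover have "y \<in> ball x r \<inter> {z. G z < a \<bullet> z}"
    proof -
      have "G x \<le> a \<bullet> x" using g[of x] x(2) a(2) by (simp add: G_def)
      moreover have "G y = G x" unfolding G_def y_def
        by (simp add: inner_add_right aa scaleR_add_left)
      moreover have "a \<bullet> y = a \<bullet> x + t" by (simp add: y_def inner_add_right aa)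
      ultimately show ?thesis using t dy by simp
    qed
    moreover have "open (ball x r \<inter> {z. G z < a \<bullet> z})"
      by (intro open_Int open_ball open_Collect_less cG continuous_intros)
    ultimately obtain z where "z \<in> \<Omega>" "z \<in> ball x r" "G z < a \<bullet> z"
      using open_Int_closure_eq_empty by blast
    then show False using g[of z] by (simp add: G_def)
  qed
qed

section \<open>Neighbouring simplices of a conforming mesh\<close>

locale fem_mesh =
  fixes \<Omega> :: "(real^'d::{finite,wellorder}) set" and Th :: "(real^'d::_) set set"
    and ne :: "(real^'d::_) set \<Rightarrow> real^'d::_"
  assumes lipschitz: "lipschitz_domain \<Omega>"
    and triangulation: "triangulation Th"
    and simplices: "\<And>T. T \<in> Th \<Longrightarrow> int CARD('d) simplex T"
    and cover: "\<Union>Th = closure \<Omega>"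
    and normals: "face_normals Th ne"
begin

lemma full: "T \<in> Th \<Longrightarrow> full_simplex T"
  by unfold_locales (rule simplices)

lemma finite_Th: "finite Th" and face_inter: "T \<in> Th \<Longrightarrow> T' \<in> Th \<Longrightarrow> T \<inter> T' face_of T"
  using triangulation by (auto simp: triangulation_def)

lemma open_domain: "open \<Omega>" and bounded_domain: "bounded \<Omega>"
  and connected_domain: "connected \<Omega>" and domain_nonempty: "\<Omega> \<noteq> {}"
  using lipschitz by (auto simp: lipschitz_domain_def)

lemma interior_cover: "interior (\<Union>Th) = \<Omega>"
  using lipschitz_domain_interior_closure[OF lipschitz] cover by simp

lemma simplex_subset: "T \<in> Th \<Longrightarrow> T \<subseteq> closure \<Omega>"
  using cover by blast

lemma interior_simplex_subset: "T \<in> Th \<Longrightarrow> interior T \<subseteq> \<Omega>"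
  using interior_cover interior_mono[of T "\<Union>Th"] by blast

lemma frontier_domain_subset: "frontier \<Omega> \<subseteq> (\<Union>T\<in>Th. frontier T)"
proof
  fix x assume "x \<in> frontier \<Omega>"
  then have x: "x \<in> closure \<Omega>" "x \<notin> \<Omega>" using open_domain by (auto simp: frontier_def interior_open)
  then obtain T where T: "T \<in> Th" "x \<in> T" using cover by blast
  then have "x \<notin> interior T" using interior_simplex_subset x by blast
  then show "x \<in> (\<Union>T\<in>Th. frontier T)" using T closure_subset by (auto simp: frontier_def)
qed

lemma negligible_frontier_simplex: "T \<in> Th \<Longrightarrow> negligible (frontier T)"
  using full_simplex.convex_T[OF full] by (rule negligible_convex_frontier)

lemma negligible_skeleton: "negligible (\<Union>T\<in>Th. frontier T)"
  using negligible_frontier_simplex finite_Th by (auto intro: negligible_Union)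

text \<open>Otherwise \<open>T\<close> would be a proper face of \<open>T'\<close>, although both
  have full dimension.\<close>

lemma inter_proper:
  assumes "T \<in> Th" "T' \<in> Th" "T \<noteq> T'"
  shows "T \<inter> T' \<noteq> T"
proof
  assume eq: "T \<inter> T' = T"
  have "T' \<inter> T face_of T'" using face_inter assms by blast
  then have "T face_of T'" using eq by (simp add: Int_commute)
  then have "aff_dim T < aff_dim T'"
    using face_of_aff_dim_lt full_simplex.convex_T[OF full[OF assms(2)]] assms(3) by blast
  then show False using full_simplex.aff_dim_T[OF full] assms by simp
qed

lemma interior_disjoint:
  assumes "T \<in> Th" "T' \<in> Th" "T \<noteq> T'"
  shows "interior T \<inter> T' = {}"
proof -
  have "(T \<inter> T') \<inter> interior T = {}"
    using face_of_disjoint_interior[OF face_inter[OF assms(1,2)] inter_proper[OF assms]] .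
  then show ?thesis using interior_subset by blast
qed

lemma negligible_inter:
  assumes "T \<in> Th" "T' \<in> Th" "T \<noteq> T'"
  shows "negligible (T \<inter> T')"
  by (rule negligible_subset[OF negligible_frontier_simplex[OF assms(1)]])
     (use interior_disjoint[OF assms] closure_subset in \<open>auto simp: frontier_def\<close>)

text \<open>The common part is a face of \<open>T\<close> that meets the relative interior of
  \<open>e\<close>, so it contains \<open>e\<close>. Being a proper face it cannot have larger
  dimension. Hence neighbours share whole facets.\<close>

lemma facet_inter:
  assumes T: "T \<in> Th" "T' \<in> Th" "T \<noteq> T'" and e: "e facet_of T" and x: "x \<in> rel_interior e" "x \<in> T'"
  shows "T \<inter> T' = e" "e facet_of T'"
proof -
  interpret T: full_simplex T by (rule full[OF T(1)])
  interpret T': full_simplex T' by (rule full[OF T(2)])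
  have eT: "e \<subseteq> T" by (rule T.facet_subset[OF e])
  have "x \<in> T \<inter> T'" using x eT rel_interior_subset by blast
  then have sub: "e \<subseteq> T \<inter> T'"
    using subset_of_face_of[OF face_inter[OF T(1,2)] eT] x(1) by (auto simp: disjnt_iff)
  have f: "e face_of T \<inter> T'"
    using face_of_subset[OF facet_of_imp_face_of[OF e] sub] by simp
  have d: "aff_dim (T \<inter> T') < aff_dim T"
    using face_of_aff_dim_lt[OF T.convex_T face_inter[OF T(1,2)] inter_proper[OF T]] .
  have de: "aff_dim e = aff_dim T - 1" using e by (simp add: facet_of_def)
  show eq: "T \<inter> T' = e"
  proof (rule ccontr)
    assume "T \<inter> T' \<noteq> e"
    then have "aff_dim e < aff_dim (T \<inter> T')"
      using face_of_aff_dim_lt[OF _ f] T.convex_T T'.convex_T convex_Int by blast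
    then show False using d de by simp
  qed
  have "T' \<inter> T face_of T'" using face_inter T by blast
  then show "e facet_of T'"
    using eq de T.facet_nonempty[OF e] T.aff_dim_T T'.aff_dim_T
    by (simp add: facet_of_def Int_commute)
qed

text \<open>With equal normals both simplices would contain the same half-ball at a relative
  interior point of \<open>e\<close>, but their intersection is only \<open>e\<close>.\<close>

lemma opposite_normals:
  assumes T: "T \<in> Th" "T' \<in> Th" "T \<noteq> T'" and e: "e facet_of T" "e facet_of T'"
  shows "outward_normal T' e = - outward_normal T e"
proof (rule ccontr)
  interpret T: full_simplex T by (rule full[OF T(1)])
  interpret T': full_simplex T' by (rule full[OF T(2)])
  let ?n = "outward_normal T e"
  assume "outward_normal T' e \<noteq> - ?n"
  moreover have "outward_normal T' e = ?n \<or> outward_normal T' e = - ?n"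
    by (rule T.normal_unique_up_to_sign[OF e(1) T'.facet_normal[OF e(2)] T'.normal_const_on_facet[OF e(2)]])
  ultimately have n': "outward_normal T' e = ?n" by blast
  obtain x where x: "x \<in> rel_interior e"
    using rel_interior_eq_empty[OF T.convex_facet[OF e(1)]] T.facet_nonempty[OF e(1)] by blast
  have xe: "x \<in> e" using x rel_interior_subset by blast
  have eq: "T \<inter> T' = e"
    using facet_inter[OF T e(1) x] xe T'.facet_subset[OF e(2)] by blast
  obtain r where r: "r > 0" "\<And>y. dist x y < r \<Longrightarrow> ?n \<bullet> y \<le> ?n \<bullet> x \<Longrightarrow> y \<in> T"
    using T.half_ball_subset[OF e(1) x] by blast
  obtain r' where r': "r' > 0" "\<And>y. dist x y < r' \<Longrightarrow> ?n \<bullet> y \<le> ?n \<bullet> x \<Longrightarrow> y \<in> T'"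
    using T'.half_ball_subset[OF e(2) x] n' by metis
  define t where "t = min r r' / 2"
  have t: "0 < t" "t < r" "t < r'" using r(1) r'(1) by (auto simp: t_def)
  have n1: "norm ?n = 1" "?n \<bullet> ?n = 1" using T.facet_normal[OF e(1)] by (auto simp: norm_eq_1)
  let ?y = "x - t *\<^sub>R ?n"
  have "dist x ?y = t" "?n \<bullet> ?y \<le> ?n \<bullet> x"
    using t n1 by (auto simp: dist_norm inner_diff_right)
  then have "?y \<in> e" using r(2)[of ?y] r'(2)[of ?y] t eq by auto
  then have "?n \<bullet> (x - ?y) = 0" using T.normal_const_on_facet[OF e(1) xe] by blast
  then show False using t n1 by simp
qed

text \<open>If the normals do not cancel, \<open>e\<close> belongs to a single simplex
  \<open>T\<close>. A small step outwards from a relative interior point leaves \<open>T\<close> and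
  meets no other simplex, so such a point is not in the open set \<open>\<Omega>\<close>; the rest
  of \<open>e\<close> follows by closure.\<close>

lemma boundary_or_balanced:
  assumes "e \<in> faces Th"
  shows "e \<subseteq> frontier \<Omega> \<or> (\<Sum>T | T \<in> Th \<and> e facet_of T. outward_normal T e) = 0"
proof (rule disjCI)
  assume unbal: "(\<Sum>T | T \<in> Th \<and> e facet_of T. outward_normal T e) \<noteq> 0"
  obtain T where T: "T \<in> Th" "e facet_of T" using assms by (auto simp: faces_def)
  interpret T: full_simplex T by (rule full[OF T(1)])
  let ?n = "outward_normal T e"
  have only: "T' = T" if T': "T' \<in> Th" "e facet_of T'" for T'
  proof (rule ccontr)
    assume ne: "T' \<noteq> T"
    have n': "outward_normal T' e = - ?n" using opposite_normals[of T T' e] T T' ne by blast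
    \<comment> \<open>A third simplex at \<open>e\<close> would have a normal opposite both to
      \<open>?n\<close> and to \<open>- ?n\<close>.\<close>
    have "T'' = T \<or> T'' = T'" if "T'' \<in> Th" "e facet_of T''" for T''
    proof (rule ccontr)
      assume "\<not> (T'' = T \<or> T'' = T')"
      then have "outward_normal T'' e = - ?n" "outward_normal T'' e = - outward_normal T' e"
        using opposite_normals[of T T'' e] opposite_normals[of T' T'' e] T T' that by blast+
      then have "?n = - ?n" using n' by simp
      then have "?n = 0" by (simp add: eq_neg_iff_add_eq_0 flip: scaleR_2)
      then show False using T.facet_normal[OF T(2)] by simp
    qed
    then have "{T. T \<in> Th \<and> e facet_of T} = {T, T'}" using T T' by blast
    then show False using unbal ne n' by simp
  qed
  have "x \<notin> \<Omega>" if x: "x \<in> rel_interior e" for x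
  proof
    assume "x \<in> \<Omega>"
    then obtain r where r: "r > 0" "ball x r \<subseteq> \<Omega>" using open_domain open_contains_ball by blast
    have "x \<notin> T'" if "T' \<in> Th" "T' \<noteq> T" for T'
      using facet_inter[OF T(1) that(1) _ T(2) x] only that by blast
    then have "x \<in> - \<Union>(Th - {T})" by blast
    moreover have "open (- \<Union>(Th - {T}))"
      using finite_Th full_simplex.compact_T[OF full]
      by (intro open_Compl closed_Union) (auto intro: compact_imp_closed)
    ultimately obtain r' where r': "r' > 0" "ball x r' \<subseteq> - \<Union>(Th - {T})"
      using open_contains_ball by blast
    define t where "t = min r r' / 2"
    have t: "0 < t" "t < r" "t < r'" using r(1) r'(1) by (auto simp: t_def)
    have n1: "norm ?n = 1" "?n \<bullet> ?n = 1" using T.facet_normal[OF T(2)] by (auto simp: norm_eq_1)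
    let ?y = "x + t *\<^sub>R ?n"
    have dy: "dist x ?y = t" using t n1 by (simp add: dist_norm)
    then have "?y \<in> ball x r" "?y \<in> ball x r'" using t by simp_all
    then have "?y \<in> \<Omega>" "?y \<notin> \<Union>(Th - {T})" using r(2) r'(2) by blast+
    then have "?y \<in> T" using cover closure_subset by blast
    then have "0 \<le> bary_coord T e ?y" using T.simplex_iff T(2) by blast
    moreover have "x \<in> e" using x rel_interior_subset by blast
    ultimately have "0 \<le> - t / facet_height T e"
      using T.bary_eq_normal[OF T(2), of x ?y] n1 by simp
    then show False using divide_pos_pos[OF t(1) T.facet_height_pos[OF T(2)]] by simp
  qed
  moreover have "rel_interior e \<subseteq> closure \<Omega>"
    using rel_interior_subset T.facet_subset[OF T(2)] simplex_subset[OF T(1)] by blast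
  ultimately have "rel_interior e \<subseteq> frontier \<Omega>"
    using open_domain by (auto simp: frontier_def interior_open)
  then have "closure (rel_interior e) \<subseteq> frontier \<Omega>" by (simp add: closure_minimal frontier_closed)
  moreover have "e \<subseteq> closure (rel_interior e)"
    using convex_closure_rel_interior[OF T.convex_facet[OF T(2)]] closure_subset by blast
  ultimately show "e \<subseteq> frontier \<Omega>" by blast
qed

lemma face_normal:
  assumes "T \<in> Th" "e facet_of T"
  shows "ne e = (ne e \<bullet> outward_normal T e) *\<^sub>R outward_normal T e"
    "ne e \<bullet> outward_normal T e = 1 \<or> ne e \<bullet> outward_normal T e = -1"
proof -
  interpret T: full_simplex T by (rule full[OF assms(1)])
  have e: "e \<in> faces Th" using assms by (auto simp: faces_def)
  have n: "norm (ne e) = 1" "\<And>x y. x \<in> e \<Longrightarrow> y \<in> e \<Longrightarrow> ne e \<bullet> (x - y) = 0"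
    using normals e by (auto simp: face_normals_def)
  show "ne e = (ne e \<bullet> outward_normal T e) *\<^sub>R outward_normal T e"
    by (rule T.parallel_normal[OF assms(2) n(2)])
  have "outward_normal T e \<bullet> outward_normal T e = 1"
    using T.facet_normal[OF assms(2)] by (simp add: norm_eq_1)
  then show "ne e \<bullet> outward_normal T e = 1 \<or> ne e \<bullet> outward_normal T e = -1"
    using T.normal_unique_up_to_sign[OF assms(2) n] by auto
qed

lemma finite_faces: "finite (faces Th)"
proof -
  have "faces Th = (\<Union>T\<in>Th. {e. e facet_of T})" by (auto simp: faces_def)
  then show ?thesis using finite_Th full_simplex.finite_facets[OF full] by simp
qed

end

section \<open>The discrete operators\<close>

lemma integrable_on_continuous_compact:
  fixes f :: "'a::euclidean_space \<Rightarrow> 'b::euclidean_space"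
  assumes "compact S" "continuous_on S f"
  shows "f integrable_on S"
  using absolutely_integrable_continuous_compact[OF assms] absolutely_integrable_on_def by blast

lemma integral_const_compact:
  fixes S :: "'a::euclidean_space set" and c :: "'b::euclidean_space"
  assumes "compact S"
  shows "integral S (\<lambda>_. c) = measure lebesgue S *\<^sub>R c"
proof -
  have S: "S \<in> lmeasurable" using assms by (rule lmeasurable_compact)
  have "((\<lambda>x. 1 *\<^sub>R c) has_integral (integral S (\<lambda>x. 1::real)) *\<^sub>R c) S"
    by (intro has_integral_scaleR_left integrable_integral integrable_on_const S)
  then show ?thesis using lmeasure_integral[OF S] by (simp add: integral_unique)
qed

lemma space_face_measure: "space (face_measure e) = e"
  by (simp add: face_measure_def Let_def space_restrict_space)

abbreviation area :: "(real^'d::finite) set \<Rightarrow> real" where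
  "area e \<equiv> measure (face_measure e) e"

abbreviation vol :: "(real^'d::finite) set \<Rightarrow> real" where
  "vol T \<equiv> measure lebesgue T"

lemma face_integral_const:
  fixes c :: "'b::euclidean_space"
  assumes "\<And>x. x \<in> e \<Longrightarrow> f x = c"
  shows "(LINT x|face_measure e. f x) = area e *\<^sub>R c"
proof -
  have "(LINT x|face_measure e. f x) = (LINT x|face_measure e. c)"
    by (rule Bochner_Integration.integral_cong) (simp_all add: space_face_measure assms)
  then show ?thesis by (simp add: space_face_measure)
qed

context simplex_facet
begin

text \<open>The cone formula with \<open>\<phi> = 1\<close>; it transfers positivity from volumes to
  areas.\<close>

lemma cone_volume: "real CARD('d) * vol T = h * area e"
proof -
  have "integral T (\<lambda>x. 0 \<bullet> (x - w) + real CARD('d) * 1) = h * (LINT y|face_measure e. 1)"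
    by (rule cone_formula) (auto intro!: derivative_eq_intros)
  then show ?thesis using integral_const_compact[OF compact_T, of "real CARD('d)"]
    by (simp add: space_face_measure mult.commute)
qed

end

lemma (in full_simplex) vol_pos: "vol T > 0"
proof -
  have "\<not> negligible T"
    using interior_T_nonempty open_not_negligible[OF open_interior] interior_subset negligible_subset by blast
  then show ?thesis
    using negligible_iff_measure lmeasurable_compact[OF compact_T] by (metis measure_nonneg less_le)
qed

context fem_mesh
begin

text \<open>The value on the skeleton of the mesh, a null set, is \<open>0\<close>. Unlike the choices in the
  definitions of the discrete operators, this makes the dependence on the data linear everywhere.\<close>

definition piecewise :: "((real^'d::_) set \<Rightarrow> real^'d::_ \<Rightarrow> 'b::comm_monoid_add) \<Rightarrow> real^'d::_ \<Rightarrow> 'b" where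
  "piecewise F x = (\<Sum>T\<in>Th. if x \<in> interior T then F T x else 0)"

lemma piecewise_eq:
  assumes "T \<in> Th" "x \<in> interior T"
  shows "piecewise F x = F T x"
proof -
  have "x \<notin> interior T'" if "T' \<in> Th" "T' \<noteq> T" for T'
    using interior_disjoint[OF assms(1) that(1)] that(2) assms(2) interior_subset by blast
  then have "piecewise F x = (\<Sum>T'\<in>Th. if T' = T then F T x else 0)"
    unfolding piecewise_def using assms(2) by (intro sum.cong) auto
  also have "\<dots> = F T x" using finite_Th assms(1) by (simp add: sum.delta)
  finally show ?thesis .
qed

lemma piecewise_const_piecewise: "piecewise (\<lambda>T _. k T) \<in> piecewise_const Th"
proof -
  have "\<exists>c. \<forall>x\<in>interior T. piecewise (\<lambda>T _. k T) x = c" if "T \<in> Th" for T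
    by (intro exI[of _ "k T"] ballI) (simp add: piecewise_eq[OF that])
  then show ?thesis by (simp add: piecewise_const_def)
qed

lemma negligible_simplex_boundary: "T \<in> Th \<Longrightarrow> negligible (T - interior T)"
  by (rule negligible_subset[OF negligible_frontier_simplex]) (use closure_subset in \<open>auto simp: frontier_def\<close>)

lemma sets_domain: "\<Omega> \<in> sets lebesgue"
  using open_domain by simp

text \<open>Agreement with a continuous \<open>F\<close> is asked in the interior only, since this
  is where the chosen operators are determined; the boundary of a simplex is a null set.\<close>

lemma integral_simplex:
  fixes f :: "real^'d::_ \<Rightarrow> 'b::euclidean_space"
  assumes T: "T \<in> Th" and F: "continuous_on T F" and f: "\<And>x. x \<in> interior T \<Longrightarrow> f x = F x"
  shows "f absolutely_integrable_on T" and "integral T f = integral T F"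
    and "(LINT x|lebesgue_on T. f x) = integral T F"
proof -
  have cT: "compact T" using full_simplex.compact_T[OF full[OF T]] .
  have aF: "F absolutely_integrable_on T" by (rule absolutely_integrable_continuous_compact[OF cT F])
  show af: "f absolutely_integrable_on T"
    by (rule absolutely_integrable_spike[OF aF negligible_simplex_boundary[OF T]]) (use f in auto)
  show eq: "integral T f = integral T F"
    by (rule integral_spike[OF negligible_simplex_boundary[OF T]]) (use f in auto)
  have sT: "T \<in> sets lebesgue" using lmeasurable_compact[OF cT] by (simp add: fmeasurable_def)
  show "(LINT x|lebesgue_on T. f x) = integral T F"
    using lebesgue_integral_eq_integral[OF absolutely_integrable_imp_integrable[OF af sT] sT] eq by simp
qed

text \<open>Simplices overlap in null sets, and their union differs from \<open>\<Omega>\<close> by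
  a part of the skeleton.\<close>

lemma integral_domain:
  fixes f :: "real^'d::_ \<Rightarrow> 'b::euclidean_space"
  assumes F: "\<And>T. T \<in> Th \<Longrightarrow> continuous_on T (F T)"
    and f: "\<And>T x. T \<in> Th \<Longrightarrow> x \<in> interior T \<Longrightarrow> f x = F T x"
  shows "integrable (lebesgue_on \<Omega>) f"
    and "(LINT x|lebesgue_on \<Omega>. f x) = (\<Sum>T\<in>Th. integral T (F T))"
proof -
  have pw: "pairwise (\<lambda>S S'. negligible (S \<inter> S')) Th"
    unfolding pairwise_def using negligible_inter by blast
  have neg: "negligible (\<Union>Th - \<Omega>)" "\<Omega> - \<Union>Th = {}"
    unfolding cover using negligible_subset[OF negligible_skeleton frontier_domain_subset] open_domain closure_subset
    by (auto simp: frontier_def interior_open)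
  have neg': "negligible {x \<in> \<Union>Th - \<Omega>. P x}" "negligible {x \<in> \<Omega> - \<Union>Th. P x}" for P
  proof -
    show "negligible {x \<in> \<Union>Th - \<Omega>. P x}" by (rule negligible_subset[OF neg(1)]) blast
    have "{x \<in> \<Omega> - \<Union>Th. P x} = {}" using neg(2) by blast
    then show "negligible {x \<in> \<Omega> - \<Union>Th. P x}" by (simp only: negligible_empty)
  qed
  have ai: "f absolutely_integrable_on T" and ei: "integral T f = integral T (F T)" if "T \<in> Th" for T
    using integral_simplex[OF that F[OF that] f[OF that]] by auto
  have hi: "(f has_integral (\<Sum>T\<in>Th. integral T f)) (\<Union>Th)"
    using ai absolutely_integrable_on_def
    by (intro has_integral_Union finite_Th pw integrable_integral) blast
  have "((\<lambda>x. norm (f x)) has_integral (\<Sum>T\<in>Th. integral T (\<lambda>x. norm (f x)))) (\<Union>Th)"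
    using ai absolutely_integrable_on_def
    by (intro has_integral_Union finite_Th pw integrable_integral) blast
  then have "f absolutely_integrable_on \<Union>Th"
    using hi unfolding absolutely_integrable_on_def by blast
  then have af: "f absolutely_integrable_on \<Omega>"
    using absolutely_integrable_spike_set_eq[OF neg'] by blast
  show int: "integrable (lebesgue_on \<Omega>) f" by (rule absolutely_integrable_imp_integrable[OF af sets_domain])
  have "(f has_integral (\<Sum>T\<in>Th. integral T f)) \<Omega>"
    using hi has_integral_spike_set_eq[OF neg'] by blast
  then show "(LINT x|lebesgue_on \<Omega>. f x) = (\<Sum>T\<in>Th. integral T (F T))"
    using lebesgue_integral_eq_integral[OF int sets_domain] ei by (simp add: integral_unique)
qed

lemma AE_domain:
  assumes "\<And>T x. T \<in> Th \<Longrightarrow> x \<in> interior T \<Longrightarrow> P x"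
  shows "AE x in lebesgue_on \<Omega>. P x"
proof -
  have "(\<Union>T\<in>Th. frontier T) \<in> null_sets lebesgue"
    using negligible_skeleton by (simp add: negligible_iff_null_sets)
  moreover have "P x" if x: "x \<in> \<Omega>" "x \<notin> (\<Union>T\<in>Th. frontier T)" for x
  proof -
    obtain T where T: "T \<in> Th" "x \<in> T" using subsetD[OF closure_subset x(1)] unfolding cover[symmetric] by blast
    then have "x \<in> interior T"
      using x(2) T(1) subsetD[OF closure_subset T(2)] unfolding frontier_def by blast
    then show ?thesis by (rule assms[OF T(1)])
  qed
  ultimately have "AE x in lebesgue. x \<in> \<Omega> \<longrightarrow> P x"
    by (intro AE_I'[of "\<Union>T\<in>Th. frontier T"]) auto
  then show ?thesis using sets_domain by (simp add: AE_restrict_space_iff)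
qed

lemma simplex_facet: "T \<in> Th \<Longrightarrow> e facet_of T \<Longrightarrow> simplex_facet T e"
  by (simp add: simplex_facet_def simplex_facet_axioms_def full)

lemma facesE: assumes "e \<in> faces Th" obtains T where "T \<in> Th" "e facet_of T"
  using assms by (auto simp: faces_def)

lemma area_pos: "e \<in> faces Th \<Longrightarrow> area e > 0"
proof (erule facesE)
  fix T assume T: "T \<in> Th" "e facet_of T"
  interpret simplex_facet T e by (rule simplex_facet[OF T])
  have "h * area e > 0" using cone_volume vol_pos by (metis mult_pos_pos of_nat_0_less_iff zero_less_card_finite)
  then show "area e > 0" using h_pos by (simp add: zero_less_mult_iff)
qed

lemma vol_pos: "T \<in> Th \<Longrightarrow> vol T > 0"
  using full_simplex.vol_pos[OF full] .

section \<open>Explicit values of the discrete operators\<close>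

text \<open>The constant of \<open>v_b\<close> on a face, read off at one chosen point. Being an
  evaluation it is linear in every pair \<open>v\<close>, not only in members of
  \<open>Vh\<close>.\<close>

definition face_value :: "'d weak_fun \<Rightarrow> (real^'d::_) set \<Rightarrow> real" where
  "face_value v e = snd v e (SOME y. y \<in> e)"

definition face_sign :: "(real^'d::_) set \<Rightarrow> (real^'d::_) set \<Rightarrow> real" where
  "face_sign T e = ne e \<bullet> outward_normal T e"

definition face_moment :: "'d weak_fun \<Rightarrow> (real^'d::_) set \<Rightarrow> real^'d::_" where
  "face_moment v e = (LINT x|face_measure e. fst v x)"

definition normal_mean :: "'d weak_fun \<Rightarrow> (real^'d::_) set \<Rightarrow> real" where
  "normal_mean v e = (face_moment v e \<bullet> ne e) / area e"

definition div_value :: "'d weak_fun \<Rightarrow> (real^'d::_) set \<Rightarrow> real" where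
  "div_value v T = (\<Sum>e | e facet_of T. area e * face_value v e * face_sign T e) / vol T"

text \<open>Since \<^term>\<open>x - apex T e\<close> has vanishing normal component on the facets other than \<^term>\<open>e\<close>,
  the coefficients of the Raviart--Thomas function are read off facet by facet.\<close>

definition rt_value :: "'d weak_fun \<Rightarrow> (real^'d::_) set \<Rightarrow> real^'d::_ \<Rightarrow> real^'d::_" where
  "rt_value v T x = (\<Sum>e | e facet_of T. (face_value v e * face_sign T e / facet_height T e) *\<^sub>R (x - apex T e))"

lemma face_sign_square: "T \<in> Th \<Longrightarrow> e facet_of T \<Longrightarrow> face_sign T e * face_sign T e = 1"
  using face_normal(2)[of T e] by (auto simp: face_sign_def)

lemma normal_eq_sign: "T \<in> Th \<Longrightarrow> e facet_of T \<Longrightarrow> ne e = face_sign T e *\<^sub>R outward_normal T e"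
  using face_normal(1)[of T e] by (simp add: face_sign_def)

lemma DG_const:
  assumes m: "m \<in> DG Th" and e: "e \<in> faces Th" and x: "x \<in> e"
  shows "m e x = m e (SOME y. y \<in> e)"
proof -
  obtain c where "\<forall>x\<in>e. m e x = c" using m e unfolding DG_def by blast
  then show ?thesis using x someI[of "\<lambda>y. y \<in> e" x] by auto
qed

lemma face_value_eq: "v \<in> Vh \<Omega> Th \<Longrightarrow> e \<in> faces Th \<Longrightarrow> x \<in> e \<Longrightarrow> snd v e x = face_value v e"
  unfolding face_value_def by (rule DG_const) (auto simp: Vh_def)

lemma facet_in_faces: "T \<in> Th \<Longrightarrow> e facet_of T \<Longrightarrow> e \<in> faces Th"
  by (auto simp: faces_def)

lemma integrable_face:
  fixes f :: "real^'d::_ \<Rightarrow> 'b::euclidean_space"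
  assumes "e \<in> faces Th" "continuous_on e f"
  shows "integrable (face_measure e) f"
proof -
  obtain T where T: "T \<in> Th" "e facet_of T" using assms(1) by (rule facesE)
  interpret simplex_facet T e by (rule simplex_facet[OF T])
  show ?thesis by (rule face_integral(1)[OF assms(2)])
qed

lemma DG_I:
  assumes "\<And>e. e \<in> faces Th \<Longrightarrow> \<exists>c. \<forall>x\<in>e. m e x = c"
  shows "m \<in> DG Th"
proof -
  have "L2 (face_measure e) (m e)" if e: "e \<in> faces Th" for e
  proof -
    obtain c where c: "\<forall>x\<in>e. m e x = c" using assms[OF e] by blast
    have "m e \<in> borel_measurable (face_measure e)"
      using measurable_cong[of "face_measure e" "m e" "\<lambda>_. c" borel] c by (simp add: space_face_measure)
    moreover have "integrable (face_measure e) (\<lambda>x. (norm (m e x))\<^sup>2)"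
      using Bochner_Integration.integrable_cong[of "face_measure e" "face_measure e" "\<lambda>x. (norm (m e x))\<^sup>2" "\<lambda>_. c\<^sup>2"]
        c integrable_face[OF e continuous_on_const, of "c\<^sup>2"] by (simp add: space_face_measure)
    ultimately show ?thesis by (simp add: L2_def)
  qed
  then show ?thesis using assms by (auto simp: DG_def)
qed

text \<open>The choice in \<open>div_m\<close> is meaningful once a witness is exhibited; testing
  with \<open>\<phi> = 1\<close> on \<open>T\<close> then determines every admissible function in
  the interior of \<open>T\<close>.\<close>

lemma div_m_eq:
  assumes v: "v \<in> Vh \<Omega> Th"
  shows "T \<in> Th \<Longrightarrow> x \<in> interior T \<Longrightarrow> div_m Th ne v x = div_value v T"
proof -
  let ?P = "\<lambda>g. g \<in> piecewise_const Th \<and> (\<forall>T\<in>Th. \<forall>\<phi>::real.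
        inner_L2 (lebesgue_on T) g (\<lambda>_. \<phi>) =
          inner_bdry T (\<lambda>e x. snd v e x * (ne e \<bullet> outward_normal T e)) (\<lambda>e x. \<phi>))"
  have rhs: "inner_bdry T (\<lambda>e x. snd v e x * (ne e \<bullet> outward_normal T e)) (\<lambda>e x. \<phi>)
      = vol T * div_value v T * \<phi>" if T: "T \<in> Th" for T and \<phi> :: real
  proof -
    have "inner_bdry T (\<lambda>e x. snd v e x * (ne e \<bullet> outward_normal T e)) (\<lambda>e x. \<phi>)
      = (\<Sum>e | e facet_of T. area e * face_value v e * face_sign T e * \<phi>)"
      unfolding inner_bdry_def inner_L2_def
    proof (rule sum.cong[OF refl])
      fix e assume "e \<in> {e. e facet_of T}"
      then have e: "e \<in> faces Th" using facet_in_faces[OF T] by simp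
      show "(LINT x|face_measure e. (snd v e x * (ne e \<bullet> outward_normal T e)) \<bullet> \<phi>)
          = area e * face_value v e * face_sign T e * \<phi>"
        using face_integral_const[of e "\<lambda>x. (snd v e x * (ne e \<bullet> outward_normal T e)) \<bullet> \<phi>"
            "face_value v e * face_sign T e * \<phi>"] face_value_eq[OF v e]
        by (simp add: face_sign_def mult.assoc)
    qed
    then show ?thesis using vol_pos[OF T] by (simp add: div_value_def sum_distrib_right)
  qed
  have lhs: "inner_L2 (lebesgue_on T) g (\<lambda>_. \<phi>) = vol T * c * \<phi>"
    if "T \<in> Th" "\<And>x. x \<in> interior T \<Longrightarrow> g x = c" for T g c and \<phi> :: real
  proof -
    have "(LINT x|lebesgue_on T. g x \<bullet> \<phi>) = integral T (\<lambda>_. c * \<phi>)"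
      by (rule integral_simplex(3)[OF that(1)]) (auto simp: that(2))
    then show ?thesis unfolding inner_L2_def
      using integral_const_compact[OF full_simplex.compact_T[OF full[OF that(1)]], of "c * \<phi>"]
      by (auto simp: mult.assoc)
  qed
  let ?g = "piecewise (\<lambda>T _. div_value v T)"
  have "?P ?g"
  proof (intro conjI ballI allI piecewise_const_piecewise)
    fix T \<phi> assume T: "T \<in> Th"
    show "inner_L2 (lebesgue_on T) ?g (\<lambda>_. \<phi>) =
        inner_bdry T (\<lambda>e x. snd v e x * (ne e \<bullet> outward_normal T e)) (\<lambda>e x. \<phi>)"
      unfolding rhs[OF T] by (rule lhs[OF T piecewise_eq[OF T]])
  qed
  then have "?P (div_m Th ne v)" unfolding div_m_def by (rule someI[where P="?P"])
  then have pc: "div_m Th ne v \<in> piecewise_const Th"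
    and I: "\<And>T \<phi>. T \<in> Th \<Longrightarrow> inner_L2 (lebesgue_on T) (div_m Th ne v) (\<lambda>_. \<phi>) = vol T * div_value v T * \<phi>"
    using rhs by auto
  show "T \<in> Th \<Longrightarrow> x \<in> interior T \<Longrightarrow> div_m Th ne v x = div_value v T"
  proof -
    assume T: "T \<in> Th" "x \<in> interior T"
    obtain c where c: "\<And>x. x \<in> interior T \<Longrightarrow> div_m Th ne v x = c"
      using pc T(1) by (auto simp: piecewise_const_def)
    have "vol T * c * 1 = vol T * div_value v T * 1"
      using lhs[OF T(1), of "div_m Th ne v" c 1, OF c] I[OF T(1), of 1] by auto
    then show ?thesis using vol_pos[OF T(1)] c[OF T(2)] by simp
  qed
qed

lemma CG_continuous_simplex:
  assumes "u \<in> CG \<Omega> Th" "T \<in> Th"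
  shows "continuous_on T u"
proof -
  obtain A c where "\<forall>x\<in>T. u x = A *v x + c" using assms unfolding CG_def by blast
  moreover have "continuous_on T (\<lambda>x. A *v x + c)"
    by (intro continuous_intros matrix_vector_mult_linear_continuous_on)
  ultimately show ?thesis by (simp cong: continuous_on_cong)
qed

lemma fst_continuous_face:
  assumes v: "v \<in> Vh \<Omega> Th" and e: "e \<in> faces Th"
  shows "continuous_on e (fst v)"
proof -
  obtain T where T: "T \<in> Th" "e facet_of T" using e by (rule facesE)
  have "continuous_on T (fst v)" using v T CG_continuous_simplex by (auto simp: Vh_def)
  then show ?thesis using full_simplex.facet_subset[OF full[OF T(1)] T(2)] continuous_on_subset by blast
qed

text \<open>Faces decouple because members of \<open>DG\<close> take independent constants on them,
  so the projection is the mean of the normal component, face by face.\<close>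

lemma Qb_eq:
  assumes v: "v \<in> Vh \<Omega> Th" and e: "e \<in> faces Th" and x: "x \<in> e"
  shows "Qb Th (normal_comp ne v) e x = normal_mean v e"
proof -
  let ?P = "\<lambda>m. m \<in> DG Th \<and>
     (\<forall>\<mu>\<in>DG Th. (\<Sum>e\<in>faces Th. inner_L2 (face_measure e) (\<lambda>x. normal_comp ne v e x - m e x) (\<mu> e)) = 0)"
  have I: "inner_L2 (face_measure e) (\<lambda>x. normal_comp ne v e x - m e x) (\<mu> e) =
      area e * (normal_mean v e - c) * k"
    if e: "e \<in> faces Th" and m: "\<And>x. x \<in> e \<Longrightarrow> m e x = c" and k: "\<And>x. x \<in> e \<Longrightarrow> \<mu> e x = k"
    for e m \<mu> c k
  proof -
    have i: "integrable (face_measure e) (fst v)" "integrable (face_measure e) (\<lambda>x. fst v x \<bullet> ne e)"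
        "integrable (face_measure e) (\<lambda>x. c)"
      by (auto intro!: integrable_face[OF e] continuous_intros fst_continuous_face[OF v e])
    have "inner_L2 (face_measure e) (\<lambda>x. normal_comp ne v e x - m e x) (\<mu> e) =
        (LINT x|face_measure e. (fst v x \<bullet> ne e - c) * k)"
      unfolding inner_L2_def
      by (rule Bochner_Integration.integral_cong) (simp_all add: space_face_measure m k normal_comp_def)
    also have "\<dots> = ((LINT x|face_measure e. fst v x \<bullet> ne e) - area e * c) * k"
      using i by (simp add: space_face_measure)
    also have "(LINT x|face_measure e. fst v x \<bullet> ne e) = face_moment v e \<bullet> ne e"
      using i(1) by (simp add: face_moment_def)
    also have "face_moment v e \<bullet> ne e = area e * normal_mean v e"
      using area_pos[OF e] by (simp add: normal_mean_def)
    finally show ?thesis by (simp add: right_diff_distrib)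
  qed
  have "?P (\<lambda>e _. normal_mean v e)"
  proof (intro conjI ballI sum.neutral)
    show "(\<lambda>e _. normal_mean v e) \<in> DG Th" by (rule DG_I) blast
    fix \<mu> e assume "\<mu> \<in> DG Th" and e: "e \<in> faces Th"
    then show "inner_L2 (face_measure e) (\<lambda>x. normal_comp ne v e x - normal_mean v e) (\<mu> e) = 0"
      using I[OF e, of "\<lambda>e _. normal_mean v e" "normal_mean v e" \<mu>] DG_const[of \<mu> e] by simp
  qed
  then have P: "?P (Qb Th (normal_comp ne v))" unfolding Qb_def by (rule someI[where P="?P"])
  let ?m = "Qb Th (normal_comp ne v)"
  \<comment> \<open>The test function that isolates the face \<open>e\<close>.\<close>
  let ?\<mu> = "\<lambda>e' _. if e' = e then 1 else 0 :: real"
  define c where "c e = ?m e (SOME y. y \<in> e)" for e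
  have m: "?m e x = c e" if "e \<in> faces Th" "x \<in> e" for e x
    unfolding c_def using P that by (intro DG_const) auto
  have "?\<mu> \<in> DG Th" by (rule DG_I) blast
  then have "0 = (\<Sum>e'\<in>faces Th. inner_L2 (face_measure e') (\<lambda>x. normal_comp ne v e' x - ?m e' x) (?\<mu> e'))"
    using P by simp
  also have "\<dots> = (\<Sum>e'\<in>faces Th. if e' = e then area e * (normal_mean v e - c e) else 0)"
  proof (rule sum.cong[OF refl])
    fix e' assume e': "e' \<in> faces Th"
    show "inner_L2 (face_measure e') (\<lambda>x. normal_comp ne v e' x - ?m e' x) (?\<mu> e')
      = (if e' = e then area e * (normal_mean v e - c e) else 0)"
      using I[OF e', of ?m "c e'" ?\<mu> "if e' = e then 1 else 0", OF m[OF e']] by simp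
  qed
  also have "\<dots> = area e * (normal_mean v e - c e)" using finite_faces e by (simp add: sum.delta)
  finally show ?thesis using area_pos[OF e] m[OF e x] by simp
qed

lemma rt_value_affine:
  "rt_value v T x = - (\<Sum>e | e facet_of T. (face_value v e * face_sign T e / facet_height T e) *\<^sub>R apex T e)
     + (\<Sum>e | e facet_of T. face_value v e * face_sign T e / facet_height T e) *\<^sub>R x"
  by (simp add: rt_value_def scaleR_diff_right sum_subtractf scaleR_sum_left)

lemma rt_value_flux:
  assumes T: "T \<in> Th" and e: "e facet_of T" and x: "x \<in> e"
  shows "outward_normal T e \<bullet> rt_value v T x = face_value v e * face_sign T e"
proof -
  interpret full_simplex T by (rule full[OF T])
  have "outward_normal T e \<bullet> rt_value v T x = (\<Sum>e' | e' facet_of T.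
      if e' = e then face_value v e * face_sign T e else 0)"
    unfolding rt_value_def inner_sum_right
    using facet_height_pos[OF e] by (intro sum.cong) (auto simp: normal_radial[OF e _ x])
  also have "\<dots> = face_value v e * face_sign T e"
    using finite_facets e by (simp add: sum.delta)
  finally show ?thesis .
qed

text \<open>The mean flux through a facet fixes the coefficient of the radial field of that facet,
  and these fields generate all \<open>a + b x\<close>.\<close>

lemma rt_value_unique:
  assumes v: "v \<in> Vh \<Omega> Th" and T: "T \<in> Th"
    and flux: "\<And>e. e facet_of T \<Longrightarrow>
      (LINT x|face_measure e. (a + b *\<^sub>R x) \<bullet> ne e) = (LINT x|face_measure e. snd v e x)"
  shows "a + b *\<^sub>R x = rt_value v T x"
proof -
  interpret full_simplex T by (rule full[OF T])
  let ?c = "\<lambda>e. b * bary_coord T e 0 + outward_normal T e \<bullet> a / facet_height T e"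
  have "?c e = face_value v e * face_sign T e / facet_height T e" if e: "e facet_of T" for e
  proof -
    have ef: "e \<in> faces Th" using facet_in_faces[OF T e] .
    have "(a + b *\<^sub>R x) \<bullet> ne e = face_sign T e * (?c e * facet_height T e)" if "x \<in> e" for x
      by (subst normal_eq_sign[OF T e]) (use normal_component[OF e that, of a b] in \<open>simp add: inner_commute\<close>)
    then have "area e * (face_sign T e * (?c e * facet_height T e)) = area e * face_value v e"
      using flux[OF e] face_integral_const[of e "\<lambda>x. (a + b *\<^sub>R x) \<bullet> ne e" "face_sign T e * (?c e * facet_height T e)"]
        face_integral_const[of e "snd v e" "face_value v e"] face_value_eq[OF v ef] by simp
    then have "face_sign T e * (?c e * facet_height T e) = face_value v e"
      using area_pos[OF ef] by simp
    then have "face_sign T e * face_sign T e * (?c e * facet_height T e) = face_sign T e * face_value v e"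
      by (metis mult.assoc)
    then have "?c e * facet_height T e = face_value v e * face_sign T e"
      unfolding face_sign_square[OF T e] by (simp only: mult_1 mult.commute)
    then show ?thesis
      using facet_height_pos[OF e] by (subst nonzero_eq_divide_eq) auto
  qed
  then show ?thesis unfolding radial_expansion[of a b x] rt_value_def by (intro sum.cong) auto
qed

lemma test_function_derivative:
  fixes \<phi> :: "real^'d::_ \<Rightarrow> real"
  assumes "\<phi> \<in> test_functions \<Omega>"
  shows "(\<phi> has_derivative (\<lambda>y. (\<chi> j. pdiff j \<phi> x) \<bullet> y)) (at x)"
    and "continuous_on UNIV (\<lambda>x. \<chi> j. pdiff j \<phi> x)"
    and "\<And>x. x \<in> frontier \<Omega> \<Longrightarrow> \<phi> x = 0"
proof -
  have sm: "smooth \<phi>" and supp: "closure {x. \<phi> x \<noteq> 0} \<subseteq> \<Omega>" using assms by (auto simp: test_functions_def)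
  have d: "foldr pdiff js \<phi> differentiable_on UNIV" for js using sm by (auto simp: smooth_def)
  have "\<phi> differentiable (at x)" using d[of "[]"] by (simp add: differentiable_on_def)
  then have fd: "(\<phi> has_derivative frechet_derivative \<phi> (at x)) (at x)"
    by (simp add: frechet_derivative_works)
  have lin: "linear (frechet_derivative \<phi> (at x))" using fd has_derivative_linear by blast
  have "frechet_derivative \<phi> (at x) y = (\<chi> j. pdiff j \<phi> x) \<bullet> y" for y
  proof -
    have "y = (\<Sum>j\<in>UNIV. (y $ j) *\<^sub>R axis j 1)" by (simp add: basis_expansion flip: scalar_mult_eq_scaleR)
    then have "frechet_derivative \<phi> (at x) y = (\<Sum>j\<in>UNIV. (y $ j) *\<^sub>R frechet_derivative \<phi> (at x) (axis j 1))"
      using linear_sum[OF lin, of "\<lambda>j. (y $ j) *\<^sub>R axis j 1" UNIV] linear_scale[OF lin] by simp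
    then show ?thesis by (simp add: inner_vec_def pdiff_def mult.commute)
  qed
  then have "frechet_derivative \<phi> (at x) = (\<lambda>y. (\<chi> j. pdiff j \<phi> x) \<bullet> y)" by blast
  then show "(\<phi> has_derivative (\<lambda>y. (\<chi> j. pdiff j \<phi> x) \<bullet> y)) (at x)" using fd by simp
  have "continuous_on UNIV (pdiff j \<phi>)" for j
    using d[of "[j]"] by (simp add: differentiable_imp_continuous_on)
  then show "continuous_on UNIV (\<lambda>x. \<chi> j. pdiff j \<phi> x)" by (intro continuous_on_vec_lambda)
  fix x assume "x \<in> frontier \<Omega>"
  then have "x \<notin> \<Omega>" using open_domain by (auto simp: frontier_def interior_open)
  then show "\<phi> x = 0" using supp subsetD[OF closure_subset, of x "{x. \<phi> x \<noteq> 0}"] by blast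
qed

lemma continuous_rt_value: "continuous_on A (rt_value v T)"
  unfolding rt_value_def by (intro continuous_intros)

text \<open>Interior facets cancel because their outward normals are opposite; on boundary facets one of
  the two factors vanishes.\<close>

lemma balanced_sum:
  assumes v: "v \<in> Vh0 \<Omega> Th \<or> (\<forall>e\<in>faces Th. e \<subseteq> frontier \<Omega> \<longrightarrow> I e = 0)"
  shows "(\<Sum>T\<in>Th. \<Sum>e | e facet_of T. I e * (face_value v e * face_sign T e)) = 0"
proof -
  have fin: "finite {e. e facet_of T}" if "T \<in> Th" for T using full_simplex.finite_facets[OF full[OF that]] .
  have "(\<Sum>T\<in>Th. \<Sum>e | e facet_of T. I e * (face_value v e * face_sign T e))
    = (\<Sum>T\<in>Th. \<Sum>e\<in>faces Th. if e facet_of T then I e * (face_value v e * face_sign T e) else 0)"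
    by (intro sum.cong refl sum.mono_neutral_cong_left finite_faces) (auto simp: facet_in_faces)
  also have "\<dots> = (\<Sum>e\<in>faces Th. \<Sum>T\<in>Th. if e facet_of T then I e * (face_value v e * face_sign T e) else 0)"
    by (rule sum.swap)
  also have "\<dots> = (\<Sum>e\<in>faces Th. 0)"
  proof (rule sum.cong[OF refl])
    fix e assume e: "e \<in> faces Th"
    have "(\<Sum>T\<in>Th. if e facet_of T then I e * (face_value v e * face_sign T e) else 0)
        = (\<Sum>T | T \<in> Th \<and> e facet_of T. I e * (face_value v e * face_sign T e))"
      using finite_Th by (simp add: sum.inter_filter)
    also have "\<dots> = I e * face_value v e * (ne e \<bullet> (\<Sum>T | T \<in> Th \<and> e facet_of T. outward_normal T e))"
      by (simp add: face_sign_def inner_sum_right sum_distrib_left mult.assoc)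
    also have "\<dots> = 0"
    proof (cases "e \<subseteq> frontier \<Omega>")
      case False
      then show ?thesis using boundary_or_balanced[OF e] by simp
    next
      case True
      show ?thesis
      proof (cases "v \<in> Vh0 \<Omega> Th")
        case V: True
        obtain T where T: "T \<in> Th" "e facet_of T" using e by (rule facesE)
        then have "e \<noteq> {}" using full_simplex.facet_nonempty[OF full[OF T(1)]] by blast
        then have "(SOME y. y \<in> e) \<in> e" by (simp add: some_in_eq)
        then have "face_value v e = 0" using V True e unfolding Vh0_def face_value_def by blast
        then show ?thesis by simp
      qed (use v e True in auto)
    qed
    finally show "(\<Sum>T\<in>Th. if e facet_of T then I e * (face_value v e * face_sign T e) else 0) = 0" .
  qed
  finally show ?thesis by simp
qed

text \<open>The witness needs a weak divergence in \<open>L2\<close>: Gauss' theorem on each simplex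
  leaves facet terms, and these cancel by \<open>balanced_sum\<close>. Uniqueness is
  \<open>rt_value_unique\<close>.\<close>

lemma RT_interp_eq:
  assumes v: "v \<in> Vh \<Omega> Th"
  shows "T \<in> Th \<Longrightarrow> x \<in> interior T \<Longrightarrow> RT_interp \<Omega> Th ne v x = rt_value v T x"
proof -
  let ?P = "\<lambda>r. r \<in> Hdiv \<Omega> \<and>
     (\<forall>T\<in>Th. \<exists>a b. (\<forall>x\<in>interior T. r x = a + b *\<^sub>R x) \<and>
        (\<forall>e. e facet_of T \<longrightarrow>
           (LINT x|face_measure e. (a + b *\<^sub>R x) \<bullet> ne e) = (LINT x|face_measure e. snd v e x)))"
  let ?a = "\<lambda>T. - (\<Sum>e | e facet_of T. (face_value v e * face_sign T e / facet_height T e) *\<^sub>R apex T e)"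
  let ?b = "\<lambda>T. \<Sum>e | e facet_of T. face_value v e * face_sign T e / facet_height T e"
  \<comment> \<open>\<open>?g\<close> is the divergence of \<open>?a T + ?b T x\<close> on each
    simplex, the candidate for the weak divergence of \<open>?r\<close>.\<close>
  let ?r = "piecewise (rt_value v)" and ?g = "piecewise (\<lambda>T _. real CARD('d) * ?b T)"
  have cr: "continuous_on T (rt_value v T)" for T by (rule continuous_rt_value)
  have cn: "continuous_on T (\<lambda>x. (norm (rt_value v T x))\<^sup>2)" for T
    by (intro continuous_intros cr)
  have L2r: "L2 (lebesgue_on \<Omega>) ?r"
    unfolding L2_def
    using integral_domain(1)[OF cr, of ?r] integral_domain(1)[of "\<lambda>T x. (norm (rt_value v T x))\<^sup>2" "\<lambda>x. (norm (?r x))\<^sup>2"] cn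
    by (auto simp: piecewise_eq intro!: continuous_intros borel_measurable_integrable)
  have L2g: "L2 (lebesgue_on \<Omega>) ?g"
    unfolding L2_def
    using integral_domain(1)[of "\<lambda>T _. real CARD('d) * ?b T" ?g]
      integral_domain(1)[of "\<lambda>T x. (norm (real CARD('d) * ?b T))\<^sup>2" "\<lambda>x. (norm (?g x))\<^sup>2"]
    by (auto simp: piecewise_eq intro!: continuous_intros borel_measurable_integrable)
  have hd: "inner_L2 (lebesgue_on \<Omega>) ?r (\<lambda>x. \<chi> j. pdiff j \<phi> x) = - inner_L2 (lebesgue_on \<Omega>) ?g \<phi>"
    if \<phi>: "\<phi> \<in> test_functions \<Omega>" for \<phi>
  proof -
    note d = test_function_derivative[OF \<phi>]
    have c\<phi>: "continuous_on A \<phi>" for A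
      using d(1) has_derivative_continuous continuous_at_imp_continuous_on by blast
    have cg: "continuous_on A (\<lambda>x. \<chi> j. pdiff j \<phi> x)" for A using d(2) continuous_on_subset by blast
    let ?F = "\<lambda>T x. rt_value v T x \<bullet> (\<chi> j. pdiff j \<phi> x)" and ?G = "\<lambda>T x. (real CARD('d) * ?b T) * \<phi> x"
    have c: "continuous_on T (?F T)" "continuous_on T (?G T)" for T
      by (intro continuous_intros cr cg c\<phi>)+
    have 1: "inner_L2 (lebesgue_on \<Omega>) ?r (\<lambda>x. \<chi> j. pdiff j \<phi> x) = (\<Sum>T\<in>Th. integral T (?F T))"
      unfolding inner_L2_def by (rule integral_domain(2)[OF c(1)]) (simp add: piecewise_eq)
    have 2: "inner_L2 (lebesgue_on \<Omega>) ?g \<phi> = (\<Sum>T\<in>Th. integral T (?G T))"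
      unfolding inner_L2_def by (rule integral_domain(2)[OF c(2)]) (simp add: piecewise_eq)
    have "integral T (?F T) + integral T (?G T)
        = (\<Sum>e | e facet_of T. (LINT x|face_measure e. \<phi> x) * (face_value v e * face_sign T e))" if T: "T \<in> Th" for T
    proof -
      interpret full_simplex T by (rule full[OF T])
      have "integral T (?F T) + integral T (?G T) = integral T (\<lambda>x. ?F T x + ?G T x)"
        by (intro integral_add[symmetric] integrable_on_continuous_compact compact_T c)
      also have "\<dots> = integral T (\<lambda>x. (\<chi> j. pdiff j \<phi> x) \<bullet> (?a T + ?b T *\<^sub>R x) + real CARD('d) * ?b T * \<phi> x)"
        unfolding rt_value_affine by (simp only: inner_commute)
      also have "\<dots> = (\<Sum>e | e facet_of T. LINT x|face_measure e. \<phi> x * (outward_normal T e \<bullet> (?a T + ?b T *\<^sub>R x)))"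
        by (rule simplex_gauss[OF simplices[OF T] d(1,2)])
      also have "\<dots> = (\<Sum>e | e facet_of T. (LINT x|face_measure e. \<phi> x) * (face_value v e * face_sign T e))"
      proof (rule sum.cong[OF refl])
        fix e assume "e \<in> {e. e facet_of T}"
        then have e: "e facet_of T" by simp
        have "(LINT x|face_measure e. \<phi> x * (outward_normal T e \<bullet> (?a T + ?b T *\<^sub>R x))) =
            (LINT x|face_measure e. \<phi> x * (face_value v e * face_sign T e))"
          by (rule Bochner_Integration.integral_cong)
             (simp_all only: space_face_measure rt_value_affine[symmetric] rt_value_flux[OF T e])
        also have "\<dots> = (LINT x|face_measure e. \<phi> x) * (face_value v e * face_sign T e)"
          by (rule integral_mult_left_zero)
        finally show "(LINT x|face_measure e. \<phi> x * (outward_normal T e \<bullet> (?a T + ?b T *\<^sub>R x))) =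
            (LINT x|face_measure e. \<phi> x) * (face_value v e * face_sign T e)" .
      qed
      finally show ?thesis .
    qed
    then have "(\<Sum>T\<in>Th. integral T (?F T)) + (\<Sum>T\<in>Th. integral T (?G T)) =
      (\<Sum>T\<in>Th. \<Sum>e | e facet_of T. (LINT x|face_measure e. \<phi> x) * (face_value v e * face_sign T e))"
      by (simp add: sum.distrib[symmetric])
    also have "\<dots> = 0"
    proof (rule balanced_sum, rule disjI2, intro ballI impI)
      fix e assume "e \<in> faces Th" "e \<subseteq> frontier \<Omega>"
      then show "(LINT x|face_measure e. \<phi> x) = 0"
        using face_integral_const[of e \<phi> 0] d(3) by auto
    qed
    finally show ?thesis unfolding 1 2 by linarith
  qed
  have "?P ?r"
  proof (intro conjI ballI)
    show "?r \<in> Hdiv \<Omega>" unfolding Hdiv_def using L2r L2g hd by blast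
    fix T assume T: "T \<in> Th"
    show "\<exists>a b. (\<forall>x\<in>interior T. ?r x = a + b *\<^sub>R x) \<and> (\<forall>e. e facet_of T \<longrightarrow>
           (LINT x|face_measure e. (a + b *\<^sub>R x) \<bullet> ne e) = (LINT x|face_measure e. snd v e x))"
    proof (intro exI conjI allI impI ballI)
      show "?r x = ?a T + ?b T *\<^sub>R x" if "x \<in> interior T" for x
        unfolding piecewise_eq[OF T that] by (rule rt_value_affine)
      fix e assume e: "e facet_of T"
      have ef: "e \<in> faces Th" using facet_in_faces[OF T e] .
      have "(?a T + ?b T *\<^sub>R x) \<bullet> ne e = face_value v e" if "x \<in> e" for x
        unfolding rt_value_affine[symmetric]
        by (subst normal_eq_sign[OF T e])
           (use rt_value_flux[OF T e that, of v] face_sign_square[OF T e] in \<open>simp add: inner_commute\<close>)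
      then show "(LINT x|face_measure e. (?a T + ?b T *\<^sub>R x) \<bullet> ne e) = (LINT x|face_measure e. snd v e x)"
        using face_value_eq[OF v ef]
        by (intro Bochner_Integration.integral_cong) (simp_all add: space_face_measure)
    qed
  qed
  then have P: "?P (RT_interp \<Omega> Th ne v)" unfolding RT_interp_def by (rule someI[where P="?P"])
  show "T \<in> Th \<Longrightarrow> x \<in> interior T \<Longrightarrow> RT_interp \<Omega> Th ne v x = rt_value v T x"
  proof -
    assume T: "T \<in> Th" and x: "x \<in> interior T"
    obtain a b where ab: "\<forall>x\<in>interior T. RT_interp \<Omega> Th ne v x = a + b *\<^sub>R x"
      "\<forall>e. e facet_of T \<longrightarrow>
           (LINT x|face_measure e. (a + b *\<^sub>R x) \<bullet> ne e) = (LINT x|face_measure e. snd v e x)"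
      using P T by blast
    then show ?thesis using rt_value_unique[OF v T, of a b x] x by simp
  qed
qed

end

section \<open>Square-integrable functions and the vector space \<open>Vh\<close>\<close>

lemma L2_inner_integrable:
  fixes f g :: "'a \<Rightarrow> 'b::euclidean_space"
  assumes f: "L2 M f" and g: "L2 M g"
  shows "integrable M (\<lambda>x. f x \<bullet> g x)"
proof (rule Bochner_Integration.integrable_bound)
  show "integrable M (\<lambda>x. (norm (f x))\<^sup>2 + (norm (g x))\<^sup>2)"
    using f g by (simp add: L2_def)
  show "(\<lambda>x. f x \<bullet> g x) \<in> borel_measurable M"
    using f g by (auto simp: L2_def intro: borel_measurable_inner)
  have "norm (f x \<bullet> g x) \<le> norm ((norm (f x))\<^sup>2 + (norm (g x))\<^sup>2)" for x
  proof -
    have "\<bar>f x \<bullet> g x\<bar> \<le> norm (f x) * norm (g x)" by (rule Cauchy_Schwarz_ineq2)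
    moreover have "2 * (norm (f x) * norm (g x)) \<le> (norm (f x))\<^sup>2 + (norm (g x))\<^sup>2"
      using sum_squares_bound[of "norm (f x)" "norm (g x)"] by (simp add: mult.assoc)
    moreover have "0 \<le> norm (f x) * norm (g x)" by simp
    ultimately show ?thesis by simp
  qed
  then show "AE x in M. norm (f x \<bullet> g x) \<le> norm ((norm (f x))\<^sup>2 + (norm (g x))\<^sup>2)" by simp
qed

lemma L2_add:
  fixes f g :: "'a \<Rightarrow> 'b::euclidean_space"
  assumes f: "L2 M f" and g: "L2 M g"
  shows "L2 M (\<lambda>x. f x + g x)"
proof -
  have "integrable M (\<lambda>x. (norm (f x))\<^sup>2 + (norm (g x))\<^sup>2 + 2 * (f x \<bullet> g x))"
    using f g L2_inner_integrable[OF f g] by (simp add: L2_def)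
  moreover have "(norm (f x))\<^sup>2 + (norm (g x))\<^sup>2 + 2 * (f x \<bullet> g x) = (norm (f x + g x))\<^sup>2" for x
    by (simp add: power2_norm_eq_inner inner_add_left inner_add_right inner_commute)
  ultimately show ?thesis using f g by (auto simp: L2_def)
qed

lemma L2_scaleR:
  fixes f :: "'a \<Rightarrow> 'b::euclidean_space"
  assumes "L2 M f"
  shows "L2 M (\<lambda>x. c *\<^sub>R f x)"
  using assms by (auto simp: L2_def power_mult_distrib)

lemma inner_L2_add_left:
  fixes f g k :: "'a \<Rightarrow> 'b::euclidean_space"
  assumes "L2 M f" "L2 M g" "L2 M k"
  shows "inner_L2 M (\<lambda>x. f x + g x) k = inner_L2 M f k + inner_L2 M g k"
  using assms by (simp add: inner_L2_def inner_add_left L2_inner_integrable)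

lemma inner_L2_scaleR_left:
  fixes f k :: "'a \<Rightarrow> 'b::euclidean_space"
  shows "inner_L2 M (\<lambda>x. c *\<^sub>R f x) k = c * inner_L2 M f k"
  by (simp add: inner_L2_def)

context fem_mesh
begin

lemma L2_piecewise:
  fixes f :: "real^'d::_ \<Rightarrow> 'b::euclidean_space"
  assumes F: "\<And>T. T \<in> Th \<Longrightarrow> continuous_on T (F T)"
    and f: "\<And>T x. T \<in> Th \<Longrightarrow> x \<in> interior T \<Longrightarrow> f x = F T x"
  shows "L2 (lebesgue_on \<Omega>) f"
proof -
  have "integrable (lebesgue_on \<Omega>) f" by (rule integral_domain(1)[OF F f])
  moreover have "integrable (lebesgue_on \<Omega>) (\<lambda>x. (norm (f x))\<^sup>2)"
    by (rule integral_domain(1)[where F="\<lambda>T x. (norm (F T x))\<^sup>2"]) (auto intro!: continuous_intros F simp: f)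
  ultimately show ?thesis by (simp add: L2_def borel_measurable_integrable)
qed

text \<open>Integrability against test functions is what allows the weak derivative of a sum to be
  split.\<close>

lemma test_function_L2:
  assumes \<phi>: "\<phi> \<in> test_functions \<Omega>"
  shows "L2 (lebesgue_on \<Omega>) \<phi>" "L2 (lebesgue_on \<Omega>) (pdiff j \<phi>)"
proof -
  note d = test_function_derivative[OF \<phi>]
  have "continuous_on A \<phi>" for A
    using d(1) has_derivative_continuous continuous_at_imp_continuous_on by blast
  then show "L2 (lebesgue_on \<Omega>) \<phi>" by (intro L2_piecewise[where F="\<lambda>T. \<phi>"]) auto
  have "continuous_on A (\<lambda>x. (\<chi> j. pdiff j \<phi> x) $ j)" for A
    by (intro continuous_intros continuous_on_subset[OF d(2)]) auto
  then show "L2 (lebesgue_on \<Omega>) (pdiff j \<phi>)" by (intro L2_piecewise[where F="\<lambda>T. pdiff j \<phi>"]) auto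
qed

lemma H1_add:
  assumes u: "u \<in> H1 \<Omega>" and v: "v \<in> H1 \<Omega>"
  shows "(\<lambda>x. u x + v x) \<in> H1 \<Omega>"
proof -
  have Lu: "L2 (lebesgue_on \<Omega>) u" and Lv: "L2 (lebesgue_on \<Omega>) v" using u v by (auto simp: H1_def)
  have "\<exists>g. L2 (lebesgue_on \<Omega>) g \<and> (\<forall>\<phi>\<in>test_functions \<Omega>.
      inner_L2 (lebesgue_on \<Omega>) (\<lambda>x. u x + v x) (pdiff j \<phi>) = - inner_L2 (lebesgue_on \<Omega>) g \<phi>)" for j
  proof -
    obtain a where a: "L2 (lebesgue_on \<Omega>) a" "\<forall>\<phi>\<in>test_functions \<Omega>.
        inner_L2 (lebesgue_on \<Omega>) u (pdiff j \<phi>) = - inner_L2 (lebesgue_on \<Omega>) a \<phi>"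
      using u unfolding H1_def by blast
    obtain b where b: "L2 (lebesgue_on \<Omega>) b" "\<forall>\<phi>\<in>test_functions \<Omega>.
        inner_L2 (lebesgue_on \<Omega>) v (pdiff j \<phi>) = - inner_L2 (lebesgue_on \<Omega>) b \<phi>"
      using v unfolding H1_def by blast
    show ?thesis
      using a b L2_add[OF a(1) b(1)]
      by (intro exI[of _ "\<lambda>x. a x + b x"])
         (simp add: inner_L2_add_left[OF Lu Lv test_function_L2(2)] inner_L2_add_left[OF a(1) b(1) test_function_L2(1)])
  qed
  then show ?thesis using L2_add[OF Lu Lv] by (simp add: H1_def)
qed

lemma H1_scale:
  assumes u: "u \<in> H1 \<Omega>"
  shows "(\<lambda>x. c * u x) \<in> H1 \<Omega>"
proof -
  have "\<exists>g. L2 (lebesgue_on \<Omega>) g \<and> (\<forall>\<phi>\<in>test_functions \<Omega>.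
      inner_L2 (lebesgue_on \<Omega>) (\<lambda>x. c *\<^sub>R u x) (pdiff j \<phi>) = - inner_L2 (lebesgue_on \<Omega>) g \<phi>)" for j
  proof -
    obtain a where a: "L2 (lebesgue_on \<Omega>) a" "\<forall>\<phi>\<in>test_functions \<Omega>.
        inner_L2 (lebesgue_on \<Omega>) u (pdiff j \<phi>) = - inner_L2 (lebesgue_on \<Omega>) a \<phi>"
      using u unfolding H1_def by blast
    show ?thesis
      using a(2) L2_scaleR[OF a(1), of c]
      by (intro exI[of _ "\<lambda>x. c *\<^sub>R a x"] conjI ballI) (simp_all only: inner_L2_scaleR_left mult_minus_right)
  qed
  moreover have "L2 (lebesgue_on \<Omega>) (\<lambda>x. c *\<^sub>R u x)"
    using u by (intro L2_scaleR) (auto simp: H1_def)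
  ultimately show ?thesis by (simp add: H1_def)
qed

lemma Vh_components:
  assumes "v \<in> Vh \<Omega> Th"
  shows "\<And>T. T \<in> Th \<Longrightarrow> \<exists>A c. \<forall>x\<in>T. fst v x = A *v x + c" and "\<And>i. (\<lambda>x. fst v x $ i) \<in> H1 \<Omega>"
proof -
  have "fst v \<in> CG \<Omega> Th" using assms by (simp add: Vh_def mem_Times_iff)
  note * = this[unfolded CG_def mem_Collect_eq]
  show "\<And>T. T \<in> Th \<Longrightarrow> \<exists>A c. \<forall>x\<in>T. fst v x = A *v x + c" by (rule bspec[OF conjunct2[OF *]])
  show "\<And>i. (\<lambda>x. fst v x $ i) \<in> H1 \<Omega>" by (rule spec[OF conjunct1[OF *]])
qed

lemma subspace_Vh: "subspace (Vh \<Omega> Th)"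
proof (rule subspaceI)
  have H0: "(\<lambda>x. 0) \<in> H1 \<Omega>"
    using test_function_L2 by (auto simp: H1_def L2_def inner_L2_def intro!: exI[of _ "\<lambda>x. 0"])
  show "0 \<in> Vh \<Omega> Th"
    unfolding Vh_def zero_prod_def
  proof (rule SigmaI)
    have "\<exists>(A::real^'d::_^'d::_) c. \<forall>x\<in>T. (0::real^'d::_ \<Rightarrow> real^'d::_) x = A *v x + c" for T :: "(real^'d::_) set"
      by (intro exI[of _ 0]) simp
    then show "0 \<in> CG \<Omega> Th" using H0 by (simp add: CG_def)
    show "0 \<in> DG Th" by (rule DG_I) auto
  qed
next
  fix u v :: "'d weak_fun" assume u: "u \<in> Vh \<Omega> Th" and v: "v \<in> Vh \<Omega> Th"
  show "u + v \<in> Vh \<Omega> Th"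
    unfolding Vh_def plus_prod_def
  proof (rule SigmaI)
    have "\<exists>(A::real^'d::_^'d::_) c. \<forall>x\<in>T. (fst u + fst v) x = A *v x + c" if T: "T \<in> Th" for T
    proof -
      obtain A :: "real^'d::_^'d::_" and c where 1: "\<forall>x\<in>T. fst u x = A *v x + c"
        using Vh_components(1)[OF u T] by (elim exE) (rule that)
      obtain A' :: "real^'d::_^'d::_" and c' where 2: "\<forall>x\<in>T. fst v x = A' *v x + c'"
        using Vh_components(1)[OF v T] by (elim exE) (rule that)
      show ?thesis
        by (intro exI[of _ "A + A'"] exI[of _ "c + c'"]) (simp add: 1 2 matrix_vector_mult_add_rdistrib)
    qed
    moreover have "(\<lambda>x. (fst u + fst v) x $ i) \<in> H1 \<Omega>" for i
      using H1_add[OF Vh_components(2)[OF u] Vh_components(2)[OF v], of i i] by simp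
    ultimately show "fst u + fst v \<in> CG \<Omega> Th" by (simp add: CG_def)
    show "snd u + snd v \<in> DG Th"
      by (rule DG_I) (use face_value_eq[OF u] face_value_eq[OF v] in auto)
  qed
next
  fix c :: real and v :: "'d weak_fun" assume v: "v \<in> Vh \<Omega> Th"
  show "c *\<^sub>R v \<in> Vh \<Omega> Th"
    unfolding Vh_def scaleR_prod_def
  proof (rule SigmaI)
    have "\<exists>(A::real^'d::_^'d::_) b. \<forall>x\<in>T. (c *\<^sub>R fst v) x = A *v x + b" if T: "T \<in> Th" for T
    proof -
      obtain A :: "real^'d::_^'d::_" and b where 1: "\<forall>x\<in>T. fst v x = A *v x + b"
        using Vh_components(1)[OF v T] by (elim exE) (rule that)
      show ?thesis
        by (intro exI[of _ "c *\<^sub>R A"] exI[of _ "c *\<^sub>R b"])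
           (simp add: 1 scaleR_matrix_vector_assoc scaleR_add_right)
    qed
    moreover have "(\<lambda>x. (c *\<^sub>R fst v) x $ i) \<in> H1 \<Omega>" for i
      using H1_scale[OF Vh_components(2)[OF v], of c i] by simp
    ultimately show "c *\<^sub>R fst v \<in> CG \<Omega> Th" by (simp add: CG_def)
    show "c *\<^sub>R snd v \<in> DG Th"
      by (rule DG_I) (use face_value_eq[OF v] in auto)
  qed
qed

lemma Vh0_subset: "Vh0 \<Omega> Th \<subseteq> Vh \<Omega> Th"
  by (auto simp: Vh0_def)

lemma subspace_Vh0: "subspace (Vh0 \<Omega> Th)"
proof (rule subspaceI)
  show "0 \<in> Vh0 \<Omega> Th" using subspace_0[OF subspace_Vh] by (simp add: Vh0_def)
  show "u + v \<in> Vh0 \<Omega> Th" if "u \<in> Vh0 \<Omega> Th" "v \<in> Vh0 \<Omega> Th" for u v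
    using that subspace_add[OF subspace_Vh, of u v] by (simp add: Vh0_def)
  show "c *\<^sub>R v \<in> Vh0 \<Omega> Th" if "v \<in> Vh0 \<Omega> Th" for c v
    using that subspace_scale[OF subspace_Vh, of v c] by (simp add: Vh0_def)
qed

lemma face_value_linear:
  "face_value (u + v) e = face_value u e + face_value v e"
  "face_value (c *\<^sub>R v) e = c * face_value v e"
  by (simp_all add: face_value_def)

lemma face_moment_linear: "e \<in> faces Th \<Longrightarrow> linear_on_subspace (Vh \<Omega> Th) (\<lambda>v. face_moment v e)"
  by (rule linear_on_subspaceI)
     (simp_all add: face_moment_def integrable_face fst_continuous_face)

lemma normal_mean_linear: "e \<in> faces Th \<Longrightarrow> linear_on_subspace (Vh \<Omega> Th) (\<lambda>v. normal_mean v e)"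
  using face_moment_linear[of e]
  by (auto simp: linear_on_subspace_def normal_mean_def inner_add_left add_divide_distrib)

lemma div_value_linear: "linear_on_subspace V (\<lambda>v. div_value v T)"
  by (rule linear_on_subspaceI)
     (simp_all add: div_value_def face_value_linear distrib_left distrib_right sum.distrib
        add_divide_distrib sum_distrib_left mult_ac)

lemma rt_value_linear:
  "rt_value (u + v) T x = rt_value u T x + rt_value v T x"
  "rt_value (c *\<^sub>R v) T x = c *\<^sub>R rt_value v T x"
  by (simp_all add: rt_value_def face_value_linear distrib_right add_divide_distrib scaleR_add_left
      sum.distrib scaleR_sum_right mult.assoc)

section \<open>Jacobians of the continuous component\<close>

definition jacobian :: "'d weak_fun \<Rightarrow> (real^'d::_) set \<Rightarrow> real^'d::_^'d::_" where
  "jacobian v T = (SOME A. \<exists>c. \<forall>x\<in>T. fst v x = A *v x + c)"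

lemma jacobian:
  assumes v: "v \<in> Vh \<Omega> Th" and T: "T \<in> Th"
  shows "\<exists>c. \<forall>x\<in>T. fst v x = jacobian v T *v x + c"
proof -
  have "\<exists>A c. \<forall>x\<in>T. fst v x = A *v x + c" by (rule Vh_components(1)[OF v T])
  then show ?thesis unfolding jacobian_def by (rule someI_ex)
qed

text \<open>The difference of two candidate matrices is constant as a map on \<open>T\<close>, which
  contains a ball, so it kills every direction.\<close>

lemma jacobian_unique:
  assumes v: "v \<in> Vh \<Omega> Th" and T: "T \<in> Th" and A: "\<And>x. x \<in> T \<Longrightarrow> fst v x = A *v x + c"
  shows "jacobian v T = A"
proof -
  obtain c' where c': "\<forall>x\<in>T. fst v x = jacobian v T *v x + c'" using jacobian[OF v T] by blast
  let ?B = "jacobian v T - A"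
  obtain x0 r where r: "r > 0" "ball x0 r \<subseteq> T"
    using full_simplex.interior_T_nonempty[OF full[OF T]] mem_interior by blast
  have B: "?B *v x = c - c'" if "x \<in> T" for x
    using c' A[OF that] that by (simp add: matrix_vector_mult_diff_rdistrib algebra_simps)
  have "?B *v y = 0" for y
  proof -
    \<comment> \<open>Adding \<open>1\<close> avoids a division by zero for \<open>y = 0\<close>;
      with the \<open>t\<close> below the step has length at most \<open>r / 2\<close>.\<close>
    define m where "m = norm y + 1"
    have m: "norm y \<le> m" "m > 0" by (simp_all add: m_def add_nonneg_pos)
    define t where "t = r / (2 * m)"
    have t: "t > 0" using r(1) m by (simp add: t_def)
    have "norm (t *\<^sub>R y) \<le> t * m" using t m by simp
    also have "\<dots> = r / 2" using m by (simp add: t_def)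
    finally have "x0 + t *\<^sub>R y \<in> T" using r by (intro subsetD[OF r(2)]) (simp add: dist_norm)
    then have "?B *v (x0 + t *\<^sub>R y) = ?B *v x0" using B r(1) subsetD[OF r(2), of x0] by simp
    then have "t *\<^sub>R (?B *v y) = 0"
      by (simp add: matrix_vector_right_distrib matrix_vector_mult_scaleR)
    then show ?thesis using t by simp
  qed
  then have "?B = 0" by (simp add: matrix_eq)
  then show ?thesis by simp
qed

lemma jacobian_linear:
  assumes T: "T \<in> Th"
  shows "linear_on_subspace (Vh \<Omega> Th) (\<lambda>v. jacobian v T)"
proof (rule linear_on_subspaceI)
  fix u v assume u: "u \<in> Vh \<Omega> Th" and v: "v \<in> Vh \<Omega> Th"
  obtain a b where "\<forall>x\<in>T. fst u x = jacobian u T *v x + a" "\<forall>x\<in>T. fst v x = jacobian v T *v x + b"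
    using jacobian[OF u T] jacobian[OF v T] by blast
  then show "jacobian (u + v) T = jacobian u T + jacobian v T"
    by (intro jacobian_unique[where c="a + b", OF subspace_add[OF subspace_Vh u v] T])
       (simp add: matrix_vector_mult_add_rdistrib)
next
  fix r v assume v: "v \<in> Vh \<Omega> Th"
  obtain b where "\<forall>x\<in>T. fst v x = jacobian v T *v x + b"
    using jacobian[OF v T] by blast
  then show "jacobian (r *\<^sub>R v) T = r *\<^sub>R jacobian v T"
    by (intro jacobian_unique[where c="r *\<^sub>R b", OF subspace_scale[OF subspace_Vh v] T])
       (simp add: scaleR_matrix_vector_assoc scaleR_add_right)
qed

end

section \<open>The discrete forms\<close>

text \<open>Rewrites a functional of the matrix \<open>\<sigma>\<close> as an inner product with a
  rank-one matrix, from which the modified gradient can be read off.\<close>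

lemma inner_outer_product:
  fixes q n :: "real^'d::finite" and \<sigma> :: "real^'d^'d"
  shows "(\<chi> i j. q $ i * n $ j) \<bullet> \<sigma> = q \<bullet> (\<sigma> *v n)"
  by (simp add: inner_vec_def matrix_vector_mult_def sum_distrib_left mult_ac)

lemma sum_triple: "(\<Sum>k\<in>A \<times> B \<times> C. h k) = (\<Sum>a\<in>A. \<Sum>b\<in>B. \<Sum>c\<in>C. h (a, b, c))"
  unfolding sum.cartesian_product by (intro sum.cong refl) auto

text \<open>\<open>kap A y\<close> stands for \<open>(\<nabla> \<times> w) \<times> y\<close> with \<open>w\<close> an affine field of Jacobian \<open>A\<close>.\<close>

locale fem_problem = fem_mesh \<Omega> Th ne
  for \<Omega> :: "(real^'d::{finite,wellorder}) set" and Th ne +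
  fixes crs :: "real^'d::_ \<Rightarrow> real^'d::_ \<Rightarrow> 'c::euclidean_space"
    and ccrs :: "(real^'d::_ \<Rightarrow> real^'d::_) \<Rightarrow> (real^'d::_ \<Rightarrow> real^'d::_) \<Rightarrow> real^'d::_ \<Rightarrow> real^'d::_"
    and kap :: "real^'d::_^'d::_ \<Rightarrow> real^'d::_ \<Rightarrow> real^'d::_"
    and \<nu> :: real and f :: "real^'d::_ \<Rightarrow> real^'d::_"
  assumes crs_inner: "norm n = 1 \<Longrightarrow> crs n a \<bullet> crs n b = a \<bullet> b - (n \<bullet> a) * (n \<bullet> b)"
    and ccrs_affine: "open S \<Longrightarrow> x \<in> S \<Longrightarrow> (\<And>y. y \<in> S \<Longrightarrow> w y = A *v y + c) \<Longrightarrow> ccrs w z x = kap A (z x)"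
    and kap_linear1: "linear (\<lambda>A. kap A y)" and kap_linear2: "linear (kap A)"
    and kap_skew: "kap A y \<bullet> y = 0"
    and \<nu>_pos: "\<nu> > 0" and f_L2: "L2 (lebesgue_on \<Omega>) f"
begin

text \<open>The integral of \<open>v\<^sub>0\<close> over \<open>e\<close> with its normal component replaced by that of \<open>v\<^sub>b n\<^sub>e\<close>.\<close>

definition facet_vector :: "'d weak_fun \<Rightarrow> (real^'d::_) set \<Rightarrow> (real^'d::_) set \<Rightarrow> real^'d::_" where
  "facet_vector v T e = face_moment v e -
     (face_sign T e * area e * (normal_mean v e - face_value v e)) *\<^sub>R outward_normal T e"

text \<open>The discrete analogue of the formula that the mean gradient is the boundary integral of
  \<open>v\<close> times the normal, divided by the volume.\<close>

definition grad_value :: "'d weak_fun \<Rightarrow> (real^'d::_) set \<Rightarrow> real^'d::_^'d::_" where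
  "grad_value v T = (1 / vol T) *\<^sub>R
     (\<Sum>e | e facet_of T. \<chi> i j. facet_vector v T e $ i * outward_normal T e $ j)"

lemma grad_value_inner:
  assumes T: "T \<in> Th"
  shows "vol T * (grad_value v T \<bullet> \<sigma>) = (\<Sum>e | e facet_of T. facet_vector v T e \<bullet> (\<sigma> *v outward_normal T e))"
  using vol_pos[OF T] by (simp add: grad_value_def inner_sum_left inner_outer_product)

text \<open>By \<open>crs_inner\<close> the second product sees only the tangential part of the
  moment of \<open>v_0\<close>; the first supplies the normal part from \<open>v_b\<close>. Together
  they form \<open>facet_vector\<close>.\<close>

lemma facet_terms:
  assumes v: "v \<in> Vh \<Omega> Th" and T: "T \<in> Th" and e: "e facet_of T"
  shows "inner_L2 (face_measure e) (\<lambda>x. snd v e x * (ne e \<bullet> outward_normal T e))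
        (\<lambda>x. outward_normal T e \<bullet> (\<sigma> *v outward_normal T e)) +
      inner_L2 (face_measure e) (\<lambda>x. crs (outward_normal T e) (fst v x))
        (\<lambda>x. crs (outward_normal T e) (\<sigma> *v outward_normal T e))
    = facet_vector v T e \<bullet> (\<sigma> *v outward_normal T e)"
proof -
  let ?n = "outward_normal T e" and ?s = "face_sign T e" and ?M = "face_moment v e"
  let ?k = "\<sigma> *v ?n"
  have ef: "e \<in> faces Th" by (rule facet_in_faces[OF T e])
  have n1: "norm ?n = 1" using full_simplex.facet_normal[OF full[OF T] e] .
  have 1: "inner_L2 (face_measure e) (\<lambda>x. snd v e x * (ne e \<bullet> ?n)) (\<lambda>x. ?n \<bullet> ?k)
      = area e * face_value v e * ?s * (?n \<bullet> ?k)"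
    unfolding inner_L2_def
    using face_integral_const[of e "\<lambda>x. (snd v e x * (ne e \<bullet> ?n)) \<bullet> (?n \<bullet> ?k)" "face_value v e * ?s * (?n \<bullet> ?k)"]
      face_value_eq[OF v ef] by (simp add: face_sign_def mult.assoc)
  have i: "integrable (face_measure e) (fst v)"
    by (rule integrable_face[OF ef fst_continuous_face[OF v ef]])
  have "inner_L2 (face_measure e) (\<lambda>x. crs ?n (fst v x)) (\<lambda>x. crs ?n ?k)
      = (LINT x|face_measure e. fst v x \<bullet> ?k - (?n \<bullet> fst v x) * (?n \<bullet> ?k))"
    unfolding inner_L2_def crs_inner[OF n1] ..
  also have "\<dots> = ?M \<bullet> ?k - (?n \<bullet> ?M) * (?n \<bullet> ?k)"
    using i by (simp add: face_moment_def)
  finally have 2: "inner_L2 (face_measure e) (\<lambda>x. crs ?n (fst v x)) (\<lambda>x. crs ?n ?k)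
      = ?M \<bullet> ?k - (?n \<bullet> ?M) * (?n \<bullet> ?k)" .
  have "?M \<bullet> ne e = area e * normal_mean v e"
    using area_pos[OF ef] by (simp add: normal_mean_def)
  then have "?s * (?M \<bullet> ?n) = area e * normal_mean v e"
    by (subst (asm) normal_eq_sign[OF T e]) simp
  then have "?s * ?s * (?M \<bullet> ?n) = ?s * (area e * normal_mean v e)" by (metis mult.assoc)
  then have 3: "?n \<bullet> ?M = ?s * area e * normal_mean v e"
    unfolding face_sign_square[OF T e] by (simp add: inner_commute mult.assoc)
  show ?thesis unfolding 1 2 3 by (simp add: facet_vector_def inner_diff_left algebra_simps)
qed

lemma grad_m_eq:
  assumes v: "v \<in> Vh \<Omega> Th" and T: "T \<in> Th" and x: "x \<in> interior T"
  shows "grad_m crs Th ne v x = grad_value v T"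
proof -
  let ?R = "\<lambda>T \<sigma>. inner_bdry T (\<lambda>e x. snd v e x * (ne e \<bullet> outward_normal T e))
                       (\<lambda>e x. outward_normal T e \<bullet> (\<sigma> *v outward_normal T e)) +
          inner_bdry T (\<lambda>e x. crs (outward_normal T e) (fst v x))
                       (\<lambda>e x. crs (outward_normal T e) (\<sigma> *v outward_normal T e))"
  let ?P = "\<lambda>G. G \<in> piecewise_const Th \<and>
     (\<forall>T\<in>Th. \<forall>\<sigma>::real^'d::_^'d::_. inner_L2 (lebesgue_on T) G (\<lambda>_. \<sigma>) = ?R T \<sigma>)"
  have rhs: "?R T \<sigma> = vol T * (grad_value v T \<bullet> \<sigma>)" if T: "T \<in> Th" for T \<sigma>
    unfolding grad_value_inner[OF T] inner_bdry_def sum.distrib[symmetric]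
    by (intro sum.cong refl) (simp add: facet_terms[OF v T])
  have lhs: "inner_L2 (lebesgue_on T) G (\<lambda>_. \<sigma>) = vol T * (C \<bullet> \<sigma>)"
    if "T \<in> Th" "\<And>x. x \<in> interior T \<Longrightarrow> G x = C" for T G C and \<sigma> :: "real^'d::_^'d::_"
  proof -
    have "(LINT x|lebesgue_on T. G x \<bullet> \<sigma>) = integral T (\<lambda>_. C \<bullet> \<sigma>)"
      by (rule integral_simplex(3)[OF that(1)]) (auto simp: that(2))
    then show ?thesis unfolding inner_L2_def
      using integral_const_compact[OF full_simplex.compact_T[OF full[OF that(1)]], of "C \<bullet> \<sigma>"] by simp
  qed
  let ?G = "piecewise (\<lambda>T _. grad_value v T)"
  have "?P ?G"
  proof (intro conjI ballI allI piecewise_const_piecewise)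
    fix T \<sigma> assume T: "T \<in> Th"
    show "inner_L2 (lebesgue_on T) ?G (\<lambda>_. \<sigma>) = ?R T \<sigma>"
      unfolding rhs[OF T] by (rule lhs[OF T piecewise_eq[OF T]])
  qed
  then have P: "?P (grad_m crs Th ne v)" unfolding grad_m_def by (rule someI[where P="?P"])
  then obtain C where C: "\<And>x. x \<in> interior T \<Longrightarrow> grad_m crs Th ne v x = C"
    using T by (auto simp: piecewise_const_def)
  have I: "inner_L2 (lebesgue_on T) (grad_m crs Th ne v) (\<lambda>_. \<sigma>) = vol T * (grad_value v T \<bullet> \<sigma>)" for \<sigma>
    unfolding rhs[OF T, symmetric] by (rule spec[OF bspec[OF conjunct2[OF P] T]])
  have "vol T * (C \<bullet> \<sigma>) = vol T * (grad_value v T \<bullet> \<sigma>)" for \<sigma>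
    by (rule trans[OF lhs[OF T C, symmetric] I])
  then have "(C - grad_value v T) \<bullet> \<sigma> = 0" for \<sigma>
    using vol_pos[OF T] by (simp add: inner_diff_left)
  then have "C - grad_value v T = 0" by (metis inner_eq_zero_iff)
  then show ?thesis using C[OF x] by simp
qed

lemma facet_vector_linear:
  assumes "e \<in> faces Th"
  shows "linear_on_subspace (Vh \<Omega> Th) (\<lambda>v. facet_vector v T e)"
  using face_moment_linear[OF assms] normal_mean_linear[OF assms]
  by (auto simp: linear_on_subspace_def facet_vector_def face_value_linear algebra_simps
      scaleR_add_left[symmetric] simp del: scaleR_add_left)

lemma grad_value_linear:
  assumes T: "T \<in> Th"
  shows "linear_on_subspace (Vh \<Omega> Th) (\<lambda>v. grad_value v T $ i $ j)"
proof -
  have g: "grad_value v T $ i $ j = (1 / vol T) * (\<Sum>e | e facet_of T. facet_vector v T e $ i * outward_normal T e $ j)" for v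
    by (simp add: grad_value_def)
  note L = facet_vector_linear[OF facet_in_faces[OF T]]
  show ?thesis
  proof (rule linear_on_subspaceI)
    fix u v assume uv: "u \<in> Vh \<Omega> Th" "v \<in> Vh \<Omega> Th"
    have "(\<Sum>e | e facet_of T. facet_vector (u + v) T e $ i * outward_normal T e $ j) =
        (\<Sum>e | e facet_of T. facet_vector u T e $ i * outward_normal T e $ j + facet_vector v T e $ i * outward_normal T e $ j)"
      by (intro sum.cong refl) (simp add: linear_on_subspaceD(1)[OF L uv] distrib_right)
    then show "grad_value (u + v) T $ i $ j = grad_value u T $ i $ j + grad_value v T $ i $ j"
      unfolding g by (simp only: sum.distrib distrib_left)
  next
    fix r v assume v: "v \<in> Vh \<Omega> Th"
    have "(\<Sum>e | e facet_of T. facet_vector (r *\<^sub>R v) T e $ i * outward_normal T e $ j) =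
        (\<Sum>e | e facet_of T. r * (facet_vector v T e $ i * outward_normal T e $ j))"
      by (intro sum.cong refl) (simp add: linear_on_subspaceD(2)[OF L v])
    then show "grad_value (r *\<^sub>R v) T $ i $ j = r *\<^sub>R (grad_value v T $ i $ j)"
      unfolding g by (simp add: sum_distrib_left[symmetric])
  qed
qed

section \<open>The energy as a sum of squares\<close>

text \<open>One functional for each matrix entry of the modified gradient on each simplex and one
  for each pair of a simplex and a facet of it. Interior faces occur twice, since the stabilizer
  sums over the boundaries of simplices.\<close>

definition energy_index :: "((real^'d::_) set \<times> 'd \<times> 'd + (real^'d::_) set \<times> (real^'d::_) set) set" where
  "energy_index = (Th \<times> UNIV \<times> UNIV) <+> (SIGMA T:Th. {e. e facet_of T})"

fun energy_functional ::
  "(real^'d::_) set \<times> 'd \<times> 'd + (real^'d::_) set \<times> (real^'d::_) set \<Rightarrow> 'd weak_fun \<Rightarrow> real" where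
  "energy_functional (Inl (T, i, j)) v = sqrt (\<nu> * vol T) * (grad_value v T $ i $ j)"
| "energy_functional (Inr (T, e)) v =
     sqrt (\<nu> * inverse (diameter T) * area e) * (normal_mean v e - face_value v e)"

lemma diameter_pos:
  assumes T: "T \<in> Th"
  shows "diameter T > 0"
proof -
  interpret full_simplex T by (rule full[OF T])
  have "interior T \<noteq> {}" by (rule interior_T_nonempty)
  then obtain x r where r: "r > 0" "ball x r \<subseteq> T" using mem_interior by blast
  obtain a :: "real^'d::_" where a: "norm a = r / 2" using vector_choose_size[of "r/2"] r(1) by auto
  have "x + a \<in> ball x r" using a r(1) by (simp add: dist_norm)
  then have "x \<in> T" "x + a \<in> T" using r by auto
  then have "dist x (x + a) \<le> diameter T"
    using diameter_bounded_bound[OF compact_imp_bounded[OF compact_T]] by blast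
  then show ?thesis using a r(1) by (simp add: dist_norm)
qed

lemma finite_energy_index: "finite energy_index"
  unfolding energy_index_def
  using finite_Th full_simplex.finite_facets[OF full] by (intro finite_Plus finite_SigmaI) auto

lemma energy_functional_linear:
  assumes "k \<in> energy_index"
  shows "linear_on_subspace (Vh \<Omega> Th) (energy_functional k)"
proof (cases k)
  case (Inl a)
  obtain T i j where a: "a = (T, i, j)" by (cases a)
  have "T \<in> Th" using assms Inl a by (auto simp: energy_index_def)
  from grad_value_linear[OF this, of i j] show ?thesis
    unfolding Inl a linear_on_subspace_def by (simp add: distrib_left)
next
  case (Inr b)
  obtain T e where b: "b = (T, e)" by (cases b)
  have "e \<in> faces Th" using assms Inr b facet_in_faces by (auto simp: energy_index_def)
  from normal_mean_linear[OF this] show ?thesis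
    unfolding Inr b linear_on_subspace_def by (simp add: face_value_linear algebra_simps)
qed

lemma a_form_eq:
  assumes w: "w \<in> Vh \<Omega> Th" and v: "v \<in> Vh \<Omega> Th"
  shows "a_form crs \<nu> \<Omega> Th ne w v = (\<Sum>k\<in>energy_index. energy_functional k w * energy_functional k v)"
proof -
  have "inner_L2 (lebesgue_on \<Omega>) (grad_m crs Th ne w) (grad_m crs Th ne v)
      = (\<Sum>T\<in>Th. integral T (\<lambda>_. grad_value w T \<bullet> grad_value v T))"
    unfolding inner_L2_def
    by (rule integral_domain(2)) (simp_all add: grad_m_eq[OF w] grad_m_eq[OF v])
  also have "\<dots> = (\<Sum>T\<in>Th. vol T * (grad_value w T \<bullet> grad_value v T))"
    by (intro sum.cong refl) (simp add: integral_const_compact[OF full_simplex.compact_T[OF full]])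
  finally have 1: "inner_L2 (lebesgue_on \<Omega>) (grad_m crs Th ne w) (grad_m crs Th ne v)
      = (\<Sum>T\<in>Th. vol T * (grad_value w T \<bullet> grad_value v T))" .
  let ?d = "\<lambda>v e. normal_mean v e - face_value v e"
  have 2: "inner_bdry T (\<lambda>e x. Qb Th (normal_comp ne w) e x - snd w e x)
                  (\<lambda>e x. Qb Th (normal_comp ne v) e x - snd v e x)
      = (\<Sum>e | e facet_of T. area e * (?d w e * ?d v e))" if T: "T \<in> Th" for T
    unfolding inner_bdry_def inner_L2_def
  proof (rule sum.cong[OF refl])
    fix e assume "e \<in> {e. e facet_of T}"
    then have e: "e \<in> faces Th" using facet_in_faces[OF T] by simp
    show "(LINT x|face_measure e. (Qb Th (normal_comp ne w) e x - snd w e x) \<bullet>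
        (Qb Th (normal_comp ne v) e x - snd v e x)) = area e * (?d w e * ?d v e)"
      using face_integral_const[of e "\<lambda>x. (Qb Th (normal_comp ne w) e x - snd w e x) \<bullet>
        (Qb Th (normal_comp ne v) e x - snd v e x)" "?d w e * ?d v e"]
      by (simp add: Qb_eq[OF w e] Qb_eq[OF v e] face_value_eq[OF w e] face_value_eq[OF v e])
  qed
  have fin: "finite {e. e facet_of T}" if "T \<in> Th" for T
    using full_simplex.finite_facets[OF full[OF that]] .
  have A: "(\<Sum>k\<in>Th \<times> UNIV \<times> UNIV. energy_functional (Inl k) w * energy_functional (Inl k) v)
      = (\<Sum>T\<in>Th. \<nu> * (vol T * (grad_value w T \<bullet> grad_value v T)))"
  proof -
    have "(\<Sum>k\<in>Th \<times> UNIV \<times> UNIV. energy_functional (Inl k) w * energy_functional (Inl k) v)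
        = (\<Sum>T\<in>Th. \<Sum>i\<in>UNIV. \<Sum>j\<in>UNIV. (sqrt (\<nu> * vol T) * sqrt (\<nu> * vol T)) * (grad_value w T $ i $ j * grad_value v T $ i $ j))"
      unfolding sum_triple by (intro sum.cong refl) (simp only: energy_functional.simps mult_ac)
    also have "\<dots> = (\<Sum>T\<in>Th. \<nu> * (vol T * (grad_value w T \<bullet> grad_value v T)))"
    proof (rule sum.cong[OF refl])
      fix T assume "T \<in> Th"
      have "sqrt (\<nu> * vol T) * sqrt (\<nu> * vol T) = \<nu> * vol T"
        using \<nu>_pos by simp
      then show "(\<Sum>i\<in>UNIV. \<Sum>j\<in>UNIV. (sqrt (\<nu> * vol T) * sqrt (\<nu> * vol T)) * (grad_value w T $ i $ j * grad_value v T $ i $ j))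
          = \<nu> * (vol T * (grad_value w T \<bullet> grad_value v T))"
        by (simp only: inner_vec_def inner_real_def sum_distrib_left mult.assoc)
    qed
    finally show ?thesis .
  qed
  have B: "(\<Sum>k\<in>(SIGMA T:Th. {e. e facet_of T}). energy_functional (Inr k) w * energy_functional (Inr k) v)
      = (\<Sum>T\<in>Th. \<nu> * (inverse (diameter T) * (\<Sum>e | e facet_of T. area e * (?d w e * ?d v e))))"
  proof -
    have "(\<Sum>k\<in>(SIGMA T:Th. {e. e facet_of T}). energy_functional (Inr k) w * energy_functional (Inr k) v)
        = (\<Sum>T\<in>Th. \<Sum>e | e facet_of T. energy_functional (Inr (T, e)) w * energy_functional (Inr (T, e)) v)"
      by (subst sum.Sigma, rule finite_Th, simp add: fin, intro sum.cong refl) auto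
    also have "\<dots> = (\<Sum>T\<in>Th. \<nu> * (inverse (diameter T) * (\<Sum>e | e facet_of T. area e * (?d w e * ?d v e))))"
      unfolding sum_distrib_left
    proof (intro sum.cong refl)
      fix T e :: "(real^'d::_) set" assume T: "T \<in> Th"
      let ?c = "\<nu> * inverse (diameter T) * area e"
      have "?c \<ge> 0" using \<nu>_pos diameter_pos[OF T] by simp
      then have c: "sqrt ?c * sqrt ?c = ?c" by simp
      have "energy_functional (Inr (T, e)) w * energy_functional (Inr (T, e)) v = (sqrt ?c * sqrt ?c) * (?d w e * ?d v e)"
        by (simp only: energy_functional.simps mult_ac)
      then show "energy_functional (Inr (T, e)) w * energy_functional (Inr (T, e)) v
          = \<nu> * (inverse (diameter T) * (area e * (?d w e * ?d v e)))"
        unfolding c by (simp only: mult.assoc)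
    qed
    finally show ?thesis .
  qed
  have "(\<Sum>k\<in>energy_index. energy_functional k w * energy_functional k v)
     = (\<Sum>T\<in>Th. \<nu> * (vol T * (grad_value w T \<bullet> grad_value v T)))
      + (\<Sum>T\<in>Th. \<nu> * (inverse (diameter T) * (\<Sum>e | e facet_of T. area e * (?d w e * ?d v e))))"
    unfolding energy_index_def A[symmetric] B[symmetric]
    using finite_Th fin by (subst sum.Plus) (auto intro!: finite_SigmaI)
  moreover have "s_form \<nu> Th ne w v = \<nu> * (\<Sum>T\<in>Th. inverse (diameter T) *
      (\<Sum>e | e facet_of T. area e * (?d w e * ?d v e)))"
    unfolding s_form_def by (simp add: 2)
  ultimately show ?thesis
    unfolding a_form_def 1 by (simp only: sum_distrib_left)
qed

section \<open>The convective term and the load\<close>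

definition c_value :: "'d weak_fun \<Rightarrow> 'd weak_fun \<Rightarrow> 'd weak_fun \<Rightarrow> real" where
  "c_value w z v = (\<Sum>T\<in>Th. integral T (\<lambda>x. kap (jacobian w T) (rt_value z T x) \<bullet> rt_value v T x))"

lemma continuous_c_integrand: "continuous_on A (\<lambda>x. kap B (rt_value z T x) \<bullet> rt_value v T x)"
proof -
  have "continuous_on UNIV (kap B)"
    using kap_linear2 linear_continuous_on linear_conv_bounded_linear by blast
  then have "continuous_on A (\<lambda>x. kap B (rt_value z T x))"
    by (rule continuous_on_compose2[OF _ continuous_rt_value]) auto
  then show ?thesis by (intro continuous_intros continuous_rt_value)
qed

lemma integrable_c: "T \<in> Th \<Longrightarrow> (\<lambda>x. kap B (rt_value z T x) \<bullet> rt_value v T x) integrable_on T"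
  by (intro integrable_on_continuous_compact continuous_c_integrand full_simplex.compact_T[OF full])

text \<open>The pointwise curl is evaluated in the open interior, where \<open>v_0\<close> is affine
  and the curl depends on its Jacobian only.\<close>

lemma c_form_eq:
  assumes w: "w \<in> Vh \<Omega> Th" and z: "z \<in> Vh \<Omega> Th" and v: "v \<in> Vh \<Omega> Th"
  shows "c_form ccrs \<Omega> Th ne w z v = c_value w z v"
  unfolding c_form_def inner_L2_def c_value_def
proof (rule integral_domain(2)[OF continuous_c_integrand])
  fix T x assume T: "T \<in> Th" and x: "x \<in> interior T"
  obtain c where c: "\<forall>x\<in>T. fst w x = jacobian w T *v x + c" using jacobian[OF w T] by blast
  have "ccrs (fst w) (RT_interp \<Omega> Th ne z) x = kap (jacobian w T) (RT_interp \<Omega> Th ne z x)"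
    by (rule ccrs_affine[OF open_interior x]) (use c interior_subset in blast)
  then show "ccrs (fst w) (RT_interp \<Omega> Th ne z) x \<bullet> RT_interp \<Omega> Th ne v x =
      kap (jacobian w T) (rt_value z T x) \<bullet> rt_value v T x"
    by (simp add: RT_interp_eq[OF z T x] RT_interp_eq[OF v T x])
qed

lemma c_value_linear1: "linear_on_subspace (Vh \<Omega> Th) (\<lambda>w. c_value w z v)"
proof (rule linear_on_subspaceI)
  fix u w assume u: "u \<in> Vh \<Omega> Th" and w: "w \<in> Vh \<Omega> Th"
  show "c_value (u + w) z v = c_value u z v + c_value w z v"
    unfolding c_value_def sum.distrib[symmetric]
    by (intro sum.cong refl)
       (simp add: linear_on_subspaceD(1)[OF jacobian_linear u w] linear_add[OF kap_linear1] inner_add_left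
         integral_add[OF integrable_c integrable_c])
next
  fix r w assume w: "w \<in> Vh \<Omega> Th"
  show "c_value (r *\<^sub>R w) z v = r *\<^sub>R c_value w z v"
    unfolding c_value_def real_scaleR_def sum_distrib_left
    by (intro sum.cong refl)
       (simp add: linear_on_subspaceD(2)[OF jacobian_linear w] linear_scale[OF kap_linear1])
qed

lemma c_value_linear2: "linear_on_subspace V (\<lambda>z. c_value w z v)"
proof (rule linear_on_subspaceI)
  fix u z assume "u \<in> V" "z \<in> V"
  show "c_value w (u + z) v = c_value w u v + c_value w z v"
    unfolding c_value_def sum.distrib[symmetric]
    by (intro sum.cong refl)
       (simp add: rt_value_linear linear_add[OF kap_linear2] inner_add_left integral_add[OF integrable_c integrable_c])
next
  fix r z assume "z \<in> V"
  show "c_value w (r *\<^sub>R z) v = r *\<^sub>R c_value w z v"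
    unfolding c_value_def real_scaleR_def sum_distrib_left
    by (intro sum.cong refl) (simp add: rt_value_linear linear_scale[OF kap_linear2])
qed

lemma c_value_linear3: "linear_on_subspace V (\<lambda>v. c_value w z v)"
proof (rule linear_on_subspaceI)
  fix u v assume "u \<in> V" "v \<in> V"
  show "c_value w z (u + v) = c_value w z u + c_value w z v"
    unfolding c_value_def sum.distrib[symmetric]
    by (intro sum.cong refl)
       (simp add: rt_value_linear inner_add_right integral_add[OF integrable_c integrable_c])
next
  fix r v assume "v \<in> V"
  show "c_value w z (r *\<^sub>R v) = r *\<^sub>R c_value w z v"
    unfolding c_value_def real_scaleR_def sum_distrib_left
    by (intro sum.cong refl) (simp add: rt_value_linear)
qed

lemma c_value_skew: "c_value w v v = 0"
  by (simp add: c_value_def kap_skew)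

text \<open>\<open>f\<close> is only square-integrable, so the load is not a sum of integrals of
  continuous functions; the chosen interpolant is replaced by its linear representative up to a null
  set.\<close>

definition load :: "'d weak_fun \<Rightarrow> real" where
  "load v = inner_L2 (lebesgue_on \<Omega>) f (piecewise (rt_value v))"

lemma L2_piecewise_rt: "L2 (lebesgue_on \<Omega>) (piecewise (rt_value v))"
  by (rule L2_piecewise[where F="rt_value v"]) (simp_all add: continuous_rt_value piecewise_eq)

lemma load_eq:
  assumes v: "v \<in> Vh \<Omega> Th"
  shows "inner_L2 (lebesgue_on \<Omega>) f (RT_interp \<Omega> Th ne v) = load v"
proof -
  have L2: "L2 (lebesgue_on \<Omega>) (RT_interp \<Omega> Th ne v)"
    by (rule L2_piecewise[where F="rt_value v"]) (simp_all add: continuous_rt_value RT_interp_eq[OF v])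
  have "AE x in lebesgue_on \<Omega>. f x \<bullet> RT_interp \<Omega> Th ne v x = f x \<bullet> piecewise (rt_value v) x"
    by (rule AE_domain) (simp add: RT_interp_eq[OF v] piecewise_eq)
  then show ?thesis unfolding load_def inner_L2_def
    using L2_inner_integrable[OF f_L2 L2] L2_inner_integrable[OF f_L2 L2_piecewise_rt]
    by (intro integral_cong_AE) (auto intro: borel_measurable_integrable)
qed

lemma load_linear: "linear_on_subspace V load"
proof (rule linear_on_subspaceI)
  have p: "piecewise (rt_value (u + v)) x = piecewise (rt_value u) x + piecewise (rt_value v) x" for u v x
    unfolding piecewise_def sum.distrib[symmetric] by (intro sum.cong refl) (simp add: rt_value_linear)
  have s: "piecewise (rt_value (r *\<^sub>R v)) x = r *\<^sub>R piecewise (rt_value v) x" for r v x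
    unfolding piecewise_def scaleR_sum_right by (intro sum.cong refl) (simp add: rt_value_linear)
  fix u v
  show "load (u + v) = load u + load v"
    by (simp add: load_def inner_L2_def p inner_add_right L2_inner_integrable[OF f_L2 L2_piecewise_rt])
  show "load (r *\<^sub>R v) = r *\<^sub>R load v" for r
    by (simp add: load_def inner_L2_def s)
qed

lemma b_form_eq:
  assumes v: "v \<in> Vh \<Omega> Th" and q: "\<And>T x. T \<in> Th \<Longrightarrow> x \<in> interior T \<Longrightarrow> q x = k T"
  shows "b_form \<Omega> Th ne v q = (\<Sum>T\<in>Th. vol T * div_value v T * k T)"
proof -
  have "b_form \<Omega> Th ne v q = (\<Sum>T\<in>Th. integral T (\<lambda>_. div_value v T * k T))"
    unfolding b_form_def inner_L2_def by (rule integral_domain(2)) (simp_all add: div_m_eq[OF v] q)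
  also have "\<dots> = (\<Sum>T\<in>Th. vol T * div_value v T * k T)"
    by (intro sum.cong refl) (simp add: integral_const_compact[OF full_simplex.compact_T[OF full]] mult.assoc)
  finally show ?thesis .
qed

end

section \<open>Existence of discrete solutions\<close>

context fem_problem
begin

lemma energy_null_values:
  assumes null: "\<forall>k\<in>energy_index. energy_functional k v = 0" and T: "T \<in> Th"
  shows "grad_value v T = 0" and "\<And>e. e facet_of T \<Longrightarrow> normal_mean v e = face_value v e"
proof -
  have "grad_value v T $ i $ j = 0" for i j
  proof -
    have "energy_functional (Inl (T, i, j)) v = 0"
      by (rule bspec[OF null]) (use T in \<open>auto simp only: energy_index_def InlI mem_Sigma_iff UNIV_I\<close>)
    moreover have "sqrt (\<nu> * vol T) \<noteq> 0"
      using real_sqrt_gt_zero[OF mult_pos_pos[OF \<nu>_pos vol_pos[OF T]]] by (rule less_imp_neq[symmetric])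
    ultimately show ?thesis by (simp only: energy_functional.simps mult_eq_0_iff simp_thms)
  qed
  then show "grad_value v T = 0" by (simp add: vec_eq_iff)
  fix e assume e: "e facet_of T"
  have "energy_functional (Inr (T, e)) v = 0"
    by (rule bspec[OF null]) (use T e in \<open>auto simp only: energy_index_def InrI mem_Sigma_iff mem_Collect_eq\<close>)
  moreover have "sqrt (\<nu> * inverse (diameter T) * area e) \<noteq> 0"
    using real_sqrt_gt_zero[OF mult_pos_pos[OF mult_pos_pos[OF \<nu>_pos
      positive_imp_inverse_positive[OF diameter_pos[OF T]]] area_pos[OF facet_in_faces[OF T e]]]]
    by (rule less_imp_neq[symmetric])
  ultimately have "normal_mean v e - face_value v e = 0"
    by (simp only: energy_functional.simps mult_eq_0_iff simp_thms)
  then show "normal_mean v e = face_value v e" by simp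
qed

text \<open>If the stabilizer vanishes, integration by parts shows that the modified gradient is the
  gradient of the continuous component.\<close>

lemma grad_value_eq_jacobian:
  assumes v: "v \<in> Vh \<Omega> Th" and T: "T \<in> Th"
    and mean: "\<And>e. e facet_of T \<Longrightarrow> normal_mean v e = face_value v e"
  shows "grad_value v T = jacobian v T"
proof -
  let ?A = "jacobian v T"
  obtain c where c: "\<forall>x\<in>T. fst v x = ?A *v x + c" using jacobian[OF v T] by blast
  interpret full_simplex T by (rule full[OF T])
  have "vol T * (grad_value v T $ i $ j) = vol T * (?A $ i $ j)" for i j
  proof -
    let ?\<phi> = "\<lambda>x. ?A $ i \<bullet> x + c $ i"
    have mom: "(LINT x|face_measure e. ?\<phi> x) = face_moment v e $ i" if e: "e facet_of T" for e
    proof -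
      have ef: "e \<in> faces Th" by (rule facet_in_faces[OF T e])
      have int: "integrable (face_measure e) (fst v)"
        by (rule integrable_face[OF ef fst_continuous_face[OF v ef]])
      have "(LINT x|face_measure e. ?\<phi> x) = (LINT x|face_measure e. fst v x \<bullet> axis i 1)"
        using c facet_subset[OF e]
        by (intro Bochner_Integration.integral_cong)
           (auto simp: space_face_measure inner_axis matrix_vector_mul_component)
      also have "\<dots> = face_moment v e \<bullet> axis i 1" using int by (simp add: face_moment_def)
      finally show ?thesis by (simp add: inner_axis)
    qed
    \<comment> \<open>Gauss' theorem for the \<open>i\<close>-th component of \<open>v_0\<close> and
      the constant field in direction \<open>j\<close>; the integrand is the constant
      \<open>?A $ i $ j\<close>.\<close>
    have "integral T (\<lambda>x. ?A $ i \<bullet> (axis j 1 + 0 *\<^sub>R x) + real CARD('d) * 0 * ?\<phi> x)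
        = (\<Sum>e | e facet_of T. LINT x|face_measure e. ?\<phi> x * (outward_normal T e \<bullet> (axis j 1 + 0 *\<^sub>R x)))"
      by (rule simplex_gauss[OF simplices[OF T]]) (auto intro!: derivative_eq_intros)
    moreover have "(\<Sum>e | e facet_of T. LINT x|face_measure e. ?\<phi> x * (outward_normal T e \<bullet> (axis j 1 + 0 *\<^sub>R x)))
        = (\<Sum>e | e facet_of T. facet_vector v T e $ i * outward_normal T e $ j)"
    proof (rule sum.cong[OF refl])
      fix e assume "e \<in> {e. e facet_of T}"
      then have e: "e facet_of T" by simp
      have "(LINT x|face_measure e. ?\<phi> x * (outward_normal T e \<bullet> (axis j 1 + 0 *\<^sub>R x)))
          = (LINT x|face_measure e. ?\<phi> x) * outward_normal T e $ j"
        by (simp only: scaleR_zero_left add_0_right inner_axis inner_real_def mult_1_right integral_mult_left_zero)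
      also have "\<dots> = facet_vector v T e $ i * outward_normal T e $ j"
        unfolding mom[OF e] by (simp add: facet_vector_def mean[OF e])
      finally show "(LINT x|face_measure e. ?\<phi> x * (outward_normal T e \<bullet> (axis j 1 + 0 *\<^sub>R x)))
          = facet_vector v T e $ i * outward_normal T e $ j" .
    qed
    moreover have "vol T * (grad_value v T $ i $ j) = (\<Sum>e | e facet_of T. facet_vector v T e $ i * outward_normal T e $ j)"
      using vol_pos by (simp add: grad_value_def)
    ultimately show ?thesis
      using integral_const_compact[OF compact_T, of "?A $ i $ j"] by (simp add: inner_axis)
  qed
  then show ?thesis using vol_pos by (simp add: vec_eq_iff)
qed

text \<open>A vanishing gradient makes \<open>v_0\<close> constant on each simplex, so it takes
  finitely many values on the connected closure and is constant there; its boundary value is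
  \<open>0\<close>. The conclusion concerns face values, as functions off the mesh are not
  controlled.\<close>

lemma energy_null:
  assumes v: "v \<in> Vh0 \<Omega> Th" and null: "\<forall>k\<in>energy_index. energy_functional k v = 0"
    and e: "e \<in> faces Th"
  shows "face_value v e = 0"
proof -
  have vV: "v \<in> Vh \<Omega> Th" using v Vh0_subset by blast
  note nv = energy_null_values[OF null]
  have const: "\<exists>c. \<forall>x\<in>T. fst v x = c" if T: "T \<in> Th" for T
  proof -
    have "jacobian v T = 0" using grad_value_eq_jacobian[OF vV T nv(2)[OF T]] nv(1)[OF T] by simp
    then show ?thesis using jacobian[OF vV T] by simp
  qed
  have conn: "connected (\<Union>Th)" unfolding cover by (rule connected_imp_connected_closure[OF connected_domain])
  obtain x0 where x0: "x0 \<in> frontier \<Omega>"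
    using frontier_eq_empty[of \<Omega>] domain_nonempty bounded_domain not_bounded_UNIV by blast
  then have x0c: "x0 \<in> \<Union>Th" unfolding cover by (simp add: frontier_def)
  have v0: "fst v x0 = 0" using v x0 by (simp add: Vh0_def)
  have zero: "fst v x = 0" if x: "x \<in> \<Union>Th" for x
  proof -
    have "fst v x $ i = 0" for i
    proof -
      \<comment> \<open>The pieces are restrictions of one function to finitely many closed sets, so
        they paste continuously.\<close>
      have "continuous_on (\<Union>T\<in>Th. T) (\<lambda>x. fst v x $ i)"
      proof (rule continuous_on_closed_Union[OF finite_Th])
        fix T assume T: "T \<in> Th"
        show "closed T" using full_simplex.compact_T[OF full[OF T]] by (rule compact_imp_closed)
        obtain c where "\<forall>x\<in>T. fst v x = c" using const[OF T] by blast
        then show "continuous_on T (\<lambda>x. fst v x $ i)"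
          by (simp cong: continuous_on_cong)
      qed
      then have cont: "continuous_on (\<Union>Th) (\<lambda>x. fst v x $ i)" by simp
      have "finite ((\<lambda>x. fst v x $ i) ` T)" if T: "T \<in> Th" for T
      proof -
        obtain c where "\<forall>x\<in>T. fst v x = c" using const[OF T] by blast
        then have "(\<lambda>x. fst v x $ i) ` T \<subseteq> {c $ i}" by auto
        then show ?thesis using finite_subset by blast
      qed
      then have "finite ((\<lambda>x. fst v x $ i) ` \<Union>Th)" using finite_Th by (simp add: image_Union)
      from continuous_finite_range_constant[OF conn cont this]
      have "fst v x $ i = fst v x0 $ i" using x x0c unfolding constant_on_def by metis
      then show ?thesis using v0 by simp
    qed
    then show ?thesis by (simp add: vec_eq_iff)
  qed
  obtain T where T: "T \<in> Th" "e facet_of T" using e by (rule facesE)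
  have "fst v x = 0" if "x \<in> e" for x
    using zero full_simplex.facet_subset[OF full[OF T(1)] T(2)] T(1) that by blast
  then have "face_moment v e = 0" using face_integral_const[of e "fst v" 0] by (simp add: face_moment_def)
  then have "normal_mean v e = 0" by (simp add: normal_mean_def)
  then show ?thesis using nv(2)[OF T] by simp
qed

text \<open>Reconstruction uses only face values, and these vanish for a vector of energy zero. This
  is the compatibility asked for by \<open>galerkin_solution\<close>.\<close>

lemma energy_null_forms:
  assumes v: "v \<in> Vh0 \<Omega> Th" and null: "\<forall>k\<in>energy_index. energy_functional k v = 0"
  shows "load v = 0" and "c_value u z v = 0"
proof -
  have rt: "rt_value v T x = 0" if T: "T \<in> Th" for T x
    unfolding rt_value_def using energy_null[OF v null facet_in_faces[OF T]] by (intro sum.neutral) simp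
  have "piecewise (rt_value v) x = 0" for x
    unfolding piecewise_def using rt by (intro sum.neutral) simp
  then show "load v = 0" by (simp add: load_def inner_L2_def)
  show "c_value u z v = 0" using rt by (simp add: c_value_def)
qed

theorem discrete_problem_solvable:
  "\<exists>u\<in>Dh \<Omega> Th ne. \<exists>p\<in>Wh0 \<Omega> Th. discrete_solution crs ccrs \<nu> \<Omega> Th ne f u p"
proof -
  \<comment> \<open>The divergence-free space through exact values on simplices in place of an
    almost everywhere condition, so that it is cut out by finitely many linear functionals.\<close>
  define V where "V = {v \<in> Vh0 \<Omega> Th. \<forall>T\<in>Th. div_value v T = 0}"
  have V0: "V \<subseteq> Vh0 \<Omega> Th" and VV: "V \<subseteq> Vh \<Omega> Th" using Vh0_subset by (auto simp: V_def)
  note dl = linear_on_subspaceD[OF div_value_linear[of "Vh0 \<Omega> Th"]]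
  have subV: "subspace V"
  proof (rule subspaceI)
    show "0 \<in> V"
      using subspace_0[OF subspace_Vh0] linear_on_subspace_0[OF div_value_linear subspace_Vh0]
      by (simp add: V_def)
    show "u + v \<in> V" if "u \<in> V" "v \<in> V" for u v
      using that subspace_add[OF subspace_Vh0, of u v] by (simp add: V_def dl)
    show "c *\<^sub>R v \<in> V" if "v \<in> V" for c v
      using that subspace_scale[OF subspace_Vh0, of v c] by (simp add: V_def dl)
  qed
  have "\<exists>u\<in>V. \<forall>v\<in>V. (\<Sum>k\<in>energy_index. energy_functional k u * energy_functional k v) + c_value u u v = load v"
  proof (rule galerkin_solution[where l=energy_functional and c=c_value and F=load, OF finite_energy_index subV])
    show "linear_on_subspace V (energy_functional k)" if "k \<in> energy_index" for k
      using linear_on_subspace_mono[OF energy_functional_linear[OF that] VV] .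
    show "linear_on_subspace V (\<lambda>w. c_value w u v)" for u v
      using linear_on_subspace_mono[OF c_value_linear1 VV] .
    show "load v = 0 \<and> (\<forall>u\<in>V. c_value u u v = 0)"
      if "v \<in> V" "\<forall>k\<in>energy_index. energy_functional k v = 0" for v
      using energy_null_forms[of v] that V0 by blast
  qed (rule c_value_linear2 c_value_linear3 c_value_skew load_linear)+
  then obtain u where u: "u \<in> V"
    and eq: "\<And>v. v \<in> V \<Longrightarrow> (\<Sum>k\<in>energy_index. energy_functional k u * energy_functional k v) + c_value u u v = load v"
    by blast
  have u0: "u \<in> Vh0 \<Omega> Th" and uV: "u \<in> Vh \<Omega> Th" using u V0 VV by auto
  \<comment> \<open>The momentum residual without pressure, now for all test functions in
    \<open>Vh0\<close>; it vanishes on \<open>V\<close> by construction of \<open>u\<close>.\<close>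
  let ?E = "\<lambda>v. (\<Sum>k\<in>energy_index. energy_functional k u * energy_functional k v) + c_value u u v - load v"
  have E: "linear_on_subspace (Vh0 \<Omega> Th) ?E"
  proof (rule linear_on_subspaceI)
    note el = linear_on_subspaceD[OF energy_functional_linear]
    note cl = linear_on_subspaceD[OF c_value_linear3[of UNIV]] and ll = linear_on_subspaceD[OF load_linear[of UNIV]]
    fix v w assume "v \<in> Vh0 \<Omega> Th" "w \<in> Vh0 \<Omega> Th"
    then have vw: "v \<in> Vh \<Omega> Th" "w \<in> Vh \<Omega> Th" using Vh0_subset by auto
    show "?E (v + w) = ?E v + ?E w"
      by (simp add: el(1)[OF _ vw] cl ll distrib_left sum.distrib)
  next
    note el = linear_on_subspaceD[OF energy_functional_linear]
    note cl = linear_on_subspaceD[OF c_value_linear3[of UNIV]] and ll = linear_on_subspaceD[OF load_linear[of UNIV]]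
    fix r v assume "v \<in> Vh0 \<Omega> Th"
    then have v: "v \<in> Vh \<Omega> Th" using Vh0_subset by auto
    have "(\<Sum>k\<in>energy_index. energy_functional k u * energy_functional k (r *\<^sub>R v))
        = r * (\<Sum>k\<in>energy_index. energy_functional k u * energy_functional k v)"
      unfolding sum_distrib_left by (intro sum.cong refl) (simp add: el(2)[OF _ v])
    then show "?E (r *\<^sub>R v) = r *\<^sub>R ?E v"
      by (simp add: cl ll algebra_simps)
  qed
  have "\<exists>c. \<forall>v\<in>Vh0 \<Omega> Th. ?E v = (\<Sum>T\<in>Th. c T * div_value v T)"
  proof (rule functional_in_span[OF finite_Th subspace_Vh0 E])
    show "linear_on_subspace (Vh0 \<Omega> Th) (\<lambda>v. div_value v T)" for T by (rule div_value_linear)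
    show "?E v = 0" if "v \<in> Vh0 \<Omega> Th" "\<forall>T\<in>Th. div_value v T = 0" for v
      using eq[of v] that by (simp add: V_def)
  qed
  then obtain c where c: "\<And>v. v \<in> Vh0 \<Omega> Th \<Longrightarrow> ?E v = (\<Sum>T\<in>Th. c T * div_value v T)" by blast
  txt \<open>The multipliers are the pressure up to the constant \<open>m\<close>, to which \<open>b\<close> is blind.\<close>
  define m where "m = (\<Sum>T\<in>Th. c T) / (\<Sum>T\<in>Th. vol T)"
  define k where "k T = c T / vol T - m" for T
  define p where "p = piecewise (\<lambda>T _. k T)"
  have p: "p x = k T" if "T \<in> Th" "x \<in> interior T" for T x
    unfolding p_def by (rule piecewise_eq[OF that])
  have volk: "vol T * k T = c T - m * vol T" if "T \<in> Th" for T
    using vol_pos[OF that] by (simp add: k_def right_diff_distrib mult.commute)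
  have vols: "(\<Sum>T\<in>Th. vol T) > 0"
  proof (rule sum_pos[OF finite_Th])
    show "Th \<noteq> {}" using cover domain_nonempty by (metis Sup_empty closure_eq_empty)
  qed (rule vol_pos)
  have "(LINT x|lebesgue_on \<Omega>. p x) = (\<Sum>T\<in>Th. integral T (\<lambda>_. k T))"
    by (rule integral_domain(2)) (simp_all add: p)
  also have "\<dots> = (\<Sum>T\<in>Th. c T - m * vol T)"
    by (intro sum.cong refl) (simp add: integral_const_compact[OF full_simplex.compact_T[OF full]] volk)
  also have "\<dots> = 0"
    unfolding sum_subtractf sum_distrib_left[symmetric] using vols by (simp add: m_def)
  finally have pW: "p \<in> Wh0 \<Omega> Th"
    by (simp add: Wh0_def p_def piecewise_const_piecewise)
  have bp: "b_form \<Omega> Th ne v p = ?E v" if v: "v \<in> Vh0 \<Omega> Th" for v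
  proof -
    have vV: "v \<in> Vh \<Omega> Th" using v Vh0_subset by blast
    have vd: "vol T * div_value v T = (\<Sum>e | e facet_of T. area e * (face_value v e * face_sign T e))"
      if "T \<in> Th" for T
      using vol_pos[OF that] by (simp add: div_value_def mult.assoc)
    \<comment> \<open>The total divergence is the flux through the boundary, which is zero for
      \<open>v\<close> in \<open>Vh0\<close>; hence subtracting \<open>m\<close> to reach zero mean
      does not change \<open>b\<close>.\<close>
    have "(\<Sum>T\<in>Th. vol T * div_value v T) = 0"
      using balanced_sum[of v area] v by (simp add: vd)
    then have z: "(\<Sum>T\<in>Th. m * (vol T * div_value v T)) = 0" by (simp flip: sum_distrib_left)
    have "b_form \<Omega> Th ne v p = (\<Sum>T\<in>Th. vol T * div_value v T * k T)"
      by (rule b_form_eq[OF vV p])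
    also have "\<dots> = (\<Sum>T\<in>Th. c T * div_value v T - m * (vol T * div_value v T))"
    proof (rule sum.cong[OF refl])
      fix T assume "T \<in> Th"
      have "vol T * div_value v T * k T = (vol T * k T) * div_value v T" by simp
      then show "vol T * div_value v T * k T = c T * div_value v T - m * (vol T * div_value v T)"
        unfolding volk[OF \<open>T \<in> Th\<close>] by (simp add: left_diff_distrib)
    qed
    also have "\<dots> = ?E v" unfolding sum_subtractf z using c[OF v] by simp
    finally show ?thesis .
  qed
  have uD: "u \<in> Dh \<Omega> Th ne"
  proof -
    have "AE x in lebesgue_on \<Omega>. div_m Th ne u x = 0"
      using u by (intro AE_domain) (simp add: div_m_eq[OF uV] V_def)
    then show ?thesis using u0 by (simp add: Dh_def)
  qed
  have bu: "b_form \<Omega> Th ne u q = 0" if "q \<in> Wh0 \<Omega> Th" for q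
  proof -
    have "\<forall>T\<in>Th. \<exists>c. \<forall>x\<in>interior T. q x = c" using that by (simp add: Wh0_def piecewise_const_def)
    then obtain k where "\<forall>T\<in>Th. \<forall>x\<in>interior T. q x = k T" by metis
    then have "b_form \<Omega> Th ne u q = (\<Sum>T\<in>Th. vol T * div_value u T * k T)"
      by (intro b_form_eq[OF uV]) simp
    also have "\<dots> = 0" using u by (intro sum.neutral) (simp add: V_def)
    finally show ?thesis .
  qed
  have mom: "a_form crs \<nu> \<Omega> Th ne u v + c_form ccrs \<Omega> Th ne u u v - b_form \<Omega> Th ne v p =
      inner_L2 (lebesgue_on \<Omega>) f (RT_interp \<Omega> Th ne v)" if v: "v \<in> Vh0 \<Omega> Th" for v
  proof -
    have vV: "v \<in> Vh \<Omega> Th" using v Vh0_subset by blast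
    show ?thesis
      unfolding a_form_eq[OF uV vV] c_form_eq[OF uV uV vV] load_eq[OF vV] bp[OF v] by simp
  qed
  show ?thesis
    using uD pW u0 mom bu unfolding discrete_solution_def by (intro bexI[of _ u] bexI[of _ p]) auto
qed

end

section \<open>The cases of two and three dimensions\<close>

text \<open>A derivative depends on a neighbourhood only, so it is enough that \<open>w\<close> is
  affine on an open set around \<open>x\<close>.\<close>

lemma pdiff_affine:
  fixes A :: "real^'d::finite^'d" and w :: "real^'d \<Rightarrow> real^'d"
  assumes S: "open S" "x \<in> S" and w: "\<And>y. y \<in> S \<Longrightarrow> w y = A *v y + c"
  shows "pdiff j (\<lambda>y. w y $ i) x = A $ i $ j"
proof -
  have "((\<lambda>y. A $ i \<bullet> y + c $ i) has_derivative (\<lambda>y. A $ i \<bullet> y)) (at x)"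
    by (auto intro!: derivative_eq_intros)
  then have "((\<lambda>y. w y $ i) has_derivative (\<lambda>y. A $ i \<bullet> y)) (at x)"
    by (rule has_derivative_transform_within_open[OF _ S]) (simp add: w matrix_vector_mul_component)
  then have "frechet_derivative (\<lambda>y. w y $ i) (at x) = (\<lambda>y. A $ i \<bullet> y)"
    by (rule frechet_derivative_at[symmetric])
  then show ?thesis by (simp add: pdiff_def inner_axis)
qed

lemma cross2_inner:
  assumes "norm n = 1"
  shows "cross2 n a \<bullet> cross2 n b = a \<bullet> b - (n \<bullet> a) * (n \<bullet> b)"
proof -
  have "n $ 1 * n $ 1 + n $ 2 * n $ 2 = 1"
    using assms by (simp add: norm_eq_1 inner_vec_def sum_2)
  \<comment> \<open>Inserting the factor \<open>1\<close>, the squared length of \<open>n\<close>,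
    turns the claim into a polynomial identity.\<close>
  then have "a \<bullet> b = (n $ 1 * n $ 1 + n $ 2 * n $ 2) * (a \<bullet> b)" by simp
  then show ?thesis by (simp add: cross2_def inner_vec_def sum_2 algebra_simps)
qed

lemma cross3_inner:
  assumes "norm n = 1"
  shows "cross3 n a \<bullet> cross3 n b = a \<bullet> b - (n \<bullet> a) * (n \<bullet> b)"
  using assms by (simp add: dot_cross norm_eq_1 inner_commute)

text \<open>The curl of an affine field with Jacobian \<open>A\<close>, applied to the rotation of
  \<open>y\<close> by a right angle; orthogonality to \<open>y\<close> comes from this
  rotation.\<close>

definition curl_matrix2 :: "real^2^2 \<Rightarrow> real^2 \<Rightarrow> real^2" where
  "curl_matrix2 A y = (A $ 2 $ 1 - A $ 1 $ 2) *\<^sub>R vector [- (y $ 2), y $ 1]"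

definition curl_matrix3 :: "real^3^3 \<Rightarrow> real^3 \<Rightarrow> real^3" where
  "curl_matrix3 A y = cross3 (vector [A $ 3 $ 2 - A $ 2 $ 3, A $ 1 $ 3 - A $ 3 $ 1, A $ 2 $ 1 - A $ 1 $ 2]) y"

lemma fem_problem_2:
  assumes "\<nu> > 0" "lipschitz_domain \<Omega>" "shape_regular_mesh \<gamma> \<Omega> Th" "face_normals Th ne" "L2 (lebesgue_on \<Omega>) f"
  shows "fem_problem \<Omega> Th ne cross2 curl_cross2 curl_matrix2 \<nu> f"
proof (intro fem_problem.intro fem_mesh.intro fem_problem_axioms.intro)
  show "linear (\<lambda>A. curl_matrix2 A y)" for y
    by (rule linearI) (simp_all add: curl_matrix2_def algebra_simps scaleR_add_left scaleR_diff_left)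
  show "linear (curl_matrix2 A)" for A
    by (rule linearI) (simp_all add: curl_matrix2_def vec_eq_iff forall_2 algebra_simps)
  show "curl_matrix2 A y \<bullet> y = 0" for A y
    by (simp add: curl_matrix2_def inner_vec_def sum_2)
  show "curl_cross2 w z x = curl_matrix2 A (z x)"
    if "open S" "x \<in> S" "\<And>y. y \<in> S \<Longrightarrow> w y = A *v y + c" for S x w A c z
    by (simp add: curl_cross2_def curl2_def curl_matrix2_def pdiff_affine[OF that])
qed (use assms in \<open>auto simp: shape_regular_mesh_def cross2_inner[unfolded inner_real_def]\<close>)

lemma fem_problem_3:
  assumes "\<nu> > 0" "lipschitz_domain \<Omega>" "shape_regular_mesh \<gamma> \<Omega> Th" "face_normals Th ne" "L2 (lebesgue_on \<Omega>) f"
  shows "fem_problem \<Omega> Th ne cross3 curl_cross3 curl_matrix3 \<nu> f"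
proof (intro fem_problem.intro fem_mesh.intro fem_problem_axioms.intro)
  show "linear (\<lambda>A. curl_matrix3 A y)" for y
    by (rule linearI) (simp_all add: curl_matrix3_def cross3_def vec_eq_iff forall_3 algebra_simps)
  show "linear (curl_matrix3 A)" for A
    by (rule linearI) (simp_all add: curl_matrix3_def cross3_def vec_eq_iff forall_3 algebra_simps)
  show "curl_matrix3 A y \<bullet> y = 0" for A y
    by (simp add: curl_matrix3_def dot_cross_self)
  show "curl_cross3 w z x = curl_matrix3 A (z x)"
    if "open S" "x \<in> S" "\<And>y. y \<in> S \<Longrightarrow> w y = A *v y + c" for S x w A c z
    by (simp add: curl_cross3_def curl3_def curl_matrix3_def pdiff_affine[OF that])
qed (use assms in \<open>auto simp: shape_regular_mesh_def cross3_inner\<close>)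

theorem theorem3p1:
  fixes \<nu> \<gamma> :: real
  assumes "\<nu> > 0"
  shows
    "(\<forall>(\<Omega> :: (real^2) set) Th ne f.
        lipschitz_domain \<Omega> \<longrightarrow> shape_regular_mesh \<gamma> \<Omega> Th \<longrightarrow> face_normals Th ne \<longrightarrow>
        L2 (lebesgue_on \<Omega>) f \<longrightarrow>
        (\<exists>u\<in>Dh \<Omega> Th ne. \<exists>p\<in>Wh0 \<Omega> Th.
           discrete_solution cross2 curl_cross2 \<nu> \<Omega> Th ne f u p)) \<and>
     (\<forall>(\<Omega> :: (real^3) set) Th ne f.
        lipschitz_domain \<Omega> \<longrightarrow> shape_regular_mesh \<gamma> \<Omega> Th \<longrightarrow> face_normals Th ne \<longrightarrow>
        L2 (lebesgue_on \<Omega>) f \<longrightarrow>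
        (\<exists>u\<in>Dh \<Omega> Th ne. \<exists>p\<in>Wh0 \<Omega> Th.
           discrete_solution cross3 curl_cross3 \<nu> \<Omega> Th ne f u p))"
  using fem_problem.discrete_problem_solvable[OF fem_problem_2[OF assms]]
    fem_problem.discrete_problem_solvable[OF fem_problem_3[OF assms]] by blast

end
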